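(* Let $\delta\in(0,1)$ and let $m,n\in\mathbb{N}$ (so $m\ge 1$) satisfy $$m=\left\lfloor\frac{n}{48(\sqrt{2}\ln(2n)-\ln\delta)}\right\rfloor .$$ Then for every $d\in\mathbb N$, $$e^{\rm avg}(n,d;\Lambda^{\rm std})\le\Big(1+\frac{4m}{n}\Big)^{1/2}\frac{1}{\sqrt{1-\delta}}\,e^{\rm avg}(m,d;\Lambda^{\rm all}).$$
   Context: Setting (average case approximation). For each $d\in\mathbb N$: $D_d\subset\mathbb R^d$ is a Borel set of positive Lebesgue measure, $\rho_d$ is a probability density on $D_d$, and $G_d=L_2(D_d,\rho_d(x)\,dx)$. $F_d$ is a separable Banach space of real-valued functions on $D_d$, continuously embedded in $G_d$, such that every point evaluation $f\mapsto f(x)$, $x\in D_d$, is a continuous linear functional on $F_d$; $F_d$ carries a zero-mean Gaussian measure $\mu_d$. ${\rm APP}_d:F_d\to G_d$, ${\rm APP}_d f=f$. $\Lambda^{\rm all}$ is the class of all continuous linear functionals on $F_d$, $\Lambda^{\rm std}$ the class of point evaluations. For $\Lambda\in\{\Lambda^{\rm all},\Lambda^{\rm std}\}$, an algorithm is $A_{n,d}f=\phi_{n,d}(L_1(f),\dots,L_n(f))$ with $L_i\in\Lambda$ and $\phi_{n,d}:\mathbb R^n\to G_d$ measurable; its average case error is $e^{\rm avg}(A_{n,d})=\big(\int_{F_d}\|f-A_{n,d}f\|_{G_d}^2\,\mu_d(df)\big)^{1/2}$, and $e^{\rm avg}(n,d;\Lambda)$ is the infimum of $e^{\rm avg}(A_{n,d})$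 over all such algorithms using $n$ functionals from $\Lambda$ (for $n=0$, $A_{0,d}=0$). *)

theory Defs
  imports "HOL-Probability.Probability"
begin

definition Gnorm2 :: "'a::euclidean_space set \<Rightarrow> ('a \<Rightarrow> real) \<Rightarrow> ('a \<Rightarrow> real) \<Rightarrow> ennreal" where
  "Gnorm2 D \<rho> h = (\<integral>\<^sup>+ x\<in>D. ennreal ((h x)\<^sup>2 * \<rho> x) \<partial>lborel)"

definition in_G :: "'a::euclidean_space set \<Rightarrow> ('a \<Rightarrow> real) \<Rightarrow> ('a \<Rightarrow> real) \<Rightarrow> bool" where
  "in_G D \<rho> h \<longleftrightarrow> (\<lambda>x. indicator D x * h x) \<in> borel_measurable lborel \<and> Gnorm2 D \<rho> h < \<infinity>"

definition prob_density_on :: "'a::euclidean_space set \<Rightarrow> ('a \<Rightarrow> real) \<Rightarrow> bool" where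
  "prob_density_on D \<rho> \<longleftrightarrow> (\<lambda>x. indicator D x * \<rho> x) \<in> borel_measurable lborel
     \<and> (\<forall>x\<in>D. 0 \<le> \<rho> x) \<and> (\<integral>\<^sup>+ x\<in>D. ennreal (\<rho> x) \<partial>lborel) = 1"

definition gaussian_measure :: "'f::real_normed_vector measure \<Rightarrow> bool" where
  "gaussian_measure \<mu> \<longleftrightarrow> sets \<mu> = sets borel \<and> prob_space \<mu> \<and>
     (\<forall>L::'f \<Rightarrow> real. bounded_linear L \<longrightarrow>
        distr \<mu> lborel L = return lborel 0 \<or>
        (\<exists>\<sigma>>0. distr \<mu> lborel L = density lborel (normal_density 0 \<sigma>)))"

text \<open>The standing setting for one fixed d: F is the separable Banach space (type 'f),
  realised as functions on D via pe.\<close>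
definition avg_setting ::
  "'a::euclidean_space set \<Rightarrow> ('a \<Rightarrow> real) \<Rightarrow> ('f::{banach,second_countable_topology} \<Rightarrow> 'a \<Rightarrow> real)
    \<Rightarrow> 'f measure \<Rightarrow> bool" where
  "avg_setting D \<rho> pe \<mu> \<longleftrightarrow>
     D \<in> sets lborel \<and> emeasure lborel D > 0 \<and> prob_density_on D \<rho> \<and>
     (\<forall>x\<in>D. bounded_linear (\<lambda>f. pe f x)) \<and>
     (\<forall>f g. (\<forall>x\<in>D. pe f x = pe g x) \<longrightarrow> f = g) \<and>
     (\<forall>f. in_G D \<rho> (pe f)) \<and>
     (\<exists>C. \<forall>f. Gnorm2 D \<rho> (pe f) \<le> ennreal (C * (norm f)\<^sup>2)) \<and>
     (\<forall>f. Gnorm2 D \<rho> (pe f) = 0 \<longrightarrow> f = 0) \<and>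
     gaussian_measure \<mu>"

definition Lambda_all :: "('f::real_normed_vector \<Rightarrow> real) set" where
  "Lambda_all = {L. bounded_linear L}"

definition Lambda_std :: "'a set \<Rightarrow> ('f \<Rightarrow> 'a \<Rightarrow> real) \<Rightarrow> ('f \<Rightarrow> real) set" where
  "Lambda_std D pe = {(\<lambda>f. pe f x) | x. x \<in> D}"

definition ennsqrt :: "ennreal \<Rightarrow> ennreal" where
  "ennsqrt e = (if e = \<infinity> then \<infinity> else ennreal (sqrt (enn2real e)))"

definition alg_err ::
  "'a::euclidean_space set \<Rightarrow> ('a \<Rightarrow> real) \<Rightarrow> ('f \<Rightarrow> 'a \<Rightarrow> real) \<Rightarrow> 'f measure \<Rightarrow> nat
    \<Rightarrow> (nat \<Rightarrow> 'f \<Rightarrow> real) \<Rightarrow> ((nat \<Rightarrow> real) \<Rightarrow> 'a \<Rightarrow> real) \<Rightarrow> ennreal" where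
  "alg_err D \<rho> pe \<mu> n Ls \<phi> =
     ennsqrt (\<integral>\<^sup>+ f. Gnorm2 D \<rho> (\<lambda>x. pe f x - \<phi> (\<lambda>i\<in>{..<n}. Ls i f) x) \<partial>\<mu>)"

text \<open>Admissible algorithms: n functionals from the class, phi : R^n -> G measurable
  (jointly measurable representative, each phi y in G).\<close>
definition admissible ::
  "'a::euclidean_space set \<Rightarrow> ('a \<Rightarrow> real) \<Rightarrow> nat \<Rightarrow> ('f \<Rightarrow> real) set
    \<Rightarrow> (nat \<Rightarrow> 'f \<Rightarrow> real) \<Rightarrow> ((nat \<Rightarrow> real) \<Rightarrow> 'a \<Rightarrow> real) \<Rightarrow> bool" where
  "admissible D \<rho> n \<Lambda> Ls \<phi> \<longleftrightarrow>
     (\<forall>i<n. Ls i \<in> \<Lambda>) \<and>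
     (\<lambda>(y, x). \<phi> y x) \<in> borel_measurable (PiM {..<n} (\<lambda>_. lborel) \<Otimes>\<^sub>M lborel) \<and>
     (\<forall>y\<in>space (PiM {..<n} (\<lambda>_. (lborel::real measure))). in_G D \<rho> (\<phi> y))"

definition e_avg ::
  "'a::euclidean_space set \<Rightarrow> ('a \<Rightarrow> real) \<Rightarrow> ('f \<Rightarrow> 'a \<Rightarrow> real) \<Rightarrow> 'f measure \<Rightarrow> nat
    \<Rightarrow> ('f \<Rightarrow> real) set \<Rightarrow> ennreal" where
  "e_avg D \<rho> pe \<mu> n \<Lambda> =
     (if n = 0 then alg_err D \<rho> pe \<mu> 0 (\<lambda>_ _. 0) (\<lambda>_ _. 0)
      else (INF p \<in> {(Ls, \<phi>). admissible D \<rho> n \<Lambda> Ls \<phi>}. alg_err D \<rho> pe \<mu> n (fst p) (snd p)))"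

end

theory Submission
  imports Defs
begin

text \<open>
  Lower bound. Let \<open>L\<^sub>1, \<dots>, L\<^sub>m\<close> be the functionals of a competing algorithm. For fixed \<open>x\<close> the Gaussian
  variable \<open>f(x)\<close> minus its linear regression on the \<open>L\<^sub>j f\<close> is orthogonal to every square-integrable
  function of the \<open>L\<^sub>j f\<close>, so the algorithm may be replaced by a linear one, and its error dominates the
  mean squared distance of \<open>f\<close> to a subspace \<open>V\<close> of \<open>G\<close> with \<open>r = dim V \<le> m\<close>.

  Upper bound. Let \<open>e\<^sub>1, \<dots>, e\<^sub>r\<close> be an orthonormal basis of \<open>V\<close> and draw \<open>n\<close> independent points with
  density \<open>(\<Sum>\<^sub>k |e\<^sub>k|\<^sup>2) / r\<close>. On the event that the weighted Gram matrix is at least \<open>1/2\<close>, weighted least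
  squares on \<open>V\<close> adds to the squared distance at most four times a noise term of mean \<open>r/n\<close> times that
  distance; this event has probability at least \<open>1 - \<delta>\<close>, so some points satisfy the bound.

  Concentration. The Gram matrix is \<open>r/n\<close> times a sum of independent \<open>u u\<^sup>T\<close> with \<open>|u| \<le> 1\<close> and
  \<open>E u u\<^sup>T = I/r\<close>. Instead of a matrix exponential, the smallest eigenvalue is controlled by the
  potential \<open>tr R\<^sup>p\<close>, where \<open>R\<close> is the inverse of \<open>c I + \<Sum> u u\<^sup>T\<close>, \<open>c = n/r\<close> and \<open>p\<close> about \<open>c/2\<close>: its expected decrease under
  a rank-one update follows from Sherman--Morrison and the log-convexity of \<open>q \<mapsto> u\<^sup>T R\<^sup>q u\<close>, and Markov's
  inequality replaces the matrix Chernoff bound.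
\<close>

section \<open>Powers of positive semidefinite operators under rank-one updates\<close>

text \<open>The shift c I makes the inverse exist before any point is drawn and keeps u^T R u \<le>
  1/c, so that each rank-one update is a small perturbation. For p + 1 \<le> c/2 the second-order
  loss eats at most a quarter of the first-order gain, hence \<kappa> = 1 - (p + 1)/(2c) \<ge> 3/4.
  After n = c r draws the expected trace is at most r ((1 + \<kappa>) c)^-p. The Gram bound 1/2
  corresponds to the level z = 3c/2, shift included, and it can fail only if tr R^p > z^-p, which
  has probability at most r (6/7)^p. As p is about c/2, a fixed multiple of ln(n/\<delta>) brings
  this below \<delta>; the stated 48 is ample. The noise is never conditioned on the good event. Its
  mean is taken over all samples, and only the left side is restricted to the event, which gives (1
  - \<delta>) times the squared minimal error and explains 1/sqrt(1 - \<delta>). One point set has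
  to serve all f, so the averages over f and over points are exchanged. Point values of the residual
  enter, so functions rather than L2 classes are used, and joint measurability in (f, x) has to be
  derived from continuity of point evaluations.\<close>

text \<open>Vectors of \<open>\<real>\<^sup>r\<close> are functions on \<^typ>\<open>nat\<close> of which only the first \<open>r\<close> entries count, because the
  dimension \<open>r\<close> comes out of the proof and cannot be a type.\<close>

definition ip :: "nat \<Rightarrow> (nat \<Rightarrow> real) \<Rightarrow> (nat \<Rightarrow> real) \<Rightarrow> real" where
  "ip r x y = (\<Sum>k<r. x k * y k)"

definition unitv :: "nat \<Rightarrow> nat \<Rightarrow> real" where
  "unitv i = (\<lambda>k. if k = i then 1 else 0)"

definition psd_op :: "nat \<Rightarrow> ((nat \<Rightarrow> real) \<Rightarrow> nat \<Rightarrow> real) \<Rightarrow> bool" where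
  "psd_op r R \<longleftrightarrow>
     (\<forall>a x y. R (\<lambda>k. x k + a * y k) = (\<lambda>k. R x k + a * R y k)) \<and>
     (\<forall>x y. ip r x (R y) = ip r (R x) y) \<and> (\<forall>x. 0 \<le> ip r x (R x))"

definition trp :: "nat \<Rightarrow> ((nat \<Rightarrow> real) \<Rightarrow> nat \<Rightarrow> real) \<Rightarrow> nat \<Rightarrow> real" where
  "trp r R q = (\<Sum>i<r. ip r (unitv i) ((R ^^ q) (unitv i)))"

section \<open>Inner products and moments of positive semidefinite operators\<close>

lemma ip_commute: "ip r x y = ip r y x"
  by (simp add: ip_def mult.commute)

lemma ip_add_scale: "ip r x (\<lambda>k. y k + a * z k) = ip r x y + a * ip r x z"
  by (simp add: ip_def algebra_simps sum.distrib sum_distrib_left)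

lemma ip_add_scale_left: "ip r (\<lambda>k. y k + a * z k) x = ip r y x + a * ip r z x"
  by (simp add: ip_commute[of r _ x] ip_add_scale)

lemma ip_diff_scale: "ip r x (\<lambda>k. y k - a * z k) = ip r x y - a * ip r x z"
  using ip_add_scale[of r x y "-a" z] by simp

lemma ip_self_nonneg: "0 \<le> ip r x x"
  by (simp add: ip_def sum_nonneg)

lemma ip_unitv: "i < r \<Longrightarrow> ip r (unitv i) x = x i"
  by (simp add: ip_def unitv_def if_distrib[where f="\<lambda>t. t * _"] sum.delta cong: if_cong)

lemma ip_expand: "(\<Sum>i<r. ip r (unitv i) x * ip r (unitv i) y) = ip r x y"
proof -
  have "(\<Sum>i<r. ip r (unitv i) x * ip r (unitv i) y) = (\<Sum>i<r. x i * y i)"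
    by (intro sum.cong) (simp_all add: ip_unitv)
  then show ?thesis by (simp add: ip_def)
qed

lemma discriminant_nonneg_imp:
  fixes a b c :: real
  assumes "\<And>t. 0 \<le> a + 2 * t * b + t\<^sup>2 * c" and "0 \<le> c"
  shows "b\<^sup>2 \<le> a * c"
proof (cases "c = 0")
  case True
  have "b = 0"
  proof (rule ccontr)
    assume "b \<noteq> 0"
    \<comment> \<open>For this \<open>t\<close> the linear function equals a - 2(|a| + 1), which is
      negative.\<close>
    have "0 \<le> a + 2 * (-(\<bar>a\<bar> + 1) / b) * b" using assms(1)[of "-(\<bar>a\<bar> + 1) / b"] True by simp
    then show False using \<open>b \<noteq> 0\<close> by simp
  qed
  then show ?thesis using True by simp
next
  case False
  then have c: "c > 0" using assms by simp
  \<comment> \<open>The minimiser of the quadratic in \<open>t\<close>.\<close>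
  have "0 \<le> a + 2 * (-b/c) * b + (-b/c)\<^sup>2 * c" by (rule assms)
  also have "\<dots> = a - b\<^sup>2 / c" using c by (simp add: field_simps power2_eq_square)
  finally show ?thesis using c by (simp add: field_simps)
qed

lemma psd_Cauchy_Schwarz:
  assumes "psd_op r R"
  shows "(ip r x (R y))\<^sup>2 \<le> ip r x (R x) * ip r y (R y)"
proof (rule discriminant_nonneg_imp)
  fix t :: real
  have sym: "ip r y (R x) = ip r x (R y)"
    using assms unfolding psd_op_def by (metis ip_commute)
  have "0 \<le> ip r (\<lambda>k. x k + t * y k) (R (\<lambda>k. x k + t * y k))"
    using assms unfolding psd_op_def by blast
  also have "\<dots> = ip r x (R x) + 2 * t * ip r x (R y) + t\<^sup>2 * ip r y (R y)"
    using assms sym unfolding psd_op_def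
    by (simp add: ip_add_scale ip_add_scale_left algebra_simps power2_eq_square)
  finally show "0 \<le> ip r x (R x) + 2 * t * ip r x (R y) + t\<^sup>2 * ip r y (R y)" .
qed (use assms in \<open>auto simp: psd_op_def\<close>)

lemma psd_opD:
  assumes "psd_op r R"
  shows psd_op_linear: "R (\<lambda>k. x k + a * y k) = (\<lambda>k. R x k + a * R y k)"
    and psd_op_sym: "ip r x (R y) = ip r (R x) y"
    and psd_op_nonneg: "0 \<le> ip r x (R x)"
  using assms unfolding psd_op_def by blast+

lemma psd_op_power_sym:
  assumes "psd_op r R"
  shows "ip r x ((R ^^ q) y) = ip r ((R ^^ q) x) y"
proof (induction q arbitrary: x y)
  case (Suc q)
  have "ip r x ((R ^^ Suc q) y) = ip r (R x) ((R ^^ q) y)"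
    using assms by (simp add: psd_op_def)
  also have "\<dots> = ip r ((R ^^ q) (R x)) y" by (rule Suc)
  finally show ?case by (simp add: funpow_swap1)
qed simp

lemma psd_op_power_linear:
  assumes "psd_op r R"
  shows "(R ^^ q) (\<lambda>k. x k + a * y k) = (\<lambda>k. (R ^^ q) x k + a * (R ^^ q) y k)"
  by (induction q) (use assms in \<open>auto simp: psd_op_def\<close>)

lemma psd_op_power_split:
  assumes "psd_op r R"
  shows "ip r x ((R ^^ (a + b)) y) = ip r ((R ^^ a) x) ((R ^^ b) y)"
  using psd_op_power_sym[OF assms, of x a] by (simp add: funpow_add)

text \<open>In place of a spectral theorem, the power is split symmetrically: R^(2k) gives |R^k
  x|^2, and R^(2k+1) leaves the form of \<open>R\<close> at R^k x.\<close>

lemma psd_op_power: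
  assumes "psd_op r R"
  shows "psd_op r (R ^^ q)"
proof -
  have "0 \<le> ip r x ((R ^^ q) x)" for x
  proof (cases "even q")
    case True
    then obtain k where "q = k + k" by (metis evenE mult_2)
    then show ?thesis by (simp add: psd_op_power_split[OF assms] ip_self_nonneg)
  next
    case False
    then obtain k where q: "q = k + Suc k" by (metis add_Suc_right mult_2 oddE Suc_eq_plus1)
    have "ip r x ((R ^^ q) x) = ip r ((R ^^ k) x) (R ((R ^^ k) x))"
      unfolding q psd_op_power_split[OF assms] by simp
    then show ?thesis using psd_op_nonneg[OF assms] by simp
  qed
  then show ?thesis
    using psd_op_power_linear[OF assms] psd_op_power_sym[OF assms] by (simp add: psd_op_def)
qed

text \<open>Write q = b + 2k with b the parity of q; then this is Cauchy-Schwarz for the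
  semidefinite form of R^b at R^k x and R^(k+1) x.\<close>

lemma psd_moment_log_convex:
  assumes "psd_op r R"
  shows "(ip r x ((R ^^ Suc q) x))\<^sup>2 \<le> ip r x ((R ^^ q) x) * ip r x ((R ^^ Suc (Suc q)) x)"
proof -
  obtain b k where q: "q = b + 2 * k" and b: "b = 0 \<or> b = 1"
    by (metis add.commute mod_div_mult_eq mult.commute parity_cases)
  have *: "ip r ((R^^i) x) ((R ^^ b) ((R^^j) x)) = ip r x ((R ^^ (b + i + j)) x)" for i j
    using psd_op_power_split[OF assms, of x i "b + j" x] by (simp add: funpow_add add_ac)
  have "(ip r ((R^^k) x) ((R ^^ b) ((R^^Suc k) x)))\<^sup>2
     \<le> ip r ((R^^k) x) ((R ^^ b) ((R^^k) x)) * ip r ((R^^Suc k) x) ((R ^^ b) ((R^^Suc k) x))"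
    by (rule psd_Cauchy_Schwarz[OF psd_op_power[OF assms]])
  then show ?thesis unfolding * q by (simp add: mult_2 add_ac)
qed

section \<open>Log-convex sequences\<close>

text \<open>The ratio s(k+1)/s(k) is nondecreasing. The cross-multiplied form admits zeros, which
  occur for instance for the moments at the zero vector.\<close>

lemma log_convex_ratio:
  fixes s :: "nat \<Rightarrow> real"
  assumes nn: "\<And>k. 0 \<le> s k" and lc: "\<And>k. (s (Suc k))\<^sup>2 \<le> s k * s (Suc (Suc k))"
  shows "s (Suc i) * s (i + j) \<le> s i * s (Suc (i + j))"
proof (induction j)
  case (Suc j)
  let ?n = "i + j"
  show ?case
  proof (cases "s (Suc ?n) = 0 \<or> s ?n = 0")
    case True
    \<comment> \<open>By log-convexity a zero at \<open>?n\<close> forces one at the next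
      index.\<close>
    then have "s (Suc ?n) = 0" using lc[of ?n] by auto
    then show ?thesis using nn by simp
  next
    case False
    then have pos: "s (Suc ?n) > 0" "s ?n > 0" using nn by (metis less_eq_real_def)+
    have "(s (Suc i) * s (Suc ?n)) * s ?n = (s (Suc i) * s ?n) * s (Suc ?n)" by simp
    also have "\<dots> \<le> (s i * s (Suc ?n)) * s (Suc ?n)" using Suc pos by (intro mult_right_mono) auto
    also have "\<dots> \<le> s i * (s ?n * s (Suc (Suc ?n)))"
      using lc[of ?n] nn[of i] by (simp add: power2_eq_square mult_left_mono mult.assoc)
    finally have "(s (Suc i) * s (Suc ?n)) * s ?n \<le> (s i * s (Suc (Suc ?n))) * s ?n"
      by (simp add: ac_simps)
    then show ?thesis using pos by simp
  qed
qed simp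

text \<open>Monotone ratios make the product grow when the two indices are spread apart with fixed
  sum; the spreading stops once the smaller one is 1. In the application \<open>s 1\<close> is the
  small quantity u^T R u.\<close>

lemma log_convex_prod_le:
  fixes s :: "nat \<Rightarrow> real"
  assumes nn: "\<And>k. 0 \<le> s k" and lc: "\<And>k. (s (Suc k))\<^sup>2 \<le> s k * s (Suc (Suc k))"
    and "i \<le> j"
  shows "s (Suc i) * s (Suc j) \<le> s 1 * s (Suc (i + j))"
  using \<open>i \<le> j\<close>
proof (induction i arbitrary: j)
  case (Suc i)
  have "s (Suc (Suc i)) * s (Suc j) \<le> s (Suc i) * s (Suc (Suc j))"
    using log_convex_ratio[where s=s, OF nn lc, of "Suc i" "j - i"] Suc.prems by simp
  also have "\<dots> \<le> s 1 * s (Suc (i + Suc j))"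
    using Suc.prems by (intro Suc.IH) simp
  finally show ?case by simp
qed simp

lemma log_convex_prod:
  fixes s :: "nat \<Rightarrow> real"
  assumes "\<And>k. 0 \<le> s k" and "\<And>k. (s (Suc k))\<^sup>2 \<le> s k * s (Suc (Suc k))"
  shows "s (Suc i) * s (Suc j) \<le> s 1 * s (Suc (i + j))"
  using log_convex_prod_le[where s=s, OF assms, of i j] log_convex_prod_le[where s=s, OF assms, of j i]
  by (cases "i \<le> j") (simp_all add: mult.commute add.commute)

text \<open>Roots turn each hypothesis into a bound by a product of two square roots, and
  Cauchy-Schwarz over \<open>I\<close> adds these up. In this way the trace inherits log-convexity
  from the diagonal moments.\<close>

lemma log_convex_sum:
  fixes s :: "'i \<Rightarrow> nat \<Rightarrow> real"
  assumes nn: "\<And>i k. 0 \<le> s i k" and lc: "\<And>i k. (s i (Suc k))\<^sup>2 \<le> s i k * s i (Suc (Suc k))"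
  shows "(\<Sum>i\<in>I. s i (Suc k))\<^sup>2 \<le> (\<Sum>i\<in>I. s i k) * (\<Sum>i\<in>I. s i (Suc (Suc k)))"
proof -
  have "(\<Sum>i\<in>I. s i (Suc k)) \<le> (\<Sum>i\<in>I. sqrt (s i k) * sqrt (s i (Suc (Suc k))))"
  proof (rule sum_mono)
    fix i
    show "s i (Suc k) \<le> sqrt (s i k) * sqrt (s i (Suc (Suc k)))"
      using lc[of i k] by (simp add: real_le_rsqrt flip: real_sqrt_mult)
  qed
  then have "(\<Sum>i\<in>I. s i (Suc k))\<^sup>2 \<le> (\<Sum>i\<in>I. sqrt (s i k) * sqrt (s i (Suc (Suc k))))\<^sup>2"
    by (intro power_mono) (auto intro: sum_nonneg nn)
  also have "\<dots> \<le> (\<Sum>i\<in>I. (sqrt (s i k))\<^sup>2) * (\<Sum>i\<in>I. (sqrt (s i (Suc (Suc k))))\<^sup>2)"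
    by (rule Cauchy_Schwarz_ineq_sum)
  finally show ?thesis by (simp add: nn)
qed

lemma trp_nonneg: "psd_op r R \<Longrightarrow> 0 \<le> trp r R q"
  unfolding trp_def by (intro sum_nonneg psd_op_nonneg psd_op_power)

lemma trp_log_convex:
  assumes "psd_op r R"
  shows "(trp r R (Suc q))\<^sup>2 \<le> trp r R q * trp r R (Suc (Suc q))"
  unfolding trp_def
  by (rule log_convex_sum) (rule psd_op_nonneg[OF psd_op_power[OF assms]] psd_moment_log_convex[OF assms])+

text \<open>For \<open>s q = tr R\<^sup>q\<close> this is the tangent at \<open>y\<^sup>p\<close> of the convex function \<open>t \<mapsto> t powr (1 + 1/p)\<close>; it makes
  the recursion for the expected trace linear.\<close>

lemma log_convex_tangent:
  fixes s :: "nat \<Rightarrow> real"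
  assumes nn: "\<And>k. 0 \<le> s k" and lc: "\<And>k. (s (Suc k))\<^sup>2 \<le> s k * s (Suc (Suc k))"
    and y: "0 \<le> y"
  shows "real (Suc p) * y * s p \<le> real p * s (Suc p) + s 0 * y ^ Suc p"
proof (cases "s p = 0")
  case True then show ?thesis using nn y by simp
next
  case False
  then have sp: "s p > 0" using nn[of p] by (simp add: less_eq_real_def)
  \<comment> \<open>The last ratio dominates the earlier ones, so up to index \<open>p\<close> the
    sequence lies below the geometric one with ratio \<rho>; the claim is thereby reduced to the
    scalar inequality \<open>bern\<close>.\<close>
  define \<rho> where "\<rho> = s (Suc p) / s p"
  have \<rho>0: "\<rho> \<ge> 0" using nn sp by (simp add: \<rho>_def)
  have step: "s (Suc k) \<le> \<rho> * s k" if "k \<le> p" for k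
    using log_convex_ratio[where s=s, OF nn lc, of k "p - k"] that sp by (simp add: \<rho>_def field_simps)
  have le: "s k \<le> \<rho> ^ k * s 0" if "k \<le> p" for k
    using that
  proof (induction k)
    case (Suc k)
    have "s (Suc k) \<le> \<rho> * s k" using step Suc by simp
    also have "\<dots> \<le> \<rho> * (\<rho> ^ k * s 0)" using Suc \<rho>0 by (intro mult_left_mono) auto
    finally show ?case by simp
  qed simp
  have eq: "s (Suc p) = \<rho> * s p" using sp by (simp add: \<rho>_def)
  have bern: "real (Suc p) * y * \<rho> ^ p \<le> real p * \<rho> ^ Suc p + y ^ Suc p"
  proof (induction p)
    case (Suc p)
    have "real (Suc (Suc p)) * y * \<rho> ^ Suc p
        = real (Suc p) * \<rho> ^ Suc (Suc p) + (real (Suc p) * y * \<rho> ^ p - real p * \<rho> ^ Suc p) * y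
          - real (Suc p) * \<rho> ^ p * (\<rho> - y)\<^sup>2"
      by (simp add: algebra_simps power2_eq_square)
    also have "\<dots> \<le> real (Suc p) * \<rho> ^ Suc (Suc p) + y ^ Suc p * y - 0"
      using Suc.IH \<rho>0 y by (intro diff_mono add_left_mono mult_right_mono) auto
    finally show ?case by (simp add: mult.commute)
  qed simp
  show ?thesis
  \<comment> \<open>The bound of \<open>s p\<close> by \<open>\<rho> ^ p * s 0\<close> may be used
    only where its coefficient is nonnegative; in the other case the left side is already below the
    first term on the right.\<close>
  proof (cases "real (Suc p) * y \<le> real p * \<rho>")
    case True
    then have "real (Suc p) * y * s p \<le> real p * \<rho> * s p" using sp by (intro mult_right_mono) auto
    moreover have "0 \<le> s 0 * y ^ Suc p" using nn y by simp
    ultimately show ?thesis unfolding eq by simp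
  next
    case False
    then have "(real (Suc p) * y - real p * \<rho>) * s p \<le> (real (Suc p) * y - real p * \<rho>) * (\<rho> ^ p * s 0)"
      using le[of p] by (intro mult_left_mono) auto
    also have "\<dots> = (real (Suc p) * y * \<rho> ^ p - real p * \<rho> ^ Suc p) * s 0" by (simp add: algebra_simps)
    also have "\<dots> \<le> y ^ Suc p * s 0" using bern nn[of 0] by (intro mult_right_mono) auto
    finally show ?thesis unfolding eq by (simp add: algebra_simps)
  qed
qed


text \<open>Sherman--Morrison: if \<open>R\<close> inverts \<open>A\<close>, then \<open>rank1_inv r u R\<close> inverts \<open>A + u u\<^sup>T\<close>.\<close>

definition rank1_inv ::
  "nat \<Rightarrow> (nat \<Rightarrow> real) \<Rightarrow> ((nat \<Rightarrow> real) \<Rightarrow> nat \<Rightarrow> real) \<Rightarrow> (nat \<Rightarrow> real) \<Rightarrow> nat \<Rightarrow> real" where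
  "rank1_inv r u R y = (\<lambda>k. R y k - ip r u (R y) / (1 + ip r u (R u)) * R u k)"

section \<open>Sherman-Morrison updates and the decrease of the trace\<close>

lemma ip_rank1_inv:
  "ip r x (rank1_inv r u R y) = ip r x (R y) - ip r u (R y) / (1 + ip r u (R u)) * ip r x (R u)"
  unfolding rank1_inv_def by (rule ip_diff_scale)

lemma rank1_inv_self:
  assumes "psd_op r R"
  shows "ip r u (rank1_inv r u R y) = ip r u (R y) / (1 + ip r u (R u))"
  using psd_op_nonneg[OF assms, of u] unfolding ip_rank1_inv by (simp add: field_simps)

text \<open>With S the updated inverse, this is R - S = R u u^T S in weak form. Keeping S on the
  right-hand side lets the identity be iterated without denominators.\<close>

lemma rank1_inv_resolvent1:
  assumes "psd_op r R"
  shows "ip r x (rank1_inv r u R y) = ip r x (R y) - ip r u (rank1_inv r u R y) * ip r x (R u)"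
  unfolding rank1_inv_self[OF assms] by (rule ip_rank1_inv)

text \<open>For positivity, Cauchy-Schwarz gives (u, R x)^2 \<le> (u, R u) (x, R x), so the
  subtracted term (u, R x)^2 / (1 + (u, R u)) cannot exceed (x, R x).\<close>

lemma psd_op_rank1_inv:
  assumes "psd_op r R"
  shows "psd_op r (rank1_inv r u R)"
proof -
  note lin = psd_op_linear[OF assms] and sym = psd_op_sym[OF assms]
  have a: "ip r u (R u) \<ge> 0" by (rule psd_op_nonneg[OF assms])
  have "rank1_inv r u R (\<lambda>k. x k + a * y k) = (\<lambda>k. rank1_inv r u R x k + a * rank1_inv r u R y k)" for a x y
    by (simp add: rank1_inv_def lin ip_add_scale algebra_simps add_divide_distrib)
  moreover have "ip r x (rank1_inv r u R y) = ip r (rank1_inv r u R x) y" for x y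
    unfolding ip_commute[of r _ y] ip_rank1_inv
    using sym[of x y] sym[of u x] sym[of u y] sym[of x u] sym[of y u] by (simp add: ip_commute)
  moreover have "0 \<le> ip r x (rank1_inv r u R x)" for x
  proof -
    have "(ip r u (R x))\<^sup>2 \<le> ip r u (R u) * ip r x (R x)" by (rule psd_Cauchy_Schwarz[OF assms])
    also have "\<dots> \<le> (1 + ip r u (R u)) * ip r x (R x)"
      using psd_op_nonneg[OF assms, of x] by (simp add: algebra_simps)
    finally have "(ip r u (R x))\<^sup>2 / (1 + ip r u (R u)) \<le> ip r x (R x)" using a by (simp add: field_simps)
    moreover have "ip r x (R u) = ip r u (R x)" using sym[of x u] by (simp add: ip_commute)
    ultimately show ?thesis unfolding ip_rank1_inv by (simp add: power2_eq_square)
  qed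
  ultimately show ?thesis unfolding psd_op_def by blast
qed

lemma rank1_inv_le:
  assumes "psd_op r R"
  shows "ip r x (rank1_inv r u R x) \<le> ip r x (R x)"
proof -
  have "ip r x (R u) = ip r u (R x)" using psd_op_sym[OF assms, of x u] by (simp add: ip_commute)
  then show ?thesis
    unfolding ip_rank1_inv using psd_op_nonneg[OF assms, of u] by simp
qed

text \<open>The same difference in the other order, R - S = S u u^T R, suited to a product in which
  S stands to the left of R.\<close>

lemma rank1_inv_resolvent2:
  assumes "psd_op r R"
  shows "ip r x (R y) - ip r x (rank1_inv r u R y) = ip r u (R y) * ip r x (rank1_inv r u R u)"
  unfolding ip_rank1_inv using psd_op_nonneg[OF assms, of u] by (simp add: field_simps)

text \<open>The second identity iterates \<open>S = R - R u u\<^sup>T S\<close>; it expresses the mixed moments in the telescoping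
  of \<open>tr R\<^sup>p - tr S\<^sup>p\<close> through moments of \<open>R\<close> and \<open>S\<close> alone.\<close>

lemma rank1_inv_power_le:
  assumes R: "psd_op r R"
  shows "ip r u ((rank1_inv r u R ^^ q) u) \<le> ip r u ((R ^^ q) u)"
    and "ip r u ((R ^^ a) ((rank1_inv r u R ^^ b) u)) =
      ip r u ((R ^^ (a + b)) u) -
      (\<Sum>j<b. ip r u ((R ^^ (a + Suc j)) u) * ip r u ((rank1_inv r u R ^^ (b - j)) u))"
proof -
  let ?S = "rank1_inv r u R"
  have S: "psd_op r ?S" by (rule psd_op_rank1_inv[OF R])
  \<comment> \<open>One S is exchanged for an R at the cost of a product of two pure
    moments.\<close>
  have step: "ip r u ((R ^^ a) ((?S ^^ Suc b) u)) = ip r u ((R ^^ Suc a) ((?S ^^ b) u))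
      - ip r u ((R ^^ Suc a) u) * ip r u ((?S ^^ Suc b) u)" for a b
  proof -
    have "ip r u ((R ^^ a) ((?S ^^ Suc b) u)) = ip r ((R ^^ a) u) (?S ((?S ^^ b) u))"
      by (simp add: psd_op_power_sym[OF R])
    also have "\<dots> = ip r ((R ^^ a) u) (R ((?S ^^ b) u)) - ip r u (?S ((?S ^^ b) u)) * ip r ((R ^^ a) u) (R u)"
      by (rule rank1_inv_resolvent1[OF R])
    finally show ?thesis by (simp add: psd_op_power_sym[OF R] funpow_swap1)
  qed
  have eq: "ip r u ((R ^^ a) ((?S ^^ b) u)) = ip r u ((R ^^ (a + b)) u) -
      (\<Sum>j<b. ip r u ((R ^^ (a + Suc j)) u) * ip r u ((?S ^^ (b - j)) u))" for a b
  proof (induction b arbitrary: a)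
    case (Suc b)
    show ?case unfolding step Suc.IH by (simp add: sum.lessThan_Suc_shift del: sum.lessThan_Suc)
  qed simp
  then show "ip r u ((R ^^ a) ((?S ^^ b) u)) = ip r u ((R ^^ (a + b)) u) -
      (\<Sum>j<b. ip r u ((R ^^ (a + Suc j)) u) * ip r u ((?S ^^ (b - j)) u))" .
  \<comment> \<open>With a = 0 the mixed moment is a pure moment of S, and all subtracted products
    are nonnegative.\<close>
  show "ip r u ((?S ^^ q) u) \<le> ip r u ((R ^^ q) u)"
    using eq[of 0 q] by (simp add: sum_nonneg psd_op_nonneg[OF psd_op_power[OF R], simplified]
      psd_op_nonneg[OF psd_op_power[OF S]] psd_op_nonneg[OF psd_op_power[OF R, of "Suc _"], simplified])
qed

text \<open>Each of the \<open>b\<close> subtracted products is at most \<epsilon> times the moment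
  of order a + b: moments of the updated operator are bounded by those of \<open>R\<close>,
  log-convexity spreads the two orders to 1 and a + b, and the moment of order 1 is at most
  \<epsilon>.\<close>

lemma rank1_inv_mixed_lower:
  assumes R: "psd_op r R" and u: "ip r u (R u) \<le> \<epsilon>"
  shows "(1 - real b * \<epsilon>) * ip r u ((R ^^ (a + b)) u) \<le> ip r u ((R ^^ a) ((rank1_inv r u R ^^ b) u))"
proof -
  let ?S = "rank1_inv r u R" and ?s = "\<lambda>k. ip r u ((R ^^ k) u)"
  have nn: "0 \<le> ?s k" for k by (rule psd_op_nonneg[OF psd_op_power[OF R]])
  have lc: "(?s (Suc k))\<^sup>2 \<le> ?s k * ?s (Suc (Suc k))" for k by (rule psd_moment_log_convex[OF R])
  have "?s (a + Suc j) * ip r u ((?S ^^ (b - j)) u) \<le> \<epsilon> * ?s (a + b)" if "j < b" for j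
  proof -
    have "?s (a + Suc j) * ip r u ((?S ^^ (b - j)) u) \<le> ?s (a + Suc j) * ?s (b - j)"
      by (intro mult_left_mono rank1_inv_power_le[OF R] nn)
    \<comment> \<open>As j < b, both orders are positive; \<open>log_convex_prod\<close> is stated
      for successors.\<close>
    also have "\<dots> = ?s (Suc (a + j)) * ?s (Suc (b - j - 1))" using that by (simp add: Suc_diff_Suc)
    also have "\<dots> \<le> ?s 1 * ?s (Suc (a + j + (b - j - 1)))"
      by (rule log_convex_prod[where s="?s", OF nn lc])
    also have "Suc (a + j + (b - j - 1)) = a + b" using that by simp
    also have "?s 1 * ?s (a + b) \<le> \<epsilon> * ?s (a + b)" using u nn by (intro mult_right_mono) auto
    finally show ?thesis .
  qed
  then have "(\<Sum>j<b. ?s (a + Suc j) * ip r u ((?S ^^ (b - j)) u)) \<le> (\<Sum>j<b. \<epsilon> * ?s (a + b))"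
    by (intro sum_mono) simp
  then show ?thesis unfolding rank1_inv_power_le(2)[OF R] by (simp add: algebra_simps)
qed

text \<open>In tr(S^i R^(p-i)) one factor R after the other is replaced by S. By the second
  resolvent identity, neighbours differ by the trace of the rank-one operator S^(i+1) u u^T R^(p-i),
  which is a mixed moment at \<open>u\<close>.\<close>

lemma trp_rank1_inv_telescope:
  assumes R: "psd_op r R"
  shows "trp r R p - trp r (rank1_inv r u R) p =
    (\<Sum>i<p. ip r u ((R ^^ (p - i)) ((rank1_inv r u R ^^ Suc i) u)))"
proof -
  let ?S = "rank1_inv r u R"
  have S: "psd_op r ?S" by (rule psd_op_rank1_inv[OF R])
  let ?t = "\<lambda>i. (\<Sum>l<r. ip r (unitv l) ((?S ^^ i) ((R ^^ (p - i)) (unitv l))))"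
  have "?t i - ?t (Suc i) = ip r u ((R ^^ (p - i)) ((?S ^^ Suc i) u))" if "i < p" for i
  proof -
    have "?t i - ?t (Suc i) = (\<Sum>l<r. ip r ((R ^^ (p - i)) u) (unitv l) * ip r (unitv l) ((?S ^^ Suc i) u))"
      unfolding sum_subtractf[symmetric]
    proof (rule sum.cong)
      fix l
      let ?e = "unitv l" let ?w = "(R ^^ (p - Suc i)) ?e"
      have pi: "p - i = Suc (p - Suc i)" using that by simp
      have "ip r ?e ((?S ^^ i) ((R ^^ (p - i)) ?e)) - ip r ?e ((?S ^^ Suc i) ?w)
         = ip r ((?S ^^ i) ?e) (R ?w) - ip r ((?S ^^ i) ?e) (?S ?w)"
        unfolding pi by (simp add: psd_op_power_sym[OF S] funpow_swap1)
      also have "\<dots> = ip r u (R ?w) * ip r ((?S ^^ i) ?e) (?S u)"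
        by (rule rank1_inv_resolvent2[OF R])
      also have "\<dots> = ip r ((R ^^ (p - i)) u) ?e * ip r ?e ((?S ^^ Suc i) u)"
        unfolding pi psd_op_power_sym[OF R, symmetric]
        using psd_op_power_sym[OF S, of ?e i "?S u"] by (simp add: funpow_swap1)
      finally show "ip r ?e ((?S ^^ i) ((R ^^ (p - i)) ?e)) - ip r ?e ((?S ^^ Suc i) ?w)
         = ip r ((R ^^ (p - i)) u) ?e * ip r ?e ((?S ^^ Suc i) u)" .
    qed simp
    also have "\<dots> = ip r ((R ^^ (p - i)) u) ((?S ^^ Suc i) u)"
      using ip_expand[of r "(R ^^ (p - i)) u"] by (simp only: ip_commute[of r _ "unitv _"])
    finally show ?thesis by (simp add: psd_op_power_sym[OF R])
  qed
  then have "(\<Sum>i<p. ?t i - ?t (Suc i)) = (\<Sum>i<p. ip r u ((R ^^ (p - i)) ((?S ^^ Suc i) u)))"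
    by (intro sum.cong) auto
  moreover have "(\<Sum>i<p. ?t i - ?t (Suc i)) = ?t 0 - ?t p" by (rule sum_lessThan_telescope')
  ultimately show ?thesis by (simp add: trp_def)
qed

text \<open>The i-th telescoping term retains at least the fraction 1 - (i+1) \<epsilon> of the
  first-order term; these losses add up to p (p+1) \<epsilon> / 2.\<close>

lemma trp_rank1_inv_le:
  assumes R: "psd_op r R" and u: "ip r u (R u) \<le> \<epsilon>"
  shows "trp r (rank1_inv r u R) p \<le>
    trp r R p - real p * (1 - real (Suc p) * \<epsilon> / 2) * ip r u ((R ^^ Suc p) u)"
proof -
  let ?s = "ip r u ((R ^^ Suc p) u)"
  have "(\<Sum>i<p. (1 - real (Suc i) * \<epsilon>) * ?s) \<le>
      (\<Sum>i<p. ip r u ((R ^^ (p - i)) ((rank1_inv r u R ^^ Suc i) u)))"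
  proof (rule sum_mono)
    fix i assume "i \<in> {..<p}"
    then have "p - i + Suc i = Suc p" by simp
    then show "(1 - real (Suc i) * \<epsilon>) * ?s \<le> ip r u ((R ^^ (p - i)) ((rank1_inv r u R ^^ Suc i) u))"
      using rank1_inv_mixed_lower[OF R u, of "Suc i" "p - i"] by metis
  qed
  moreover have "(\<Sum>i<p. (1 - real (Suc i) * \<epsilon>) * ?s) = real p * (1 - real (Suc p) * \<epsilon> / 2) * ?s"
  proof -
    have "(\<Sum>i<p. (1 - real (Suc i) * \<epsilon>)) = real p * (1 - real (Suc p) * \<epsilon> / 2)"
      by (induction p) (simp_all add: field_simps)
    then show ?thesis by (simp only: sum_distrib_right[symmetric])
  qed
  ultimately show ?thesis using trp_rank1_inv_telescope[OF R, of p u] by linarith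
qed


section \<open>From the trace to the smallest eigenvalue\<close>

text \<open>Cauchy-Schwarz twice, in the coordinates and in the form of R^q, bounds the square of
  the form by trace times |x|^2 times the form itself; one factor then cancels.\<close>

lemma psd_le_trp:
  assumes R: "psd_op r R"
  shows "ip r x ((R ^^ q) x) \<le> trp r R q * ip r x x"
proof -
  let ?B = "R ^^ q" and ?b = "ip r x ((R ^^ q) x)"
  note B = psd_op_power[OF R, of q]
  have b0: "0 \<le> ?b" by (rule psd_op_nonneg[OF B])
  have "?b\<^sup>2 = (\<Sum>k<r. x k * ip r (unitv k) (?B x))\<^sup>2"
    by (simp add: ip_unitv ip_def[of r x])
  also have "\<dots> \<le> (\<Sum>k<r. (x k)\<^sup>2) * (\<Sum>k<r. (ip r (unitv k) (?B x))\<^sup>2)"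
    by (rule Cauchy_Schwarz_ineq_sum)
  also have "\<dots> \<le> ip r x x * (\<Sum>k<r. ip r (unitv k) (?B (unitv k)) * ?b)"
    by (intro mult_mono sum_mono psd_Cauchy_Schwarz[OF B] sum_nonneg ip_self_nonneg)
      (auto simp: ip_def power2_eq_square)
  also have "\<dots> = (trp r R q * ip r x x) * ?b" by (simp add: trp_def sum_distrib_left sum_distrib_right mult_ac)
  finally have *: "?b * ?b \<le> (trp r R q * ip r x x) * ?b" by (simp add: power2_eq_square)
  show ?thesis
  proof (cases "?b = 0")
    case True then show ?thesis using trp_nonneg[OF R, of q] ip_self_nonneg[of r x] by simp
  next
    case False then show ?thesis using * b0 by simp
  qed
qed

text \<open>Jensen's inequality for the spectral measure of \<open>R\<close> at x, obtained here
  from log-convexity, gives ((x, R x)/|x|^2)^p \<le> (x, R^p x)/|x|^2 \<le> tr R^p. Hence (x, R x)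
  \<le> |x|^2 / z, and Cauchy-Schwarz for the form of \<open>A\<close> at x and R x turns this into
  a lower bound on (x, A x).\<close>

lemma trp_imp_lower_bound:
  assumes R: "psd_op r R" and A: "psd_op r A" and inv: "\<And>x. A (R x) = x"
    and p: "0 < p" and z: "0 < z" and tr: "trp r R p \<le> (1 / z) ^ p"
  shows "z * ip r x x \<le> ip r x (A x)"
proof (cases "ip r x x = 0")
  case True then show ?thesis using psd_op_nonneg[OF A, of x] by simp
next
  case False
  let ?s = "\<lambda>k. ip r x ((R ^^ k) x)"
  have s0: "?s 0 > 0" using False ip_self_nonneg[of r x] by simp
  have nn: "0 \<le> ?s k" for k by (rule psd_op_nonneg[OF psd_op_power[OF R]])
  have lc: "(?s (Suc k))\<^sup>2 \<le> ?s k * ?s (Suc (Suc k))" for k by (rule psd_moment_log_convex[OF R])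
  have "?s 1 ^ q * ?s 0 \<le> ?s q * ?s 0 ^ q" for q
  proof (induction q)
    case (Suc q)
    have "?s 1 ^ Suc q * ?s 0 \<le> ?s 1 * (?s q * ?s 0 ^ q)"
      using mult_left_mono[OF Suc.IH nn[of 1]] by (simp add: mult_ac)
    also have "\<dots> \<le> (?s 0 * ?s (Suc q)) * ?s 0 ^ q"
      using mult_right_mono[OF log_convex_ratio[where s="?s", OF nn lc, of 0 q], of "?s 0 ^ q"] s0
      by (simp add: mult_ac)
    finally show ?case by (simp add: mult_ac)
  qed simp
  also have "?s p * ?s 0 ^ p \<le> ((1 / z) ^ p * ?s 0) * ?s 0 ^ p"
    using order.trans[OF psd_le_trp[OF R, of x p] mult_right_mono[OF tr, of "ip r x x"]] s0
    by (intro mult_right_mono) auto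
  finally have "?s 1 ^ p * ?s 0 \<le> (?s 0 / z) ^ p * ?s 0" by (simp add: power_divide mult_ac)
  then have "?s 1 ^ p \<le> (?s 0 / z) ^ p" using s0 by (simp only: mult_le_cancel_right_pos)
  then have s1: "?s 1 \<le> ?s 0 / z"
    using p s0 z nn[of 1] by (simp add: power_mono_iff)
  have "(?s 0)\<^sup>2 = (ip r x (A (R x)))\<^sup>2" by (simp add: inv)
  also have "\<dots> \<le> ip r x (A x) * ip r (R x) (A (R x))" by (rule psd_Cauchy_Schwarz[OF A])
  also have "\<dots> = ip r x (A x) * ?s 1" by (simp add: inv ip_commute)
  also have "\<dots> \<le> ip r x (A x) * (?s 0 / z)" using s1 psd_op_nonneg[OF A] by (intro mult_left_mono)
  finally show ?thesis using s0 z by (simp add: power2_eq_square field_simps)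
qed

section \<open>The shifted frame operator and its inverse after i samples\<close>

text \<open>The inverse of \<open>frame_op\<close> is built by successive updates of (c I)^-1:
  measurability in the sample and the effect of one further vector can both be read off the
  recursion.\<close>

fun inv_op :: "nat \<Rightarrow> real \<Rightarrow> (nat \<Rightarrow> nat \<Rightarrow> real) \<Rightarrow> nat \<Rightarrow> (nat \<Rightarrow> real) \<Rightarrow> nat \<Rightarrow> real" where
  "inv_op r c us 0 = (\<lambda>y k. y k / c)"
| "inv_op r c us (Suc i) = rank1_inv r (us i) (inv_op r c us i)"

definition frame_op :: "nat \<Rightarrow> real \<Rightarrow> (nat \<Rightarrow> nat \<Rightarrow> real) \<Rightarrow> nat \<Rightarrow> (nat \<Rightarrow> real) \<Rightarrow> nat \<Rightarrow> real" where
  "frame_op r c us i y = (\<lambda>k. c * y k + (\<Sum>j<i. ip r (us j) y * us j k))"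

text \<open>The state after i samples ignores all later ones, which permits integrating over the
  newest sample with the earlier ones fixed.\<close>

lemma inv_op_cong: "(\<And>j. j < i \<Longrightarrow> us j = vs j) \<Longrightarrow> inv_op r c us i = inv_op r c vs i"
  by (induction i) auto

lemma psd_inv_op: "c > 0 \<Longrightarrow> psd_op r (inv_op r c us i)"
proof (induction i)
  case 0
  then show ?case
    by (auto simp: psd_op_def ip_def add_divide_distrib sum_nonneg)
qed (auto intro: psd_op_rank1_inv)

lemma inv_op_le:
  assumes "c > 0"
  shows "ip r x (inv_op r c us i x) \<le> ip r x x / c"
proof (induction i)
  case (Suc i)
  then show ?case using rank1_inv_le[OF psd_inv_op[OF assms], of r x "us i" us i] by simp
qed (simp add: ip_def sum_divide_distrib)

lemma ip_frame_op: "ip r x (frame_op r c us i y) = c * ip r x y + (\<Sum>j<i. ip r (us j) x * ip r (us j) y)"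
proof -
  have "ip r x (frame_op r c us i y) =
      c * ip r x y + (\<Sum>k<r. \<Sum>j<i. x k * (ip r (us j) y * us j k))"
    by (simp add: frame_op_def ip_def[of r x] algebra_simps sum.distrib sum_distrib_left)
  also have "(\<Sum>k<r. \<Sum>j<i. x k * (ip r (us j) y * us j k)) = (\<Sum>j<i. ip r (us j) x * ip r (us j) y)"
    by (subst sum.swap) (simp add: ip_def[of r _ x] sum_distrib_left sum_distrib_right mult_ac)
  finally show ?thesis .
qed

lemma psd_frame_op:
  assumes "c \<ge> 0" shows "psd_op r (frame_op r c us i)"
proof -
  have "frame_op r c us i (\<lambda>k. x k + a * y k) = (\<lambda>k. frame_op r c us i x k + a * frame_op r c us i y k)" for x y a
    by (simp add: frame_op_def ip_add_scale algebra_simps sum.distrib sum_distrib_left)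
  moreover have "ip r x (frame_op r c us i y) = ip r (frame_op r c us i x) y" for x y
    unfolding ip_commute[of r _ y] ip_frame_op by (simp add: ip_commute mult.commute)
  moreover have "0 \<le> ip r x (frame_op r c us i x)" for x
    unfolding ip_frame_op using assms by (simp add: ip_self_nonneg sum_nonneg)
  ultimately show ?thesis unfolding psd_op_def by blast
qed

text \<open>Sherman-Morrison, checked in the direction that \<open>trp_imp_lower_bound\<close> takes
  as its hypothesis \<open>inv\<close>.\<close>

lemma frame_op_inv_op:
  assumes c: "c > 0"
  shows "frame_op r c us i (inv_op r c us i x) = x"
proof (induction i arbitrary: x)
  case 0 then show ?case using c by (simp add: frame_op_def)
next
  case (Suc i)
  let ?R = "inv_op r c us i" and ?A = "frame_op r c us i" and ?u = "us i"
  let ?a = "ip r ?u (?R ?u)" and ?b = "ip r ?u (?R x)"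
  note R = psd_inv_op[OF c, of r us i]
  have a: "?a \<ge> 0" by (rule psd_op_nonneg[OF R])
  have "frame_op r c us (Suc i) (rank1_inv r ?u ?R x) =
      (\<lambda>k. ?A (rank1_inv r ?u ?R x) k + ip r ?u (rank1_inv r ?u ?R x) * ?u k)"
    by (simp add: frame_op_def add.assoc)
  also have "?A (rank1_inv r ?u ?R x) = (\<lambda>k. x k - ?b / (1 + ?a) * ?u k)"
    using psd_op_linear[OF psd_frame_op[of c r us i], of "?R x" "- (?b / (1 + ?a))" "?R ?u"] c
    by (simp add: rank1_inv_def Suc)
  also have "ip r ?u (rank1_inv r ?u ?R x) = ?b / (1 + ?a)" by (rule rank1_inv_self[OF R])
  finally show ?case by (simp only: inv_op.simps diff_add_cancel)
qed

text \<open>The shift keeps R \<le> I/c throughout, so a vector of norm at most 1 allows \<epsilon>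
  = 1/c.\<close>

lemma trp_inv_op_Suc_le:
  assumes c: "c > 0" and u: "ip r (us i) (us i) \<le> 1"
  shows "trp r (inv_op r c us (Suc i)) p \<le> trp r (inv_op r c us i) p
     - real p * (1 - real (Suc p) / (2 * c)) * ip r (us i) ((inv_op r c us i ^^ Suc p) (us i))"
proof -
  have "ip r (us i) (inv_op r c us i (us i)) \<le> ip r (us i) (us i) / c" by (rule inv_op_le[OF c])
  also have "\<dots> \<le> 1 / c" using u c by (intro divide_right_mono) auto
  finally show ?thesis using trp_rank1_inv_le[OF psd_inv_op[OF c], of r "us i" us i "1/c" p] by (simp add: mult.commute)
qed

lemma trp_0: "trp r R 0 = real r"
  by (simp add: trp_def ip_unitv) (simp add: unitv_def)

section \<open>A lower frame bound for random isotropic vectors\<close>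

text \<open>Operators carry no measurable structure here. A random operator counts as measurable if
  it maps measurable vectors to measurable vectors, and the update preserves this.\<close>

lemma measurable_rank1_inv:
  assumes "\<And>v k. (\<And>j. (\<lambda>\<omega>. v \<omega> j) \<in> borel_measurable M) \<Longrightarrow> (\<lambda>\<omega>. R \<omega> (v \<omega>) k) \<in> borel_measurable M"
    and "\<And>j. (\<lambda>\<omega>. u \<omega> j) \<in> borel_measurable M" and "\<And>j. (\<lambda>\<omega>. v \<omega> j) \<in> borel_measurable M"
  shows "(\<lambda>\<omega>. rank1_inv r (u \<omega>) (R \<omega>) (v \<omega>) k) \<in> borel_measurable M"
  unfolding rank1_inv_def ip_def
  by (intro borel_measurable_diff borel_measurable_times borel_measurable_divide borel_measurable_add
      borel_measurable_sum borel_measurable_const assms)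

lemma measurable_inv_op:
  assumes "\<And>i j. (\<lambda>\<omega>. us \<omega> i j) \<in> borel_measurable M" and "\<And>j. (\<lambda>\<omega>. v \<omega> j) \<in> borel_measurable M"
  shows "(\<lambda>\<omega>. inv_op r c (us \<omega>) n (v \<omega>) k) \<in> borel_measurable M"
  using assms(2)
proof (induction n arbitrary: v k)
  case (Suc n)
  show ?case unfolding inv_op.simps
    by (rule measurable_rank1_inv) (use Suc assms(1) in auto)
qed simp

lemma measurable_trp_inv_op:
  assumes "\<And>i j. i < n \<Longrightarrow> (\<lambda>\<omega>. us \<omega> i j) \<in> borel_measurable M"
  shows "(\<lambda>\<omega>. trp r (inv_op r c (us \<omega>) n) q) \<in> borel_measurable M"
proof -
  \<comment> \<open>Sample coordinates are measurable only below \<open>n\<close>, whereas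
    \<open>measurable_inv_op\<close> asks for all indices; padding with zero vectors leaves the
    operator unchanged.\<close>
  define vs where "vs \<omega> i = (if i < n then us \<omega> i else (\<lambda>_. 0))" for \<omega> i
  have vs: "(\<lambda>\<omega>. vs \<omega> i j) \<in> borel_measurable M" for i j
    using assms[of i j] by (cases "i < n") (simp_all add: vs_def)
  have eq: "inv_op r c (us \<omega>) n = inv_op r c (vs \<omega>) n" for \<omega>
    by (rule inv_op_cong) (simp add: vs_def)
  have "(\<lambda>\<omega>. (inv_op r c (vs \<omega>) n ^^ q) (unitv l) k) \<in> borel_measurable M" for l k
  proof (induction q arbitrary: k)
    case (Suc q)
    then show ?case using measurable_inv_op[where us=vs, OF vs] by simp
  qed simp
  then show ?thesis unfolding eq trp_def ip_def
    by (intro borel_measurable_sum borel_measurable_times) auto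
qed

lemma measurable_PiM_component_fun:
  assumes "(\<lambda>x. u x k) \<in> borel_measurable M" and "i \<in> I"
  shows "(\<lambda>\<omega>. u (\<omega> i) k) \<in> borel_measurable (PiM I (\<lambda>_. M))"
  using measurable_compose[OF measurable_component_singleton[of i I "\<lambda>_. M"], of "\<lambda>x. u x k"] assms
  by simp

text \<open>E u^T R^q u = tr(R^q E u u^T), and isotropy makes E u u^T = I/r.\<close>

lemma quadratic_form_expectation:
  assumes R: "psd_op r R"
    and int: "\<And>k l. k < r \<Longrightarrow> l < r \<Longrightarrow> integrable M (\<lambda>x. u x k * u x l)"
    and iso: "\<And>k l. k < r \<Longrightarrow> l < r \<Longrightarrow> (\<integral>x. u x k * u x l \<partial>M) = (if k = l then 1 / real r else 0)"
  shows "integrable M (\<lambda>x. ip r (u x) ((R ^^ q) (u x)))"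
    and "(\<integral>x. ip r (u x) ((R ^^ q) (u x)) \<partial>M) = trp r R q / real r"
proof -
  \<comment> \<open>Symmetry exposes the matrix entries of R^q, so that the quadratic form becomes a
    finite sum of the products \<open>u x k * u x l\<close>.\<close>
  have row: "(R ^^ q) v k = (\<Sum>l<r. (R ^^ q) (unitv k) l * v l)" if "k < r" for k v
  proof -
    have "(R ^^ q) v k = ip r (unitv k) ((R ^^ q) v)" using that by (simp add: ip_unitv)
    also have "\<dots> = ip r ((R ^^ q) (unitv k)) v" by (rule psd_op_power_sym[OF R])
    finally show ?thesis by (simp add: ip_def)
  qed
  have eq: "ip r v ((R ^^ q) v) = (\<Sum>k<r. \<Sum>l<r. (R ^^ q) (unitv k) l * (v k * v l))" for v
    unfolding ip_def
  proof (rule sum.cong[OF refl])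
    fix k assume "k \<in> {..<r}"
    then have "v k * (R ^^ q) v k = v k * (\<Sum>l<r. (R ^^ q) (unitv k) l * v l)" using row by simp
    then show "v k * (R ^^ q) v k = (\<Sum>l<r. (R ^^ q) (unitv k) l * (v k * v l))"
      by (simp only: sum_distrib_left mult.left_commute)
  qed
  have i1: "integrable M (\<lambda>x. c * (u x k * u x l))" if "k < r" "l < r" for c k l
    by (rule integrable_mult_right) (rule int[OF that])
  have i2: "integrable M (\<lambda>x. \<Sum>l<r. (R ^^ q) (unitv k) l * (u x k * u x l))" if "k < r" for k
    by (rule Bochner_Integration.integrable_sum) (rule i1, use that in simp_all)
  show "integrable M (\<lambda>x. ip r (u x) ((R ^^ q) (u x)))"
    unfolding eq by (rule Bochner_Integration.integrable_sum) (rule i2, simp)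
  have "(\<integral>x. ip r (u x) ((R ^^ q) (u x)) \<partial>M) =
      (\<Sum>k<r. \<integral>x. (\<Sum>l<r. (R ^^ q) (unitv k) l * (u x k * u x l)) \<partial>M)"
    unfolding eq by (rule Bochner_Integration.integral_sum) (rule i2, simp)
  also have "\<dots> = (\<Sum>k<r. \<Sum>l<r. \<integral>x. (R ^^ q) (unitv k) l * (u x k * u x l) \<partial>M)"
    by (intro sum.cong refl Bochner_Integration.integral_sum) (rule i1, simp_all)
  also have "\<dots> = (\<Sum>k<r. \<Sum>l<r. (R ^^ q) (unitv k) l * (\<integral>x. u x k * u x l \<partial>M))"
    by (simp only: integral_mult_right_zero)
  also have "\<dots> = (\<Sum>k<r. \<Sum>l<r. if k = l then (R ^^ q) (unitv k) l / real r else 0)"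
    by (intro sum.cong) (auto simp: iso)
  also have "\<dots> = (\<Sum>k<r. (R ^^ q) (unitv k) k / real r)" by simp
  also have "\<dots> = trp r R q / real r" by (simp add: trp_def ip_unitv sum_divide_distrib)
  finally show "(\<integral>x. ip r (u x) ((R ^^ q) (u x)) \<partial>M) = trp r R q / real r" .
qed

text \<open>The one-step bound involves tr R^(p+1). The tangent at the current level 1/z replaces it
  by an affine function of tr R^p, which can be averaged over the earlier samples. The bound r z^-p
  then reproduces itself with z raised by \<kappa>/r.\<close>

lemma expected_trp_inv_op:
  fixes u :: "'x \<Rightarrow> nat \<Rightarrow> real" and M :: "'x measure"
  assumes M: "prob_space M" and r: "0 < r"
    and meas: "\<And>k. (\<lambda>x. u x k) \<in> borel_measurable M"
    and u1: "\<And>x. ip r (u x) (u x) \<le> 1"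
    and iso: "\<And>k l. k < r \<Longrightarrow> l < r \<Longrightarrow> (\<integral>x. u x k * u x l \<partial>M) = (if k = l then 1 / real r else 0)"
    and c: "real (Suc p) \<le> c" and \<kappa>: "\<kappa> = 1 - real (Suc p) / (2 * c)"
  shows "(\<integral>\<^sup>+\<omega>. ennreal (trp r (inv_op r c (\<lambda>j. u (\<omega> j)) n) p) \<partial>PiM {..<n} (\<lambda>_. M))
     \<le> ennreal (real r * (1 / (c + \<kappa> * real n / real r)) ^ p)"
proof -
  interpret prob_space M by (rule M)
  interpret P: product_prob_space "\<lambda>_::nat. M" UNIV ..
  have c0: "c > 0" using c by simp
  have \<kappa>0: "0 \<le> \<kappa>" and \<kappa>1: "\<kappa> \<le> 1" using c c0 by (simp_all add: \<kappa> field_simps)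
  have abs: "\<bar>u x k\<bar> \<le> 1" if "k < r" for x k
  proof -
    have "(u x k)\<^sup>2 \<le> ip r (u x) (u x)"
      unfolding ip_def power2_eq_square using that by (intro member_le_sum) auto
    then have "(u x k)\<^sup>2 \<le> 1" using u1[of x] by linarith
    then show ?thesis by (simp add: abs_square_le_1)
  qed
  have int: "integrable M (\<lambda>x. u x k * u x l)" if "k < r" "l < r" for k l
  proof (rule integrable_const_bound[where B=1])
    show "AE x in M. norm (u x k * u x l) \<le> 1"
      using abs[OF that(1)] abs[OF that(2)] by (simp add: abs_mult mult_le_one)
  qed (use meas in auto)
  \<comment> \<open>The tangent point stays free here, because it has to follow the level reached in
    the induction.\<close>
  have step: "(\<integral>\<^sup>+y. ennreal (trp r (rank1_inv r (u y) (inv_op r c us n)) p) \<partial>M)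
     \<le> ennreal (1 - real (Suc p) * \<kappa> / (real r * z)) * ennreal (trp r (inv_op r c us n) p)
        + ennreal (\<kappa> * (1/z) ^ Suc p)" if z: "c \<le> z" for us n z
  proof -
    let ?R = "inv_op r c us n"
    have R: "psd_op r ?R" by (rule psd_inv_op[OF c0])
    have z0: "z > 0" using z c0 by simp
    let ?g = "\<lambda>y. trp r ?R p - real p * \<kappa> * ip r (u y) ((?R ^^ Suc p) (u y))"
    have le: "trp r (rank1_inv r (u y) ?R) p \<le> ?g y" for y
      using trp_inv_op_Suc_le[OF c0, of r "us(n := u y)" n p] u1[of y]
        inv_op_cong[of n "us(n := u y)" us r c]
      by (simp add: \<kappa>)
    note q = quadratic_form_expectation[OF R int iso, of "Suc p"]
    have "(\<integral>\<^sup>+y. ennreal (trp r (rank1_inv r (u y) ?R) p) \<partial>M) \<le> (\<integral>\<^sup>+y. ennreal (?g y) \<partial>M)"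
      by (intro nn_integral_mono ennreal_leI le)
    also have "\<dots> = ennreal (\<integral>y. ?g y \<partial>M)"
    proof (rule nn_integral_eq_integral)
      show "integrable M ?g" by (intro Bochner_Integration.integrable_diff integrable_mult_right q) auto
      show "AE y in M. 0 \<le> ?g y"
        using order.trans[OF trp_nonneg[OF psd_op_rank1_inv[OF R]] le] by simp
    qed
    also have "(\<integral>y. ?g y \<partial>M) = trp r ?R p - real p * \<kappa> * (trp r ?R (Suc p) / real r)"
      by (subst Bochner_Integration.integral_diff)
        (use q in \<open>auto simp: prob_space simp del: funpow.simps\<close>)
    also have "\<dots> \<le> (1 - real (Suc p) * \<kappa> / (real r * z)) * trp r ?R p + \<kappa> * (1/z) ^ Suc p"
    proof -
      have "real (Suc p) * (1/z) * trp r ?R p \<le> real p * trp r ?R (Suc p) + trp r ?R 0 * (1/z) ^ Suc p"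
        by (rule log_convex_tangent[where s="trp r ?R", OF trp_nonneg[OF R] trp_log_convex[OF R]])
          (use z0 in simp)
      from mult_left_mono[OF this, of "\<kappa> / real r"] show ?thesis
        using \<kappa>0 r by (simp add: trp_0 algebra_simps add_divide_distrib)
    qed
    also have "ennreal \<dots> = ennreal (1 - real (Suc p) * \<kappa> / (real r * z)) * ennreal (trp r ?R p)
        + ennreal (\<kappa> * (1/z) ^ Suc p)"
    proof -
      \<comment> \<open>The factor has to be nonnegative before the sum may be split in
        \<open>ennreal\<close>: (p+1) \<kappa> \<le> c \<le> r z.\<close>
      have "real (Suc p) * \<kappa> \<le> c * 1" using c \<kappa>0 \<kappa>1 c0 by (intro mult_mono) auto
      also have "\<dots> \<le> real r * z" using r z z0 mult_mono[of 1 "real r" c z] c0 by simp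
      finally have "0 \<le> 1 - real (Suc p) * \<kappa> / (real r * z)" using r z0 by (simp add: field_simps)
      then show ?thesis using \<kappa>0 z0 trp_nonneg[OF R, of p]
        by (simp add: ennreal_mult ennreal_plus)
    qed
    finally show ?thesis using ennreal_leI by (metis (no_types, lifting))
  qed
  show ?thesis
  proof (induction n)
    case 0
    have "(\<integral>\<^sup>+\<omega>. ennreal (trp r (inv_op r c (\<lambda>j. u (\<omega> j)) 0) p) \<partial>PiM {..<0} (\<lambda>_. M))
       = ennreal (trp r (\<lambda>y k. y k / c) p)"
      by (simp add: nn_integral_count_space_finite PiM_empty)
    also have "trp r (\<lambda>y k. y k / c) p = real r * (1 / c) ^ p"
    proof -
      have "((\<lambda>y k. y k / c) ^^ p) y = (\<lambda>k. y k * (1/c) ^ p)" for y :: "nat \<Rightarrow> real"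
        by (induction p) (auto simp: field_simps)
      then show ?thesis by (simp add: trp_def ip_unitv) (simp add: unitv_def)
    qed
    finally show ?case by simp
  next
    case (Suc n)
    \<comment> \<open>The level reached after \<open>n\<close> vectors: the shift plus \<kappa>/r
      for each of them.\<close>
    define z where "z = c + \<kappa> * real n / real r"
    have z: "c \<le> z" using \<kappa>0 by (simp add: z_def)
    have z0: "z > 0" using z c0 by simp
    let ?f = "\<lambda>\<omega>. ennreal (trp r (inv_op r c (\<lambda>j. u (\<omega> j)) n) p)"
    let ?a = "1 - real (Suc p) * \<kappa> / (real r * z)"
    have m: "(\<lambda>\<omega>. ennreal (trp r (inv_op r c (\<lambda>j. u (\<omega> j)) k) p)) \<in> borel_measurable (PiM {..<k} (\<lambda>_. M))" for k
      by (intro measurable_compose[OF _ measurable_ennreal] measurable_trp_inv_op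
          measurable_PiM_component_fun meas) auto
    have a0: "0 \<le> ?a"
    proof -
      have "real (Suc p) * \<kappa> \<le> c * 1" using c \<kappa>0 \<kappa>1 c0 by (intro mult_mono) auto
      also have "\<dots> \<le> real r * z" using r z z0 mult_mono[of 1 "real r" c z] c0 by simp
      finally show "0 \<le> 1 - real (Suc p) * \<kappa> / (real r * z)" using r z0 by (simp add: field_simps)
    qed
    have "(\<integral>\<^sup>+\<omega>. ennreal (trp r (inv_op r c (\<lambda>j. u (\<omega> j)) (Suc n)) p) \<partial>PiM {..<Suc n} (\<lambda>_. M))
      = (\<integral>\<^sup>+\<omega>. \<integral>\<^sup>+y. ennreal (trp r (inv_op r c (\<lambda>j. u ((fun_upd \<omega> n y) j)) (Suc n)) p) \<partial>M \<partial>PiM {..<n} (\<lambda>_. M))"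
      using m[of "Suc n"] unfolding lessThan_Suc
      by (subst P.product_nn_integral_insert) auto
    also have "\<dots> = (\<integral>\<^sup>+\<omega>. \<integral>\<^sup>+y. ennreal (trp r (rank1_inv r (u y) (inv_op r c (\<lambda>j. u (\<omega> j)) n)) p) \<partial>M \<partial>PiM {..<n} (\<lambda>_. M))"
    proof -
      have "inv_op r c (\<lambda>j. u ((fun_upd \<omega> n y) j)) n = inv_op r c (\<lambda>j. u (\<omega> j)) n" for \<omega> y
        by (rule inv_op_cong) simp
      then show ?thesis by simp
    qed
    also have "\<dots> \<le> (\<integral>\<^sup>+\<omega>. ennreal ?a * ?f \<omega> + ennreal (\<kappa> * (1/z) ^ Suc p) \<partial>PiM {..<n} (\<lambda>_. M))"
      by (intro nn_integral_mono step z)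
    also have "\<dots> = ennreal ?a * (\<integral>\<^sup>+\<omega>. ?f \<omega> \<partial>PiM {..<n} (\<lambda>_. M)) + ennreal (\<kappa> * (1/z) ^ Suc p)"
      using m[of n] prob_space.emeasure_space_1[OF prob_space_PiM[OF M], of "{..<n}"]
      by (simp add: nn_integral_add nn_integral_cmult M)
    also have "\<dots> \<le> ennreal ?a * ennreal (real r * (1 / z) ^ p) + ennreal (\<kappa> * (1/z) ^ Suc p)"
      using Suc unfolding z_def[symmetric] by (intro add_right_mono mult_left_mono) auto
    also have "\<dots> = ennreal (?a * (real r * (1 / z) ^ p) + \<kappa> * (1/z) ^ Suc p)"
      using a0 z0 \<kappa>0 by (simp add: ennreal_mult ennreal_plus)
    also have "\<dots> \<le> ennreal (real r * (1 / (z + \<kappa> / real r)) ^ p)"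
    proof (rule ennreal_leI)
      \<comment> \<open>The relative rise of the level. What remains is 1 - p x \<le> (1 + x)^-p, a
        case of Bernoulli's inequality.\<close>
      define x where "x = \<kappa> / (real r * z)"
      have x0: "x \<ge> 0" using \<kappa>0 r z0 by (simp add: x_def)
      have "?a * (real r * (1 / z) ^ p) + \<kappa> * (1/z) ^ Suc p = real r * (1 / z) ^ p * (1 - real p * x)"
        using r z0 by (simp add: x_def field_simps)
      also have "1 - real p * x \<le> (1 / (1 + x)) ^ p"
      proof -
        have "1 - real p * x \<le> (1 - x / (1 + x)) ^ p"
        proof -
          have "1 + real p * (- (x / (1 + x))) \<le> (1 + (- (x / (1 + x)))) ^ p"
            using x0 by (intro Bernoulli_inequality) (simp add: field_simps)
          moreover have "real p * (x / (1 + x)) \<le> real p * x"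
            using x0 by (intro mult_left_mono) (auto simp: field_simps)
          ultimately show ?thesis by simp
        qed
        also have "1 - x / (1 + x) = 1 / (1 + x)" using x0 by (simp add: field_simps)
        finally show ?thesis .
      qed
      also have "real r * (1 / z) ^ p * (1 / (1 + x)) ^ p = real r * (1 / (z + \<kappa> / real r)) ^ p"
      proof -
        have "(1 / z) * (1 / (1 + x)) = 1 / (z + \<kappa> / real r)"
          using r z0 x0 by (simp add: x_def field_simps)
        then show ?thesis by (simp only: mult.assoc power_mult_distrib[symmetric])
      qed
      finally show "?a * (real r * (1 / z) ^ p) + \<kappa> * (1/z) ^ Suc p \<le> real r * (1 / (z + \<kappa> / real r)) ^ p"
        using r z0 by (simp add: mult_left_mono)
    qed
    also have "z + \<kappa> / real r = c + \<kappa> * real (Suc n) / real r"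
      by (simp add: z_def add_divide_distrib algebra_simps)
    finally show ?case .
  qed
qed

text \<open>The constant 48 is spent here. Lowering sqrt 2 to 1 gives c \<ge> 48 (ln(2n) - ln
  \<delta>) \<ge> 24, so \<open>p\<close> is positive after rounding. Since p \<ge> c/2 - 2 and 6/7
  \<le> exp(-1/7), the exponent p/7 is at least (24/7)(ln(2n) - ln \<delta>) - 2/7, which exceeds ln
  n - ln \<delta>. The 1 subtracted in \<open>p\<close> serves p + 1 \<le> c/2.\<close>

lemma tail_exponent:
  fixes c \<delta> :: real
  assumes \<delta>: "0 < \<delta>" "\<delta> < 1" and r: "0 < r" "r \<le> n"
    and c: "48 * (sqrt 2 * ln (2 * real n) - ln \<delta>) \<le> c"
  defines "p \<equiv> nat \<lfloor>c / 2\<rfloor> - 1"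
  shows "0 < p" and "real (Suc p) \<le> c / 2" and "real r * (6/7) ^ p \<le> \<delta>"
proof -
  have n: "n \<ge> 1" using r by simp
  have ln2: "ln 2 \<ge> (1/2::real)" using ln_diff_le[of 1 2] by simp
  have lnn: "ln (2 * real n) = ln 2 + ln (real n)" using n by (simp add: ln_mult)
  have "0 \<le> ln (real n)" using n by simp
  have "1 * ln (2 * real n) \<le> sqrt 2 * ln (2 * real n)"
    using n by (intro mult_right_mono) auto
  then have "48 * (ln (2 * real n) - ln \<delta>) \<le> 48 * (sqrt 2 * ln (2 * real n) - ln \<delta>)"
    by (intro mult_left_mono diff_right_mono) simp_all
  then have c2: "48 * (ln (2 * real n) - ln \<delta>) \<le> c" using c by (rule order.trans)
  have ln\<delta>: "ln \<delta> < 0" using \<delta> by simp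
  then have c24: "c \<ge> 24" using c2 ln2 lnn \<open>0 \<le> ln (real n)\<close> by argo
  have "nat \<lfloor>c / 2\<rfloor> \<ge> 12" using c24 by linarith
  then have Suc: "real (Suc p) = real_of_int \<lfloor>c / 2\<rfloor>" 
    using \<open>nat \<lfloor>c / 2\<rfloor> \<ge> 12\<close> unfolding p_def by simp
  show "0 < p" using \<open>nat \<lfloor>c / 2\<rfloor> \<ge> 12\<close> unfolding p_def by linarith
  show "real (Suc p) \<le> c / 2" unfolding Suc by (rule of_int_floor_le)
  have "real (Suc p) \<ge> c / 2 - 1" unfolding Suc by linarith
  then have p: "real p \<ge> c / 2 - 2" unfolding of_nat_Suc by linarith
  have "(6/7::real) \<le> exp (- (1/7))" using exp_ge_add_one_self[of "- (1/7::real)"] by simp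
  then have "(6/7::real) ^ p \<le> exp (- (1/7)) ^ p" by (intro power_mono) auto
  also have "\<dots> = exp (- (real p / 7))" by (simp flip: exp_of_nat_mult)
  finally have "real r * (6/7) ^ p \<le> exp (ln (real r)) * exp (- (real p / 7))"
    using r by (simp add: mult_left_mono)
  also have "\<dots> = exp (ln (real r) - real p / 7)" by (simp flip: exp_add)
  also have "\<dots> \<le> exp (ln \<delta>)"
  proof -
    have "ln (real r) \<le> ln (real n)" using r by simp
    moreover have "real p / 7 \<ge> c / 14 - 2/7" using p by simp
    moreover have "c / 14 \<ge> (24/7) * (ln (2 * real n) - ln \<delta>)" using c2 by simp
    ultimately show ?thesis using lnn ln2 ln\<delta> \<open>0 \<le> ln (real n)\<close> unfolding exp_le_cancel_iff by argo
  qed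
  finally show "real r * (6/7) ^ p \<le> \<delta>" using \<delta> by simp
qed

text \<open>Markov's inequality for tr R^p at the level z^-p with z = 3c/2. Below that level the
  shifted operator is at least z I; removing the shift leaves c/2, and the scaling r/n = 1/c makes
  it 1/2.\<close>

lemma isotropic_lower_frame_bound:
  fixes u :: "'x \<Rightarrow> nat \<Rightarrow> real" and M :: "'x measure"
  assumes M: "prob_space M" and r: "0 < r" "r \<le> n"
    and meas: "\<And>k. (\<lambda>x. u x k) \<in> borel_measurable M"
    and u1: "\<And>x. ip r (u x) (u x) \<le> 1"
    and iso: "\<And>k l. k < r \<Longrightarrow> l < r \<Longrightarrow> (\<integral>x. u x k * u x l \<partial>M) = (if k = l then 1 / real r else 0)"
    and \<delta>: "0 < \<delta>" "\<delta> < 1"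
    and n: "48 * (sqrt 2 * ln (2 * real n) - ln \<delta>) \<le> real n / real r"
  obtains E where "E \<in> sets (PiM {..<n} (\<lambda>_. M))"
    "ennreal (1 - \<delta>) \<le> emeasure (PiM {..<n} (\<lambda>_. M)) E"
    "\<And>\<omega> a. \<omega> \<in> E \<Longrightarrow> ip r a a / 2 \<le> (real r / real n) * (\<Sum>j<n. (ip r (u (\<omega> j)) a)\<^sup>2)"
proof -
  let ?P = "PiM {..<n} (\<lambda>_. M)"
  interpret P: prob_space ?P by (rule prob_space_PiM) (rule M)
  define c where "c = real n / real r"
  have c0: "c > 0" using r by (simp add: c_def)
  define p where "p = nat \<lfloor>c / 2\<rfloor> - 1"
  note p = tail_exponent[OF \<delta> r n, folded c_def, folded p_def]
  define \<kappa> where "\<kappa> = 1 - real (Suc p) / (2 * c)"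
  have \<kappa>: "\<kappa> \<ge> 3/4" using p(2) c0 unfolding \<kappa>_def by (simp add: field_simps)
  define T where "T \<omega> = trp r (inv_op r c (\<lambda>j. u (\<omega> j)) n) p" for \<omega>
  have T0: "0 \<le> T \<omega>" for \<omega> unfolding T_def by (rule trp_nonneg[OF psd_inv_op[OF c0]])
  have Tm: "T \<in> borel_measurable ?P"
    unfolding T_def
    by (intro measurable_trp_inv_op measurable_PiM_component_fun meas) auto
  define z where "z = 3 / 2 * c"
  have z0: "z > 0" using c0 by (simp add: z_def)
  define E where "E = {\<omega> \<in> space ?P. T \<omega> \<le> (1/z) ^ p}"
  have E: "E \<in> sets ?P" unfolding E_def using Tm by measurable
  have "emeasure ?P (space ?P - E) \<le> emeasure ?P {\<omega> \<in> space ?P. 1 \<le> ennreal (z ^ p) * ennreal (T \<omega>)}"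
  proof (rule emeasure_mono)
    show "space ?P - E \<subseteq> {\<omega> \<in> space ?P. 1 \<le> ennreal (z ^ p) * ennreal (T \<omega>)}"
    proof safe
      fix \<omega> assume "\<omega> \<in> space ?P" "\<omega> \<notin> E"
      then have "(1/z) ^ p < T \<omega>" by (simp add: E_def)
      then have "1 \<le> z ^ p * T \<omega>" using z0 by (simp add: field_simps)
      then show "1 \<le> ennreal (z ^ p) * ennreal (T \<omega>)"
        using z0 T0 by (simp flip: ennreal_mult)
    qed
  qed (use Tm in measurable)
  also have "\<dots> \<le> ennreal (z ^ p) * (\<integral>\<^sup>+\<omega>. ennreal (T \<omega>) \<partial>?P)"
  proof -
    have "emeasure ?P {\<omega> \<in> space ?P. 1 \<le> ennreal (z ^ p) * ennreal (T \<omega>)}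
        \<le> ennreal (z ^ p) * (\<integral>\<^sup>+\<omega>. ennreal (T \<omega>) * indicator (space ?P) \<omega> \<partial>?P)"
      by (intro nn_integral_Markov_inequality) (use Tm in auto)
    also have "(\<integral>\<^sup>+\<omega>. ennreal (T \<omega>) * indicator (space ?P) \<omega> \<partial>?P) = (\<integral>\<^sup>+\<omega>. ennreal (T \<omega>) \<partial>?P)"
      by (intro nn_integral_cong) simp
    finally show ?thesis .
  qed
  also have "\<dots> \<le> ennreal (z ^ p) * ennreal (real r * (1 / (c + \<kappa> * real n / real r)) ^ p)"
    unfolding T_def
    by (intro mult_left_mono expected_trp_inv_op[OF M r(1) meas u1 iso _ \<kappa>_def]) (use p(2) c0 in auto)
  \<comment> \<open>Here n/r = c, so the final level is (1 + \<kappa>) c \<ge> 7c/4, and (3/2)/(7/4)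
    = 6/7.\<close>
  also have "\<dots> = ennreal (real r * (z / (c + \<kappa> * c)) ^ p)"
    using z0 c0 \<kappa> by (simp add: c_def power_divide mult_ac flip: ennreal_mult)
  also have "\<dots> \<le> ennreal (real r * (6/7) ^ p)"
  proof (intro ennreal_leI mult_left_mono power_mono)
    have "c * (7/4) \<le> c + \<kappa> * c" using mult_right_mono[OF \<kappa>, of c] c0 by simp
    moreover have "0 < c + \<kappa> * c" using c0 \<kappa> by (intro add_pos_pos mult_pos_pos) auto
    ultimately show "z / (c + \<kappa> * c) \<le> 6 / 7" unfolding z_def by (subst pos_divide_le_eq) auto
  qed (use z0 c0 \<kappa> in auto)
  also have "\<dots> \<le> ennreal \<delta>" by (rule ennreal_leI[OF p(3)])
  finally have "P.prob (space ?P - E) \<le> \<delta>" using \<delta> by (simp add: P.emeasure_eq_measure)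
  then have "1 - \<delta> \<le> P.prob E" using P.prob_compl[OF E] by simp
  then have "ennreal (1 - \<delta>) \<le> emeasure ?P E" by (simp add: P.emeasure_eq_measure)
  moreover have "ip r a a / 2 \<le> (real r / real n) * (\<Sum>j<n. (ip r (u (\<omega> j)) a)\<^sup>2)" if "\<omega> \<in> E" for \<omega> a
  proof -
    let ?us = "\<lambda>j. u (\<omega> j)"
    have "z * ip r a a \<le> ip r a (frame_op r c ?us n a)"
      by (rule trp_imp_lower_bound[OF psd_inv_op[OF c0] psd_frame_op frame_op_inv_op[OF c0] p(1) z0])
        (use that c0 in \<open>auto simp: E_def T_def\<close>)
    then have "c * (ip r a a / 2) \<le> (\<Sum>j<n. (ip r (u (\<omega> j)) a)\<^sup>2)"
      unfolding ip_frame_op by (simp add: z_def power2_eq_square algebra_simps)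
    then show ?thesis using r by (simp add: c_def field_simps)
  qed
  ultimately show ?thesis using that E by blast
qed

section \<open>Orthonormal systems of square-integrable functions\<close>

text \<open>Kept as a predicate on functions rather than on classes, because sampling needs point
  values.\<close>

definition square_int :: "'b measure \<Rightarrow> ('b \<Rightarrow> real) \<Rightarrow> bool" where
  "square_int M f \<longleftrightarrow> f \<in> borel_measurable M \<and> integrable M (\<lambda>x. (f x)\<^sup>2)"

lemma square_int_measurable: "square_int M f \<Longrightarrow> f \<in> borel_measurable M"
  by (simp add: square_int_def)

lemma square_int_mult:
  assumes "square_int M f" "square_int M g"
  shows "integrable M (\<lambda>x. f x * g x)"
proof (rule Bochner_Integration.integrable_bound)
  show "integrable M (\<lambda>x. (f x)\<^sup>2 + (g x)\<^sup>2)" using assms by (simp add: square_int_def)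
  have "\<bar>a * b\<bar> \<le> \<bar>a\<^sup>2 + b\<^sup>2\<bar>" for a b :: real
  proof -
    have "2 * \<bar>a * b\<bar> \<le> a\<^sup>2 + b\<^sup>2"
      using sum_squares_bound[of "\<bar>a\<bar>" "\<bar>b\<bar>"] by (simp add: abs_mult)
    moreover have "0 \<le> \<bar>a * b\<bar>" by simp
    ultimately show ?thesis by linarith
  qed
  then show "AE x in M. norm (f x * g x) \<le> norm ((f x)\<^sup>2 + (g x)\<^sup>2)"
    unfolding real_norm_def by (intro AE_I2)
qed (use assms in \<open>auto simp: square_int_def\<close>)

lemma square_int_scale: "square_int M f \<Longrightarrow> square_int M (\<lambda>x. a * f x)"
  by (auto simp: square_int_def power_mult_distrib)

lemma square_int_add:
  assumes "square_int M f" "square_int M g"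
  shows "square_int M (\<lambda>x. f x + g x)"
proof -
  have "integrable M (\<lambda>x. (f x)\<^sup>2 + (g x)\<^sup>2 + 2 * (f x * g x))"
    using assms square_int_mult[OF assms] unfolding square_int_def by auto
  then show ?thesis using assms by (auto simp: square_int_def power2_sum mult.assoc)
qed

lemma square_int_diff:
  assumes "square_int M f" "square_int M g"
  shows "square_int M (\<lambda>x. f x - g x)"
  using square_int_add[OF assms(1) square_int_scale[OF assms(2), of "-1"]] by simp

lemma square_int_0: "square_int M (\<lambda>x. 0)"
  by (simp add: square_int_def)

lemma square_int_lincomb:
  assumes "\<And>k. k < (r::nat) \<Longrightarrow> square_int M (e k)"
  shows "square_int M (\<lambda>x. \<Sum>k<r. a k * e k x)"
  using assms by (induction r) (auto intro!: square_int_add square_int_scale square_int_0)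

definition orthonormal :: "'b measure \<Rightarrow> nat \<Rightarrow> (nat \<Rightarrow> 'b \<Rightarrow> real) \<Rightarrow> bool" where
  "orthonormal M r e \<longleftrightarrow> (\<forall>k<r. square_int M (e k)) \<and>
     (\<forall>k<r. \<forall>l<r. (\<integral>x. e k x * e l x \<partial>M) = (if k = l then 1 else 0))"

lemma integral_lincomb:
  assumes "\<And>k. k < (r::nat) \<Longrightarrow> square_int M (e k)" "square_int M f"
  shows "(\<integral>x. f x * (\<Sum>k<r. a k * e k x) \<partial>M) = (\<Sum>k<r. a k * (\<integral>x. f x * e k x \<partial>M))"
proof -
  have "(\<integral>x. f x * (\<Sum>k<r. a k * e k x) \<partial>M) = (\<integral>x. (\<Sum>k<r. a k * (f x * e k x)) \<partial>M)"
    by (simp add: sum_distrib_left mult_ac)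
  also have "\<dots> = (\<Sum>k<r. a k * (\<integral>x. f x * e k x \<partial>M))"
    using square_int_mult[OF assms(2,1)] by (subst Bochner_Integration.integral_sum) auto
  finally show ?thesis .
qed

lemma orthonormal_lincomb:
  assumes "orthonormal M r e" and "k < r"
  shows "(\<integral>x. e k x * (\<Sum>l<r. a l * e l x) \<partial>M) = a k"
proof -
  have "(\<integral>x. e k x * (\<Sum>l<r. a l * e l x) \<partial>M) = (\<Sum>l<r. a l * (\<integral>x. e k x * e l x \<partial>M))"
    using assms by (intro integral_lincomb) (auto simp: orthonormal_def)
  also have "\<dots> = (\<Sum>l<r. if l = k then a k else 0)"
    using assms by (intro sum.cong) (auto simp: orthonormal_def)
  finally show ?thesis using assms by simp
qed

lemma orthonormal_norm:
  assumes "orthonormal M r e"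
  shows "(\<integral>x. (\<Sum>l<r. a l * e l x)\<^sup>2 \<partial>M) = (\<Sum>l<r. (a l)\<^sup>2)"
proof -
  have e: "square_int M (e k)" if "k < r" for k using assms that by (simp add: orthonormal_def)
  have "(\<integral>x. (\<Sum>l<r. a l * e l x) * (\<Sum>l<r. a l * e l x) \<partial>M)
      = (\<Sum>k<r. a k * (\<integral>x. (\<Sum>l<r. a l * e l x) * e k x \<partial>M))"
    by (intro integral_lincomb square_int_lincomb e)
  also have "\<dots> = (\<Sum>k<r. a k * a k)"
    using orthonormal_lincomb[OF assms, of _ a] by (intro sum.cong) (auto simp: mult.commute)
  finally show ?thesis by (simp add: power2_eq_square)
qed

lemma orthonormal_residual:
  assumes on: "orthonormal M r e" and f: "square_int M f" and k: "k < r"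
  shows "(\<integral>x. e k x * (f x - (\<Sum>l<r. (\<integral>y. f y * e l y \<partial>M) * e l x)) \<partial>M) = 0"
proof -
  have e: "square_int M (e k)" if "k < r" for k using on that by (simp add: orthonormal_def)
  let ?s = "\<lambda>x. (\<Sum>l<r. (\<integral>y. f y * e l y \<partial>M) * e l x)"
  have "(\<integral>x. e k x * (f x - ?s x) \<partial>M) = (\<integral>x. e k x * f x - e k x * ?s x \<partial>M)"
    by (simp add: algebra_simps)
  also have "\<dots> = (\<integral>x. e k x * f x \<partial>M) - (\<integral>x. e k x * ?s x \<partial>M)"
    by (intro Bochner_Integration.integral_diff square_int_mult e k f square_int_lincomb)
  also have "\<dots> = 0" unfolding orthonormal_lincomb[OF on k] by (simp add: mult.commute)
  finally show ?thesis .
qed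

text \<open>No \<open>h j\<close> need be square integrable: only the square-integrable linear combinations are spanned.\<close>

lemma gram_schmidt:
  fixes h :: "nat \<Rightarrow> 'b \<Rightarrow> real"
  assumes "\<And>j. j < m \<Longrightarrow> h j \<in> borel_measurable M"
  shows "\<exists>r\<le>m. \<exists>C. orthonormal M r (\<lambda>k x. \<Sum>j<m. C k j * h j x) \<and>
    (\<forall>b. square_int M (\<lambda>x. \<Sum>j<m. b j * h j x) \<longrightarrow>
      (\<exists>a. AE x in M. (\<Sum>j<m. b j * h j x) = (\<Sum>k<r. a k * (\<Sum>j<m. C k j * h j x))))"
  using assms
proof (induction m)
  case 0
  show ?case by (rule exI[of _ 0]) (simp add: orthonormal_def)
next
  case (Suc m)
  then obtain r C where r: "r \<le> m" and on: "orthonormal M r (\<lambda>k x. \<Sum>j<m. C k j * h j x)"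
    and sp: "\<And>b. square_int M (\<lambda>x. \<Sum>j<m. b j * h j x) \<Longrightarrow>
      (\<exists>a. AE x in M. (\<Sum>j<m. b j * h j x) = (\<Sum>k<r. a k * (\<Sum>j<m. C k j * h j x)))"
    by auto
  define e where "e k x = (\<Sum>j<m. C k j * h j x)" for k x
  have on: "orthonormal M r e" using on by (simp add: e_def[abs_def])
  have eS: "square_int M (e k)" if "k < r" for k using on that by (simp add: orthonormal_def)
  have sp: "\<exists>a. AE x in M. (\<Sum>j<m. b j * h j x) = (\<Sum>k<r. a k * e k x)"
    if "square_int M (\<lambda>x. \<Sum>j<m. b j * h j x)" for b
    using sp[OF that] by (simp add: e_def)
  \<comment> \<open>Coefficients are carried along, padded by 0 at the new index, because the
    applications need the basis as explicit combinations: in the Gaussian case these are again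
    continuous linear functionals.\<close>
  define C' where "C' k j = (if j < m then C k j else 0)" for k j
  have e': "(\<Sum>j<Suc m. C' k j * h j x) = e k x" for k x
    by (simp add: C'_def e_def)
  show ?case
  \<comment> \<open>If there is no such combination, \<open>h m\<close> never enters a
    square-integrable sum and the old system still spans.\<close>
  proof (cases "\<exists>b. b m \<noteq> 0 \<and> square_int M (\<lambda>x. \<Sum>j<Suc m. b j * h j x)")
    case False
    have "\<exists>a. AE x in M. (\<Sum>j<Suc m. b j * h j x) = (\<Sum>k<r. a k * e k x)"
      if "square_int M (\<lambda>x. \<Sum>j<Suc m. b j * h j x)" for b
    proof -
      have "b m = 0" using False that by blast
      then show ?thesis using sp[of b] that by simp
    qed
    then have "orthonormal M r (\<lambda>k x. \<Sum>j<Suc m. C' k j * h j x) \<and>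
      (\<forall>b. square_int M (\<lambda>x. \<Sum>j<Suc m. b j * h j x) \<longrightarrow>
      (\<exists>a. AE x in M. (\<Sum>j<Suc m. b j * h j x) = (\<Sum>k<r. a k * (\<Sum>j<Suc m. C' k j * h j x))))"
      unfolding e' using on by blast
    moreover have "r \<le> Suc m" using r by simp
    ultimately show ?thesis by blast
  next
    case True
    then obtain b where bm: "b m \<noteq> 0" and b: "square_int M (\<lambda>x. \<Sum>j<Suc m. b j * h j x)" by blast
    define g where "g x = (\<Sum>j<Suc m. b j * h j x)" for x
    have g: "square_int M g" using b by (simp add: g_def[abs_def])
    define g' where "g' x = g x - (\<Sum>k<r. (\<integral>y. g y * e k y \<partial>M) * e k x)" for x
    have g': "square_int M g'" unfolding g'_def by (intro square_int_diff g square_int_lincomb eS)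
    have orth: "(\<integral>x. e k x * g' x \<partial>M) = 0" if "k < r" for k
      unfolding g'_def by (rule orthonormal_residual[OF on g that])
    \<comment> \<open>Subtracting the multiple \<open>b' m / b m\<close> of \<open>g\<close> removes
      \<open>h m\<close>; the remainder is square integrable and involves only the first
      \<open>m\<close> functions, so the induction hypothesis applies.\<close>
    have red: "\<exists>a. AE x in M. (\<Sum>j<Suc m. b' j * h j x) = b' m / b m * g' x + (\<Sum>k<r. a k * e k x)"
      if b': "square_int M (\<lambda>x. \<Sum>j<Suc m. b' j * h j x)" for b'
    proof -
      let ?t = "b' m / b m"
      have eq: "(\<Sum>j<Suc m. b' j * h j x) - ?t * g x = (\<Sum>j<m. (b' j - ?t * b j) * h j x)" for x
        using bm by (simp add: g_def algebra_simps sum_subtractf sum_distrib_left)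
      have "square_int M (\<lambda>x. \<Sum>j<m. (b' j - ?t * b j) * h j x)"
        unfolding eq[symmetric] by (intro square_int_diff b' square_int_scale g)
      from sp[OF this] obtain a where
        "AE x in M. (\<Sum>j<m. (b' j - ?t * b j) * h j x) = (\<Sum>k<r. a k * e k x)" by blast
      then have "AE x in M. (\<Sum>j<Suc m. b' j * h j x) =
          ?t * g' x + (\<Sum>k<r. (a k + ?t * (\<integral>y. g y * e k y \<partial>M)) * e k x)"
      proof eventually_elim
        case (elim x)
        then show ?case unfolding eq[symmetric] g'_def
          by (simp add: algebra_simps sum.distrib sum_distrib_left del: sum.lessThan_Suc)
      qed
      then show ?thesis by (intro exI[of _ "\<lambda>k. a k + ?t * (\<integral>y. g y * e k y \<partial>M)"])
    qed
    define s where "s = (\<integral>x. (g' x)\<^sup>2 \<partial>M)"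
    have s0: "s \<ge> 0" by (simp add: s_def)
    show ?thesis
    \<comment> \<open>If the orthogonal part is null, the new function adds no dimension; so the
      final rank may lie below \<open>m\<close>.\<close>
    proof (cases "s = 0")
      case True
      have "AE x in M. (g' x)\<^sup>2 = 0"
        using True g' unfolding s_def square_int_def
        by (subst (asm) integral_nonneg_eq_0_iff_AE) auto
      then have z: "AE x in M. g' x = 0" by simp
      have "\<exists>a. AE x in M. (\<Sum>j<Suc m. b' j * h j x) = (\<Sum>k<r. a k * e k x)"
        if b': "square_int M (\<lambda>x. \<Sum>j<Suc m. b' j * h j x)" for b'
      proof -
        from red[OF b'] obtain a where
          "AE x in M. (\<Sum>j<Suc m. b' j * h j x) = b' m / b m * g' x + (\<Sum>k<r. a k * e k x)" by blast
        with z have "AE x in M. (\<Sum>j<Suc m. b' j * h j x) = (\<Sum>k<r. a k * e k x)"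
          by eventually_elim simp
        then show ?thesis by (intro exI[of _ a])
      qed
      then have "orthonormal M r (\<lambda>k x. \<Sum>j<Suc m. C' k j * h j x) \<and>
      (\<forall>b. square_int M (\<lambda>x. \<Sum>j<Suc m. b j * h j x) \<longrightarrow>
      (\<exists>a. AE x in M. (\<Sum>j<Suc m. b j * h j x) = (\<Sum>k<r. a k * (\<Sum>j<Suc m. C' k j * h j x))))"
      unfolding e' using on by blast
    moreover have "r \<le> Suc m" using r by simp
    ultimately show ?thesis by blast
    next
      case False
      then have s: "s > 0" using s0 by simp
      define C'' where "C'' k j = (if k < r then C' k j
        else (b j - (\<Sum>k<r. (\<integral>y. g y * e k y \<partial>M) * C' k j)) / sqrt s)" for k j
      define e2 where "e2 k x = (if k < r then e k x else g' x / sqrt s)" for k x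
      have g'C: "g' x = (\<Sum>j<Suc m. (b j - (\<Sum>k<r. (\<integral>y. g y * e k y \<partial>M) * C' k j)) * h j x)" for x
      proof -
        have "(\<Sum>k<r. (\<integral>y. g y * e k y \<partial>M) * e k x)
          = (\<Sum>j<Suc m. (\<Sum>k<r. (\<integral>y. g y * e k y \<partial>M) * C' k j) * h j x)"
          unfolding e'[symmetric] sum_distrib_left sum_distrib_right mult.assoc[symmetric]
          by (rule sum.swap)
        then show ?thesis unfolding g'_def g_def by (simp only: left_diff_distrib sum_subtractf)
      qed
      have e2: "(\<Sum>j<Suc m. C'' k j * h j x) = e2 k x" for k x
      proof (cases "k < r")
        case True then show ?thesis using e' by (simp add: C''_def e2_def del: sum.lessThan_Suc)
      next
        case False
        then show ?thesis unfolding C''_def e2_def g'C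
          by (simp add: sum_divide_distrib del: sum.lessThan_Suc)
      qed
      have e2S: "square_int M (e2 k)" for k
        unfolding e2_def using eS square_int_scale[OF g', of "1 / sqrt s"] by (cases "k < r") auto
      have "(\<integral>x. e2 k x * e2 l x \<partial>M) = (if k = l then 1 else 0)" if "k < Suc r" "l < Suc r" for k l
      proof (cases "k < r"; cases "l < r")
        assume "k < r" "l < r" then show ?thesis using on by (simp add: e2_def orthonormal_def)
      next
        assume "k < r" "\<not> l < r" then show ?thesis using orth[of k] by (simp add: e2_def)
      next
        assume "\<not> k < r" "l < r" then show ?thesis using orth[of l] by (simp add: e2_def mult.commute)
      next
        assume "\<not> k < r" "\<not> l < r"
        moreover have "(\<integral>x. g' x * g' x \<partial>M) / s = 1" using s by (simp add: s_def power2_eq_square)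
        ultimately show ?thesis using that s by (simp add: e2_def)
      qed
      then have on2: "orthonormal M (Suc r) e2" using e2S by (auto simp: orthonormal_def)
      have "\<exists>a. AE x in M. (\<Sum>j<Suc m. b' j * h j x) = (\<Sum>k<Suc r. a k * e2 k x)"
        if b': "square_int M (\<lambda>x. \<Sum>j<Suc m. b' j * h j x)" for b'
      proof -
        from red[OF b'] obtain a where
          *: "AE x in M. (\<Sum>j<Suc m. b' j * h j x) = b' m / b m * g' x + (\<Sum>k<r. a k * e k x)" by blast
        have **: "(\<Sum>k<Suc r. (if k < r then a k else b' m / b m * sqrt s) * e2 k x)
           = b' m / b m * g' x + (\<Sum>k<r. a k * e k x)" for x
        proof -
          have "(\<Sum>k<r. (if k < r then a k else b' m / b m * sqrt s) * e2 k x) = (\<Sum>k<r. a k * e k x)"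
            by (rule sum.cong) (auto simp: e2_def)
          then show ?thesis using s by (simp add: e2_def)
        qed
        show ?thesis using * unfolding **[symmetric]
          by (intro exI[of _ "\<lambda>k. if k < r then a k else b' m / b m * sqrt s"])
      qed
      then have "orthonormal M (Suc r) (\<lambda>k x. \<Sum>j<Suc m. C'' k j * h j x) \<and>
        (\<forall>b. square_int M (\<lambda>x. \<Sum>j<Suc m. b j * h j x) \<longrightarrow>
        (\<exists>a. AE x in M. (\<Sum>j<Suc m. b j * h j x) = (\<Sum>k<Suc r. a k * (\<Sum>j<Suc m. C'' k j * h j x))))"
        unfolding e2 using on2 by blast
      moreover have "Suc r \<le> Suc m" using r by simp
      ultimately show ?thesis by blast
    qed
  qed
qed

section \<open>Gaussian regression\<close>

lemma bounded_linear_measurable_gaussian: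
  fixes \<mu> :: "'f::real_normed_vector measure"
  assumes "gaussian_measure \<mu>" "bounded_linear (L :: 'f \<Rightarrow> real)"
  shows "L \<in> borel_measurable \<mu>"
proof -
  have "L \<in> borel_measurable borel"
    using assms(2) by (intro borel_measurable_continuous_onI) (simp add: linear_continuous_on)
  moreover have "sets \<mu> = sets borel" using assms(1) by (simp add: gaussian_measure_def)
  ultimately show ?thesis using measurable_cong_sets[of \<mu> borel borel borel] by simp
qed

text \<open>The degenerate and the normal case share the formula exp(-Var/2). Frequency 1 is enough,
  because multiples of a functional are again functionals.\<close>

lemma gaussian_functional:
  fixes \<mu> :: "'f::real_normed_vector measure"
  assumes G: "gaussian_measure \<mu>" and L: "bounded_linear (L :: 'f \<Rightarrow> real)"
  shows "square_int \<mu> L"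
    and "(CLINT f|\<mu>. iexp (L f)) = complex_of_real (exp (- (\<integral>f. (L f)\<^sup>2 \<partial>\<mu>) / 2))"
proof -
  interpret prob_space \<mu> using G by (simp add: gaussian_measure_def)
  have m: "L \<in> borel_measurable \<mu>" by (rule bounded_linear_measurable_gaussian[OF G L])
  have ml: "L \<in> measurable \<mu> lborel" using m by simp
  from G L have "distr \<mu> lborel L = return lborel 0 \<or>
        (\<exists>\<sigma>>0. distr \<mu> lborel L = density lborel (normal_density 0 \<sigma>))"
    by (auto simp: gaussian_measure_def)
  then have "square_int \<mu> L \<and> (CLINT f|\<mu>. iexp (L f)) = complex_of_real (exp (- (\<integral>f. (L f)\<^sup>2 \<partial>\<mu>) / 2))"
  proof (elim disjE exE conjE)
    assume d: "distr \<mu> lborel L = return lborel 0"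
    have "AE x in return lborel 0. x = (0::real)" by (subst AE_return) auto
    then have "AE x in distr \<mu> lborel L. x = 0" unfolding d .
    then have z: "AE f in \<mu>. L f = 0" by (subst (asm) AE_distr_iff[OF ml]) auto
    have "integrable \<mu> (\<lambda>f. (L f)\<^sup>2) \<longleftrightarrow> integrable \<mu> (\<lambda>f. 0::real)"
      using z m by (intro integrable_cong_AE) auto
    moreover have "(\<integral>f. (L f)\<^sup>2 \<partial>\<mu>) = (\<integral>f. 0 \<partial>\<mu>)"
      using z m by (intro integral_cong_AE) auto
    moreover have "(CLINT f|\<mu>. iexp (L f)) = (CLINT f|\<mu>. 1)"
      using z m by (intro integral_cong_AE) auto
    ultimately show ?thesis using m by (simp add: square_int_def prob_space)
  next
    fix \<sigma> :: real assume \<sigma>: "\<sigma> > 0" and d: "distr \<mu> lborel L = density lborel (normal_density 0 \<sigma>)"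
    have D: "distributed \<mu> lborel L (normal_density 0 \<sigma>)"
      using d ml by (simp add: distributed_def)
    have std: "distributed \<mu> lborel (\<lambda>f. L f / \<sigma>) std_normal_density"
      using D unfolding normal_standard_normal_convert[OF \<sigma>] by simp
    have bi: "has_bochner_integral lborel (\<lambda>x. normal_density 0 \<sigma> x * x\<^sup>2) (\<sigma>\<^sup>2)"
      using normal_moment_even[OF \<sigma>, of 0 1] by simp
    have "integrable (distr \<mu> lborel L) (\<lambda>x. x\<^sup>2)"
      unfolding d using bi by (subst integrable_density) (auto simp: has_bochner_integral_iff)
    then have i: "integrable \<mu> (\<lambda>f. (L f)\<^sup>2)" by (rule integrable_distr[OF ml])
    have "(\<integral>f. (L f)\<^sup>2 \<partial>\<mu>) = (\<integral>x. x\<^sup>2 \<partial>distr \<mu> lborel L)"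
      by (subst integral_distr[OF ml]) auto
    also have "\<dots> = \<sigma>\<^sup>2"
      unfolding d using bi by (subst integral_density) (auto simp: has_bochner_integral_iff)
    finally have v: "(\<integral>f. (L f)\<^sup>2 \<partial>\<mu>) = \<sigma>\<^sup>2" .
    have "distr \<mu> lborel (\<lambda>f. L f / \<sigma>) = std_normal_distribution"
      using std by (simp add: distributed_def)
    \<comment> \<open>Scaling to the standard normal law moves \<sigma> into the frequency.\<close>
    moreover have "(CLINT f|\<mu>. iexp (L f)) = (CLINT x|distr \<mu> lborel (\<lambda>f. L f / \<sigma>). iexp (\<sigma> * x))"
      using m \<sigma> by (subst integral_distr) auto
    ultimately have "(CLINT f|\<mu>. iexp (L f)) = char std_normal_distribution \<sigma>"
      by (simp add: char_def)
    then show ?thesis using m i by (simp add: square_int_def v char_std_normal_distribution)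
  qed
  then show "square_int \<mu> L"
    "(CLINT f|\<mu>. iexp (L f)) = complex_of_real (exp (- (\<integral>f. (L f)\<^sup>2 \<partial>\<mu>) / 2))" by auto
qed

text \<open>\<open>s Z + Y\<close> and \<open>- s Z + Y\<close> have the same variance, hence the same characteristic function; so
  \<open>sin (s Z) iexp Y\<close> has mean zero, and dividing by \<open>s\<close> and letting \<open>s \<rightarrow> 0\<close> gives the claim.\<close>

lemma gaussian_orthogonal_iexp:
  fixes \<mu> :: "'f::real_normed_vector measure" and Z Y :: "'f \<Rightarrow> real"
  assumes G: "gaussian_measure \<mu>" and Z: "bounded_linear Z" and Y: "bounded_linear Y"
    and orth: "(\<integral>f. Z f * Y f \<partial>\<mu>) = 0"
  shows "(CLINT f|\<mu>. complex_of_real (Z f) * iexp (Y f)) = 0"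
proof -
  interpret prob_space \<mu> using G by (simp add: gaussian_measure_def)
  have sZ: "square_int \<mu> Z" and sY: "square_int \<mu> Y" by (rule gaussian_functional[OF G] Z Y)+
  have [measurable]: "Z \<in> borel_measurable \<mu>" "Y \<in> borel_measurable \<mu>"
    using sZ sY by (auto simp: square_int_def)
  have var: "(\<integral>f. (s * Z f + Y f)\<^sup>2 \<partial>\<mu>) = s\<^sup>2 * (\<integral>f. (Z f)\<^sup>2 \<partial>\<mu>) + (\<integral>f. (Y f)\<^sup>2 \<partial>\<mu>)" for s
  proof -
    have "(\<integral>f. (s * Z f + Y f)\<^sup>2 \<partial>\<mu>) = (\<integral>f. s\<^sup>2 * (Z f)\<^sup>2 + 2 * s * (Z f * Y f) + (Y f)\<^sup>2 \<partial>\<mu>)"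
      by (intro Bochner_Integration.integral_cong) (auto simp: power2_eq_square algebra_simps)
    also have "\<dots> = s\<^sup>2 * (\<integral>f. (Z f)\<^sup>2 \<partial>\<mu>) + 2 * s * (\<integral>f. Z f * Y f \<partial>\<mu>) + (\<integral>f. (Y f)\<^sup>2 \<partial>\<mu>)"
      using sZ sY square_int_mult[OF sZ sY] by (simp add: square_int_def)
    finally show ?thesis using orth by simp
  qed
  have F: "(CLINT f|\<mu>. iexp (s * Z f + Y f)) =
      complex_of_real (exp (- (s\<^sup>2 * (\<integral>f. (Z f)\<^sup>2 \<partial>\<mu>) + (\<integral>f. (Y f)\<^sup>2 \<partial>\<mu>)) / 2))" for s
  proof -
    have "bounded_linear (\<lambda>f. s * Z f + Y f)"
      by (intro bounded_linear_add bounded_linear_const_mult Z Y)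
    from gaussian_functional(2)[OF G this] show ?thesis by (simp only: var)
  qed
  have int: "integrable \<mu> (\<lambda>f. iexp (s * Z f + Y f))" for s
    by (intro integrable_iexp) auto
  have sin0: "(CLINT f|\<mu>. complex_of_real (sin (s * Z f)) * iexp (Y f)) = 0" for s
  proof -
    have "(CLINT f|\<mu>. iexp (s * Z f + Y f) - iexp ((-s) * Z f + Y f)) = 0"
      by (subst Bochner_Integration.integral_diff[OF int int]) (simp only: F, simp)
    moreover have "iexp (s * Z f + Y f) - iexp ((-s) * Z f + Y f)
       = 2 * \<i> * (complex_of_real (sin (s * Z f)) * iexp (Y f))" for f
    proof -
      have "iexp (s * Z f + Y f) - iexp ((-s) * Z f + Y f) = (iexp (s * Z f) - iexp (- (s * Z f))) * iexp (Y f)"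
        by (simp add: exp_add exp_diff exp_minus divide_inverse algebra_simps)
      also have "iexp (s * Z f) - iexp (- (s * Z f)) = 2 * \<i> * complex_of_real (sin (s * Z f))"
        by (simp add: complex_eq_iff Re_exp Im_exp)
      finally show ?thesis by (simp add: mult.assoc)
    qed
    ultimately show ?thesis by (simp only: integral_mult_right_zero) simp
  qed
  have "(\<lambda>n. CLINT f|\<mu>. complex_of_real (real (Suc n) * sin (1 / real (Suc n) * Z f)) * iexp (Y f))
     \<longlonglongrightarrow> (CLINT f|\<mu>. complex_of_real (Z f) * iexp (Y f))"
  \<comment> \<open>The majorant |Z| comes from |sin x| \<le> |x|, the factor \<open>Suc n\<close>
    cancelling.\<close>
  proof (rule integral_dominated_convergence[where w="\<lambda>f. \<bar>Z f\<bar>"])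
    show "integrable \<mu> (\<lambda>f. \<bar>Z f\<bar>)"
      using square_int_mult[OF sZ, of "\<lambda>_. 1"] by (simp add: square_int_def)
    show "AE f in \<mu>. (\<lambda>n. complex_of_real (real (Suc n) * sin (1 / real (Suc n) * Z f)) * iexp (Y f))
       \<longlonglongrightarrow> complex_of_real (Z f) * iexp (Y f)"
    proof (intro AE_I2 tendsto_mult tendsto_of_real tendsto_const)
      fix f
      have "(\<lambda>n. real (Suc n) * sin (1 / real (Suc n) * z)) \<longlonglongrightarrow> z" for z :: real
      proof (cases "z = 0")
        case False
        have "(\<lambda>n. z / real (Suc n)) \<longlonglongrightarrow> 0"
          using tendsto_mult[OF tendsto_const[of z] LIMSEQ_inverse_real_of_nat] by (simp add: divide_inverse)
        then have "filterlim (\<lambda>n. z / real (Suc n)) (at 0) sequentially"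
          using False by (simp add: filterlim_at)
        moreover have "((\<lambda>x::real. sin x / x) \<longlongrightarrow> 1) (at 0)"
          using DERIV_sin[of 0] by (simp add: has_field_derivative_iff)
        ultimately have "(\<lambda>n. sin (z / real (Suc n)) / (z / real (Suc n))) \<longlonglongrightarrow> 1"
          by (rule filterlim_compose[rotated])
        from tendsto_mult[OF tendsto_const[of z] this]
        have "(\<lambda>n. z * (sin (z / real (Suc n)) / (z / real (Suc n)))) \<longlonglongrightarrow> z" by simp
        moreover have "z * (sin (z / real (Suc n)) / (z / real (Suc n))) = real (Suc n) * sin (1 / real (Suc n) * z)" for n
          using False by (simp del: of_nat_Suc)
        ultimately show ?thesis by (simp only:)
      qed simp
      then show "(\<lambda>n. real (Suc n) * sin (1 / real (Suc n) * Z f)) \<longlonglongrightarrow> Z f" .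
    qed
    show "AE f in \<mu>. norm (complex_of_real (real (Suc n) * sin (1 / real (Suc n) * Z f)) * iexp (Y f)) \<le> \<bar>Z f\<bar>" for n
    proof (rule AE_I2)
      fix f
      have "\<bar>sin (1 / real (Suc n) * Z f)\<bar> \<le> \<bar>1 / real (Suc n) * Z f\<bar>" by (rule abs_sin_x_le_abs_x)
      from mult_left_mono[OF this, of "real (Suc n)"]
      have "real (Suc n) * \<bar>sin (1 / real (Suc n) * Z f)\<bar> \<le> \<bar>Z f\<bar>"
        by (simp add: abs_mult)
      then show "norm (complex_of_real (real (Suc n) * sin (1 / real (Suc n) * Z f)) * iexp (Y f)) \<le> \<bar>Z f\<bar>"
        by (simp add: norm_mult abs_mult del: of_nat_Suc)
    qed
  qed auto
  moreover have "(CLINT f|\<mu>. complex_of_real (real (Suc n) * sin (1 / real (Suc n) * Z f)) * iexp (Y f)) = 0" for n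
    using sin0[of "1 / real (Suc n)"] by (simp only: of_real_mult mult.assoc integral_mult_right_zero) simp
  ultimately have "(\<lambda>n. 0) \<longlonglongrightarrow> (CLINT f|\<mu>. complex_of_real (Z f) * iexp (Y f))" by (simp only:)
  from LIMSEQ_unique[OF this tendsto_const] show ?thesis .
qed

section \<open>From orthogonality to exponentials to orthogonality to all functions of the
  data\<close>

text \<open>Weighting \<open>M\<close> by the positive or the negative part of \<open>W\<close> and
  pushing forward by \<open>X\<close> gives, after division by the common mass \<open>c\<close>, two
  probability measures with the same characteristic function, which Levy's theorem
  identifies.\<close>

lemma vanishing_transform_real:
  fixes W X :: "'b \<Rightarrow> real"
  assumes W: "integrable M W" and X[measurable]: "X \<in> borel_measurable M"
    and z: "\<And>s. (CLINT x|M. complex_of_real (W x) * iexp (s * X x)) = 0"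
    and A: "A \<in> sets borel"
  shows "(\<integral>x. W x * indicator A (X x) \<partial>M) = 0"
proof -
  have [measurable]: "W \<in> borel_measurable M" using W by auto
  define c where "c = (\<integral>x. max 0 (W x) \<partial>M)"
  let ?p = "\<lambda>x. max 0 (W x)" and ?n = "\<lambda>x. max 0 (- W x)"
  have ip: "integrable M ?p" and inn: "integrable M ?n" using W by auto
  have W_eq: "W x = ?p x - ?n x" for x by auto
  have cint: "integrable M (\<lambda>x. complex_of_real (V x) * iexp (s * X x))" if "integrable M V" for V s
  proof (rule Bochner_Integration.integrable_bound[OF that])
    have [measurable]: "V \<in> borel_measurable M" using that by auto
    show "(\<lambda>x. complex_of_real (V x) * iexp (s * X x)) \<in> borel_measurable M" by measurable
  qed (simp add: norm_mult)
  have eq: "(CLINT x|M. complex_of_real (?p x) * iexp (s * X x)) = (CLINT x|M. complex_of_real (?n x) * iexp (s * X x))" for s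
  proof -
    have "0 = (CLINT x|M. complex_of_real (?p x) * iexp (s * X x) - complex_of_real (?n x) * iexp (s * X x))"
      unfolding z[of s, symmetric] by (subst W_eq) (simp add: algebra_simps)
    also have "\<dots> = (CLINT x|M. complex_of_real (?p x) * iexp (s * X x)) - (CLINT x|M. complex_of_real (?n x) * iexp (s * X x))"
      by (intro Bochner_Integration.integral_diff cint ip inn)
    finally show ?thesis by simp
  qed
  \<comment> \<open>Frequency 0 shows that the two parts have equal mass.\<close>
  have cn: "(\<integral>x. ?n x \<partial>M) = c"
    using eq[of 0] unfolding c_def by simp
  have i_eq: "(\<integral>x. W x * indicator A (X x) \<partial>M) = (\<integral>x. ?p x * indicator A (X x) \<partial>M) - (\<integral>x. ?n x * indicator A (X x) \<partial>M)"
  proof -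
    have int: "integrable M (\<lambda>x. V x * indicator A (X x))" if "integrable M V" for V :: "'b \<Rightarrow> real"
    proof (rule Bochner_Integration.integrable_bound[OF that])
      have [measurable]: "V \<in> borel_measurable M" using that by auto
      show "(\<lambda>x. V x * indicator A (X x)) \<in> borel_measurable M" using A by measurable
    qed (simp add: indicator_def)
    have "(\<integral>x. W x * indicator A (X x) \<partial>M) = (\<integral>x. ?p x * indicator A (X x) - ?n x * indicator A (X x) \<partial>M)"
      by (subst W_eq) (simp add: algebra_simps)
    then show ?thesis using int[OF ip] int[OF inn] by simp
  qed
  show ?thesis
  proof (cases "c = 0")
    case True
    have "AE x in M. ?p x = 0" using True ip unfolding c_def by (subst (asm) integral_nonneg_eq_0_iff_AE) auto
    moreover have "AE x in M. ?n x = 0"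
    proof -
      have "(\<integral>x. ?n x \<partial>M) = 0" using True cn by simp
      then show ?thesis using inn by (subst (asm) integral_nonneg_eq_0_iff_AE) auto
    qed
    ultimately have "AE x in M. W x * indicator A (X x) = 0" by eventually_elim auto
    then show ?thesis by (rule integral_eq_zero_AE)
  next
    case False
    then have c: "c > 0" unfolding c_def by (metis Bochner_Integration.integral_nonneg less_eq_real_def max.cobounded1)
    define D where "D V = distr (density M (\<lambda>x. ennreal (V x / c))) borel X" for V
    have D: "real_distribution (D V)" "char (D V) s = (CLINT x|M. complex_of_real (V x) * iexp (s * X x)) / c"
      "measure (D V) A = (\<integral>x. V x * indicator A (X x) \<partial>M) / c"
      if V: "integrable M V" "\<And>x. 0 \<le> V x" "(\<integral>x. V x \<partial>M) = c" for V s
    proof -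
      have [measurable]: "V \<in> borel_measurable M" using V by auto
      have "emeasure (density M (\<lambda>x. ennreal (V x / c))) (space M) = (\<integral>\<^sup>+x. ennreal (V x / c) \<partial>M)"
        by (simp add: emeasure_density cong: nn_integral_cong)
      also have "\<dots> = ennreal (\<integral>x. V x / c \<partial>M)"
        using V c by (intro nn_integral_eq_integral) auto
      also have "\<dots> = 1" using V c by simp
      finally interpret P: prob_space "density M (\<lambda>x. ennreal (V x / c))" by (intro prob_spaceI) simp
      show "real_distribution (D V)"
        unfolding D_def real_distribution_def real_distribution_axioms_def
        by (auto intro!: P.prob_space_distr)
      show "char (D V) s = (CLINT x|M. complex_of_real (V x) * iexp (s * X x)) / c"
        unfolding D_def char_def using c V(2)
        by (simp add: integral_distr integral_density scaleR_conv_of_real del: of_real_mult)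
      have "measure (D V) A = (\<integral>x. indicator A x \<partial>D V)"
        using A by (simp add: D_def)
      also have "\<dots> = (\<integral>x. V x * indicator A (X x) \<partial>M) / c"
        unfolding D_def using c V(2) A by (subst integral_distr, simp, simp, subst integral_density) auto
      finally show "measure (D V) A = (\<integral>x. V x * indicator A (X x) \<partial>M) / c" .
    qed
    have "D ?p = D ?n"
    proof (rule Levy_uniqueness)
      show "char (D ?p) = char (D ?n)"
        by (rule ext) (subst D(2), (use ip inn cn in \<open>auto simp: c_def\<close>)[3], subst D(2),
          use ip inn cn eq in \<open>auto simp: c_def\<close>)
    qed (rule D(1); use ip inn cn in \<open>auto simp: c_def\<close>)+
    then have "measure (D ?p) A = measure (D ?n) A" by simp
    then show ?thesis
      unfolding i_eq using D(3)[of ?p] D(3)[of ?n] ip inn cn c by (simp add: c_def)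
  qed
qed

text \<open>The transform of the conjugate of \<open>W\<close> at s is the conjugate of that of
  \<open>W\<close> at -s, so the real and imaginary parts have vanishing transforms
  separately.\<close>

lemma vanishing_transform:
  fixes W :: "'b \<Rightarrow> complex" and X :: "'b \<Rightarrow> real"
  assumes W: "integrable M W" and X[measurable]: "X \<in> borel_measurable M"
    and z: "\<And>s. (CLINT x|M. W x * iexp (s * X x)) = 0"
    and A: "A \<in> sets borel"
  shows "(CLINT x|M. W x * indicator A (X x)) = 0"
proof -
  have [measurable]: "W \<in> borel_measurable M" using W by auto
  have int: "integrable M (\<lambda>x. V x * iexp (s * X x))" if "integrable M V" for V :: "'b \<Rightarrow> complex" and s
  proof (rule Bochner_Integration.integrable_bound[OF that])
    have [measurable]: "V \<in> borel_measurable M" using that by auto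
    show "(\<lambda>x. V x * iexp (s * X x)) \<in> borel_measurable M" by measurable
  qed (simp add: norm_mult)
  have zc: "(CLINT x|M. cnj (W x) * iexp (s * X x)) = 0" for s
  proof -
    have "(CLINT x|M. cnj (W x) * iexp (s * X x)) = (CLINT x|M. cnj (W x * iexp ((-s) * X x)))"
      by (intro Bochner_Integration.integral_cong) (auto simp: exp_cnj)
    also have "\<dots> = cnj (CLINT x|M. W x * iexp ((-s) * X x))"
      by (rule integral_bounded_linear[OF bounded_linear_cnj int[OF W]])
    finally show ?thesis using z[of "-s"] by simp
  qed
  have iW: "integrable M (\<lambda>x. cnj (W x))" using W by simp
  have "(CLINT x|M. complex_of_real (Re (W x)) * iexp (s * X x)) = 0" for s
  proof -
    have "(CLINT x|M. complex_of_real (Re (W x)) * iexp (s * X x))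
       = (CLINT x|M. (W x * iexp (s * X x) + cnj (W x) * iexp (s * X x)) / 2)"
      by (intro Bochner_Integration.integral_cong) (auto simp: complex_eq_iff algebra_simps)
    then show ?thesis using z zc int[OF W] int[OF iW] by simp
  qed
  then have re: "(\<integral>x. Re (W x) * indicator A (X x) \<partial>M) = 0"
    using W A by (intro vanishing_transform_real) auto
  have "(CLINT x|M. complex_of_real (Im (W x)) * iexp (s * X x)) = 0" for s
  proof -
    have "(CLINT x|M. complex_of_real (Im (W x)) * iexp (s * X x))
       = (CLINT x|M. (W x * iexp (s * X x) - cnj (W x) * iexp (s * X x)) / (2 * \<i>))"
    proof (intro Bochner_Integration.integral_cong refl)
      fix x
      have "W x * iexp (s * X x) - cnj (W x) * iexp (s * X x) = 2 * \<i> * (complex_of_real (Im (W x)) * iexp (s * X x))"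
        by (simp add: left_diff_distrib[symmetric] complex_diff_cnj)
      then show "complex_of_real (Im (W x)) * iexp (s * X x) = (W x * iexp (s * X x) - cnj (W x) * iexp (s * X x)) / (2 * \<i>)"
        by simp
    qed
    then show ?thesis using z zc int[OF W] int[OF iW] by simp
  qed
  then have im: "(\<integral>x. Im (W x) * indicator A (X x) \<partial>M) = 0"
    using W A by (intro vanishing_transform_real) auto
  have i: "integrable M (\<lambda>x. W x * indicator A (X x))"
  proof (rule Bochner_Integration.integrable_bound[OF W])
    show "(\<lambda>x. W x * indicator A (X x)) \<in> borel_measurable M" using A by measurable
  qed (simp add: norm_mult indicator_def)
  have "Re (CLINT x|M. W x * indicator A (X x)) = (\<integral>x. Re (W x) * indicator A (X x) \<partial>M)"
    unfolding integral_Re[OF i, symmetric] by (intro Bochner_Integration.integral_cong) (auto simp: indicator_def)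
  moreover have "Im (CLINT x|M. W x * indicator A (X x)) = (\<integral>x. Im (W x) * indicator A (X x) \<partial>M)"
    unfolding integral_Im[OF i, symmetric] by (intro Bochner_Integration.integral_cong) (auto simp: indicator_def)
  ultimately show ?thesis using re im by (simp add: complex_eq_iff)
qed

text \<open>Exponentials and indicators of the coordinates already treated are absorbed into \<open>W\<close>, so that only the
  one-dimensional uniqueness theorem of Levy is needed.\<close>

lemma vanishing_transform_box:
  fixes W :: "'b \<Rightarrow> complex" and X :: "nat \<Rightarrow> 'b \<Rightarrow> real"
  assumes "integrable M W" and "\<And>j. j < k \<Longrightarrow> X j \<in> borel_measurable M"
    and "\<And>t. (CLINT x|M. W x * iexp (\<Sum>j<k. t j * X j x)) = 0"
    and "\<And>j. j < k \<Longrightarrow> A j \<in> sets borel"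
  shows "(CLINT x|M. W x * (\<Prod>j<k. indicator (A j) (X j x))) = 0"
  using assms
proof (induction k arbitrary: W)
  case (Suc k)
  have [measurable]: "W \<in> borel_measurable M" "X k \<in> borel_measurable M"
    "\<And>j. j < k \<Longrightarrow> X j \<in> borel_measurable M" "A k \<in> sets borel" "\<And>j. j < k \<Longrightarrow> A j \<in> sets borel"
    using Suc.prems by auto
  have bound: "integrable M (\<lambda>x. W x * V x)" if "V \<in> borel_measurable M" "\<And>x. norm (V x) \<le> 1" for V :: "'b \<Rightarrow> complex"
  proof (rule Bochner_Integration.integrable_bound[OF Suc.prems(1)])
    show "AE x in M. norm (W x * V x) \<le> norm (W x)"
      using that(2) by (simp add: norm_mult mult_left_le)
  qed (use that in measurable)
  let ?I = "\<lambda>x. (\<Prod>j<k. indicator (A j) (X j x)) :: complex"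
  have I: "?I \<in> borel_measurable M" by (intro borel_measurable_prod) auto
  have I1: "norm (?I x) \<le> 1" for x
    by (simp add: prod_norm[symmetric] indicator_def prod_le_1)
  have "(CLINT x|M. (W x * ?I x) * indicator (A k) (X k x)) = 0"
  proof (rule vanishing_transform)
    show "integrable M (\<lambda>x. W x * ?I x)" by (rule bound[OF I I1])
    fix s
    \<comment> \<open>The induction hypothesis treats the first \<open>k\<close> coordinates with
      the exponential of coordinate \<open>k\<close> absorbed into the weight; the one-dimensional
      result then trades that exponential for an indicator.\<close>
    have "(CLINT x|M. (W x * iexp (s * X k x)) * ?I x) = 0"
    proof (rule Suc.IH)
      show "integrable M (\<lambda>x. W x * iexp (s * X k x))" by (rule bound) auto
      fix t
      have "(CLINT x|M. W x * iexp (s * X k x) * iexp (\<Sum>j<k. t j * X j x))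
         = (CLINT x|M. W x * iexp (\<Sum>j<Suc k. (t(k := s)) j * X j x))"
        by (intro Bochner_Integration.integral_cong) (auto simp: exp_add[symmetric] algebra_simps)
      also have "\<dots> = 0" by (rule Suc.prems(3))
      finally show "(CLINT x|M. W x * iexp (s * X k x) * iexp (\<Sum>j<k. t j * X j x)) = 0" .
    qed (use Suc.prems in auto)
    then show "(CLINT x|M. W x * ?I x * iexp (s * X k x)) = 0" by (simp add: mult_ac)
  qed auto
  then show ?case by (simp add: mult.assoc)
qed simp

text \<open>Vanishing on boxes means that the positive and negative parts of \<open>W\<close> induce
  the same finite measure on R^k through \<open>X\<close>; the integral of \<psi> is then the same
  for both. Integrability is asked of the product with \<open>W\<close> only, so \<psi> may be
  unbounded.\<close>

lemma vanishing_transform_orthogonal: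
  fixes W :: "'b \<Rightarrow> real" and X :: "nat \<Rightarrow> 'b \<Rightarrow> real" and \<psi> :: "(nat \<Rightarrow> real) \<Rightarrow> real"
  assumes W: "integrable M W" and X: "\<And>j. j < k \<Longrightarrow> X j \<in> borel_measurable M"
    and z: "\<And>t. (CLINT x|M. complex_of_real (W x) * iexp (\<Sum>j<k. t j * X j x)) = 0"
    and \<psi>[measurable]: "\<psi> \<in> borel_measurable (PiM {..<k} (\<lambda>_. borel))"
    and int: "integrable M (\<lambda>x. \<psi> (\<lambda>j\<in>{..<k}. X j x) * W x)"
  shows "(\<integral>x. \<psi> (\<lambda>j\<in>{..<k}. X j x) * W x \<partial>M) = 0"
proof -
  let ?P = "PiM {..<k} (\<lambda>_. borel :: real measure)"
  let ?T = "\<lambda>x. \<lambda>j\<in>{..<k}. X j x"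
  let ?p = "\<lambda>x. max 0 (W x)" and ?n = "\<lambda>x. max 0 (- W x)"
  have [measurable]: "W \<in> borel_measurable M" using W by auto
  have T[measurable]: "?T \<in> measurable M ?P" using X by (intro measurable_restrict) auto
  have ip: "integrable M ?p" and inn: "integrable M ?n" using W by auto
  define D where "D V = distr (density M (\<lambda>x. ennreal (V x))) ?P ?T" for V
  have D: "emeasure (D V) (Pi\<^sub>E {..<k} A) = ennreal (\<integral>x. V x * (\<Prod>j<k. indicator (A j) (X j x)) \<partial>M)"
    if V: "integrable M V" "\<And>x. 0 \<le> V x" and A: "\<And>j. j < k \<Longrightarrow> A j \<in> sets borel" for V A
  proof -
    have [measurable]: "V \<in> borel_measurable M" using V by auto
    have B: "Pi\<^sub>E {..<k} A \<in> sets ?P" using A by (intro sets_PiM_I_finite) auto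
    have ind: "indicator (Pi\<^sub>E {..<k} A) (?T x) = (\<Prod>j<k. indicator (A j) (X j x) :: real)" for x
      by (auto simp: indicator_def prod.neutral PiE_iff)
    have "emeasure (D V) (Pi\<^sub>E {..<k} A) = (\<integral>\<^sup>+y. indicator (Pi\<^sub>E {..<k} A) y \<partial>D V)"
      using B by (simp add: D_def)
    also have "\<dots> = (\<integral>\<^sup>+x. ennreal (V x) * indicator (Pi\<^sub>E {..<k} A) (?T x) \<partial>M)"
      unfolding D_def using B by (subst nn_integral_distr) (auto simp: nn_integral_density)
    also have "\<dots> = (\<integral>\<^sup>+x. ennreal (V x * (\<Prod>j<k. indicator (A j) (X j x))) \<partial>M)"
      unfolding ind[symmetric] by (intro nn_integral_cong) (auto simp: indicator_def)
    also have "\<dots> = ennreal (\<integral>x. V x * (\<Prod>j<k. indicator (A j) (X j x)) \<partial>M)"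
    proof (rule nn_integral_eq_integral)
      show "integrable M (\<lambda>x. V x * (\<Prod>j<k. indicator (A j) (X j x)))"
        unfolding ind[symmetric]
      proof (rule Bochner_Integration.integrable_bound[OF V(1)])
        show "(\<lambda>x. V x * indicator (Pi\<^sub>E {..<k} A) (?T x)) \<in> borel_measurable M" using B by measurable
      qed (auto simp: indicator_def)
    qed (use V in \<open>auto intro!: mult_nonneg_nonneg prod_nonneg\<close>)
    finally show ?thesis .
  qed
  have box: "(\<integral>x. ?p x * (\<Prod>j<k. indicator (A j) (X j x)) \<partial>M) = (\<integral>x. ?n x * (\<Prod>j<k. indicator (A j) (X j x)) \<partial>M)"
    if A: "\<And>j. j < k \<Longrightarrow> A j \<in> sets borel" for A
  proof -
    let ?J = "\<lambda>x. (\<Prod>j<k. indicator (A j) (X j x)) :: real"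
    have J: "?J \<in> borel_measurable M"
      using A X by (intro borel_measurable_prod measurable_compose[OF X borel_measurable_indicator]) auto
    have J1: "\<bar>?J x\<bar> \<le> 1" for x
      by (simp add: abs_prod indicator_def prod_le_1)
    have int: "integrable M (\<lambda>x. V x * ?J x)" if "integrable M V" for V :: "'b \<Rightarrow> real"
      using J1 by (intro Bochner_Integration.integrable_bound[OF that] borel_measurable_times J)
        (use that in \<open>auto simp: abs_mult mult_left_le\<close>)
    have "(CLINT x|M. complex_of_real (W x) * (\<Prod>j<k. indicator (A j) (X j x))) = 0"
      by (rule vanishing_transform_box) (use W X z A in auto)
    also have "(CLINT x|M. complex_of_real (W x) * (\<Prod>j<k. indicator (A j) (X j x)))
       = (CLINT x|M. complex_of_real (W x * ?J x))"
      unfolding of_real_mult of_real_prod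
      by (intro Bochner_Integration.integral_cong arg_cong2[where f="(*)"] prod.cong) (auto simp: indicator_def)
    finally have "(\<integral>x. W x * ?J x \<partial>M) = 0" by (simp del: of_real_mult)
    moreover have "(\<integral>x. W x * ?J x \<partial>M) = (\<integral>x. ?p x * ?J x - ?n x * ?J x \<partial>M)"
      by (intro Bochner_Integration.integral_cong) (auto simp: max_def)
    ultimately show ?thesis using int[OF ip] int[OF inn] by simp
  qed
  have "D ?p = D ?n"
  proof (rule measure_eqI_PiM_finite)
    show "emeasure (D ?p) (Pi\<^sub>E {..<k} A) = emeasure (D ?n) (Pi\<^sub>E {..<k} A)"
      if "\<And>i. i \<in> {..<k} \<Longrightarrow> A i \<in> sets borel" for A
      using that by (subst D, (use ip in auto)[3], subst D) (use inn box in auto)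
    show "range (\<lambda>n::nat. Pi\<^sub>E {..<k} (\<lambda>_. UNIV)) \<subseteq> prod_algebra {..<k} (\<lambda>_. borel :: real measure)"
      by (auto intro!: prod_algebraI_finite)
    show "(\<Union>n::nat. Pi\<^sub>E {..<k} (\<lambda>_. UNIV)) = space ?P" by (simp add: space_PiM)
    show "emeasure (D ?p) (Pi\<^sub>E {..<k} (\<lambda>_. UNIV)) \<noteq> \<infinity>" for n :: nat
      by (subst D) (use ip in auto)
  qed (auto simp: D_def)
  then have eq: "(\<integral>y. \<psi> y \<partial>D ?p) = (\<integral>y. \<psi> y \<partial>D ?n)" by simp
  have DV: "(\<integral>y. \<psi> y \<partial>D V) = (\<integral>x. V x * \<psi> (?T x) \<partial>M)" if [measurable]: "V \<in> borel_measurable M" and "\<And>x. 0 \<le> V x" for V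
    unfolding D_def using that by (subst integral_distr) (auto simp: integral_density)
  have i: "integrable M (\<lambda>x. V x * \<psi> (?T x))"
    if "V \<in> borel_measurable M" "\<And>x. \<bar>V x\<bar> \<le> \<bar>W x\<bar>" for V
  proof (rule Bochner_Integration.integrable_bound[OF int])
    show "AE x in M. norm (V x * \<psi> (?T x)) \<le> norm (\<psi> (?T x) * W x)"
    proof (rule AE_I2)
      fix x
      have "\<bar>V x\<bar> * \<bar>\<psi> (?T x)\<bar> \<le> \<bar>W x\<bar> * \<bar>\<psi> (?T x)\<bar>" by (rule mult_right_mono[OF that(2)]) simp
      then show "norm (V x * \<psi> (?T x)) \<le> norm (\<psi> (?T x) * W x)" by (simp add: abs_mult mult.commute)
    qed
    have [measurable]: "V \<in> borel_measurable M" by fact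
    show "(\<lambda>x. V x * \<psi> (?T x)) \<in> borel_measurable M" by measurable
  qed
  have "(\<integral>x. \<psi> (?T x) * W x \<partial>M) = (\<integral>x. ?p x * \<psi> (?T x) - ?n x * \<psi> (?T x) \<partial>M)"
    by (intro Bochner_Integration.integral_cong) (auto simp: max_def)
  also have "\<dots> = (\<integral>x. ?p x * \<psi> (?T x) \<partial>M) - (\<integral>x. ?n x * \<psi> (?T x) \<partial>M)"
    by (intro Bochner_Integration.integral_diff i) auto
  also have "\<dots> = 0" using eq DV[of ?p] DV[of ?n] by simp
  finally show ?thesis .
qed

section \<open>Measurability, least squares and independent sums\<close>

text \<open>Rounding f to a point of a countable dense set makes the function a countable case
  distinction; continuity in f gives the limit.\<close>

lemma caratheodory_measurable:
  fixes g :: "'f::{second_countable_topology, metric_space} \<Rightarrow> 'a \<Rightarrow> real"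
  assumes M: "sets M = sets borel" and N: "\<And>f. g f \<in> borel_measurable N"
    and cont: "\<And>x. x \<in> space N \<Longrightarrow> continuous_on UNIV (\<lambda>f. g f x)"
  shows "(\<lambda>(f, x). g f x) \<in> borel_measurable (M \<Otimes>\<^sub>M N)"
proof -
  obtain S :: "'f set" where S: "countable S" and dense: "\<And>X. open X \<Longrightarrow> X \<noteq> {} \<Longrightarrow> \<exists>d\<in>S. d \<in> X"
    using countable_dense_setE by blast
  have "S \<noteq> {}" using dense[of UNIV] by auto
  define d where "d = from_nat_into S"
  have d: "\<exists>k. dist (d k) f < \<epsilon>" if "\<epsilon> > 0" for f \<epsilon>
  proof -
    have "f \<in> ball f \<epsilon>" using that by simp
    then obtain s where "s \<in> S" "s \<in> ball f \<epsilon>" using dense[of "ball f \<epsilon>"] open_ball by blast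
    moreover have "range d = S" unfolding d_def by (rule range_from_nat_into) fact+
    ultimately show ?thesis by (metis dist_commute mem_ball rangeE)
  qed
  \<comment> \<open>Taking the least index makes the choice of the approximating point measurable in
    f.\<close>
  define k where "k n f = (LEAST k. dist (d k) f < 1 / real (Suc n))" for n f
  have k: "dist (d (k n f)) f < 1 / real (Suc n)" for n f
    unfolding k_def by (rule LeastI_ex) (rule d, simp)
  have km: "k n \<in> measurable M (count_space UNIV)" for n
    unfolding k_def[abs_def]
  proof (rule measurable_Least)
    fix i
    have "Measurable.pred borel (\<lambda>f. dist (d i) f < 1 / real (Suc n))" by measurable
    then show "Measurable.pred M (\<lambda>f. dist (d i) f < 1 / real (Suc n))"
      using measurable_cong_sets[OF M refl] by blast
  qed
  show ?thesis
  proof (rule borel_measurable_LIMSEQ_real[where u="\<lambda>n (f, x). g (d (k n f)) x"])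
    fix n
    have "(\<lambda>p. (\<lambda>i p. g (d i) (snd p)) (k n (fst p)) p) \<in> borel_measurable (M \<Otimes>\<^sub>M N)"
    proof (rule measurable_compose_countable)
      show "(\<lambda>p. g (d i) (snd p)) \<in> borel_measurable (M \<Otimes>\<^sub>M N)" for i
        by (rule measurable_compose[OF measurable_snd N])
      show "(\<lambda>p. k n (fst p)) \<in> measurable (M \<Otimes>\<^sub>M N) (count_space UNIV)"
        by (rule measurable_compose[OF measurable_fst km])
    qed
    then show "(\<lambda>(f, x). g (d (k n f)) x) \<in> borel_measurable (M \<Otimes>\<^sub>M N)"
      by (simp add: case_prod_beta')
  next
    fix p assume p: "p \<in> space (M \<Otimes>\<^sub>M N)"
    obtain f x where fx: "p = (f, x)" by force
    have x: "x \<in> space N" using p by (simp add: fx space_pair_measure)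
    have "(\<lambda>n. d (k n f)) \<longlonglongrightarrow> f"
    proof (rule metric_LIMSEQ_I)
      fix \<epsilon> :: real assume "\<epsilon> > 0"
      then obtain n0 where n0: "1 / real (Suc n0) < \<epsilon>" using nat_approx_posE by blast
      have "dist (d (k n f)) f < \<epsilon>" if "n \<ge> n0" for n
      proof -
        have "1 / real (Suc n) \<le> 1 / real (Suc n0)" using that by (simp add: frac_le)
        then show ?thesis using k[of n f] n0 by linarith
      qed
      then show "\<exists>n0. \<forall>n\<ge>n0. dist (d (k n f)) f < \<epsilon>" by blast
    qed
    then have "(\<lambda>n. g (d (k n f)) x) \<longlonglongrightarrow> g f x"
      using continuous_on_tendsto_compose[OF cont[OF x], of "\<lambda>n. d (k n f)" f sequentially] by simp
    then show "(\<lambda>n. case p of (f, x) \<Rightarrow> g (d (k n f)) x) \<longlonglongrightarrow> (case p of (f, x) \<Rightarrow> g f x)"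
      by (simp add: fx)
  qed
qed

lemma orthonormal_pythagoras:
  assumes on: "orthonormal M r e" and f: "square_int M f"
  defines "c \<equiv> \<lambda>k. (\<integral>y. f y * e k y \<partial>M)"
  shows "(\<integral>x. (f x - (\<Sum>k<r. b k * e k x))\<^sup>2 \<partial>M) =
    (\<integral>x. (f x - (\<Sum>k<r. c k * e k x))\<^sup>2 \<partial>M) + (\<Sum>k<r. (b k - c k)\<^sup>2)"
proof -
  have e: "square_int M (e k)" if "k < r" for k using on that by (simp add: orthonormal_def)
  define g where "g x = f x - (\<Sum>k<r. c k * e k x)" for x
  have g: "square_int M g" unfolding g_def by (intro square_int_diff f square_int_lincomb e)
  define s where "s x = (\<Sum>k<r. (b k - c k) * e k x)" for x
  have s: "square_int M s" unfolding s_def by (intro square_int_lincomb e)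
  have "(\<integral>x. g x * s x \<partial>M) = (\<Sum>k<r. (b k - c k) * (\<integral>x. g x * e k x \<partial>M))"
    unfolding s_def by (rule integral_lincomb[OF e g])
  also have "\<dots> = 0"
  proof (rule sum.neutral, rule ballI)
    fix k assume "k \<in> {..<r}"
    then show "(b k - c k) * (\<integral>x. g x * e k x \<partial>M) = 0"
      using orthonormal_residual[OF on f, of k] by (simp add: g_def c_def mult.commute)
  qed
  finally have gs: "(\<integral>x. g x * s x \<partial>M) = 0" .
  have "(\<integral>x. (f x - (\<Sum>k<r. b k * e k x))\<^sup>2 \<partial>M) = (\<integral>x. (g x)\<^sup>2 - 2 * (g x * s x) + (s x)\<^sup>2 \<partial>M)"
  proof (rule Bochner_Integration.integral_cong[OF refl])
    fix x
    have "f x - (\<Sum>k<r. b k * e k x) = g x - s x"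
      by (simp add: g_def s_def left_diff_distrib sum_subtractf)
    then show "(f x - (\<Sum>k<r. b k * e k x))\<^sup>2 = (g x)\<^sup>2 - 2 * (g x * s x) + (s x)\<^sup>2"
      by (simp add: power2_diff)
  qed
  also have "\<dots> = (\<integral>x. (g x)\<^sup>2 \<partial>M) + (\<integral>x. (s x)\<^sup>2 \<partial>M)"
    using g s square_int_mult[OF g s] gs by (simp add: square_int_def)
  also have "(\<integral>x. (s x)\<^sup>2 \<partial>M) = (\<Sum>k<r. (b k - c k)\<^sup>2)"
    unfolding s_def by (rule orthonormal_norm[OF on])
  finally show ?thesis by (simp add: g_def)
qed

lemma nn_integral_square_int:
  "square_int M f \<Longrightarrow> (\<integral>\<^sup>+x. ennreal ((f x)\<^sup>2) \<partial>M) = ennreal (\<integral>x. (f x)\<^sup>2 \<partial>M)"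
  by (rule nn_integral_eq_integral) (auto simp: square_int_def)

lemma square_intI_nn:
  assumes "f \<in> borel_measurable M" "(\<integral>\<^sup>+x. ennreal ((f x)\<^sup>2) \<partial>M) < \<infinity>"
  shows "square_int M f"
  using assms by (auto simp: square_int_def intro!: integrableI_nonneg)

text \<open>By construction \<open>Z\<close> is uncorrelated with every combination of the
  functionals, which in the Gaussian case makes it orthogonal to every square-integrable function of
  them; \<open>V\<close> - \<open>Z\<close> is such a function, and Pythagoras concludes. The
  orthonormal \<open>K j\<close> stand in for the \<open>L l\<close>, which may be linearly
  dependent.\<close>

lemma gaussian_regression:
  fixes \<mu> :: "'f::real_normed_vector measure" and L :: "nat \<Rightarrow> 'f \<Rightarrow> real"
  assumes G: "gaussian_measure \<mu>" and X: "bounded_linear X" and L: "\<And>l. l < m \<Longrightarrow> bounded_linear (L l)"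
    and on: "orthonormal \<mu> s (\<lambda>j f. \<Sum>l<m. C j l * L l f)"
    and span: "\<And>b. square_int \<mu> (\<lambda>f. \<Sum>l<m. b l * L l f) \<Longrightarrow>
      \<exists>a. AE f in \<mu>. (\<Sum>l<m. b l * L l f) = (\<Sum>j<s. a j * (\<Sum>l<m. C j l * L l f))"
    and \<psi>: "\<psi> \<in> borel_measurable (PiM {..<m} (\<lambda>_. borel))"
  defines "K \<equiv> \<lambda>j f. \<Sum>l<m. C j l * L l f"
  shows "(\<integral>\<^sup>+f. ennreal ((X f - (\<Sum>j<s. (\<integral>f. X f * K j f \<partial>\<mu>) * K j f))\<^sup>2) \<partial>\<mu>)
     \<le> (\<integral>\<^sup>+f. ennreal ((X f - \<psi> (\<lambda>l\<in>{..<m}. L l f))\<^sup>2) \<partial>\<mu>)"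
proof (cases "(\<integral>\<^sup>+f. ennreal ((X f - \<psi> (\<lambda>l\<in>{..<m}. L l f))\<^sup>2) \<partial>\<mu>) = \<infinity>")
  case False
  have K: "bounded_linear (K j)" for j
    unfolding K_def by (intro bounded_linear_sum bounded_linear_const_mult L) auto
  define h where "h j = (\<integral>f. X f * K j f \<partial>\<mu>)" for j
  define Z where "Z f = X f - (\<Sum>j<s. h j * K j f)" for f
  have Z: "bounded_linear Z"
    unfolding Z_def by (intro bounded_linear_sub X bounded_linear_sum bounded_linear_const_mult K)
  have sX: "square_int \<mu> X" by (rule gaussian_functional[OF G X])
  have sZ: "square_int \<mu> Z" by (rule gaussian_functional[OF G Z])
  have onK: "orthonormal \<mu> s K" using on by (simp add: K_def)
  have sK: "square_int \<mu> (K j)" for j by (rule gaussian_functional[OF G K])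
  have Lm: "L l \<in> borel_measurable \<mu>" if "l < m" for l
    by (rule bounded_linear_measurable_gaussian[OF G L[OF that]])
  have T: "(\<lambda>f. \<lambda>l\<in>{..<m}. L l f) \<in> measurable \<mu> (PiM {..<m} (\<lambda>_. borel))"
    using Lm by (intro measurable_restrict) auto
  have fourier: "(CLINT f|\<mu>. complex_of_real (Z f) * iexp (\<Sum>l<m. t l * L l f)) = 0" for t
  proof (rule gaussian_orthogonal_iexp[OF G Z])
    show Y: "bounded_linear (\<lambda>f. \<Sum>l<m. t l * L l f)"
      by (intro bounded_linear_sum bounded_linear_const_mult L) auto
    obtain a where a: "AE f in \<mu>. (\<Sum>l<m. t l * L l f) = (\<Sum>j<s. a j * K j f)"
      using span[OF gaussian_functional(1)[OF G Y]] unfolding K_def by blast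
    have "(\<integral>f. Z f * (\<Sum>l<m. t l * L l f) \<partial>\<mu>) = (\<integral>f. Z f * (\<Sum>j<s. a j * K j f) \<partial>\<mu>)"
      using a sZ square_int_lincomb[of s \<mu> K a] sK gaussian_functional(1)[OF G Y]
      by (intro integral_cong_AE) (auto simp: square_int_def)
    also have "\<dots> = (\<Sum>j<s. a j * (\<integral>f. Z f * K j f \<partial>\<mu>))" by (rule integral_lincomb[OF sK sZ])
    also have "\<dots> = 0"
      using orthonormal_residual[OF onK sX] by (intro sum.neutral) (simp add: Z_def h_def mult.commute)
    finally show "(\<integral>f. Z f * (\<Sum>l<m. t l * L l f) \<partial>\<mu>) = 0" .
  qed
  define V where "V f = X f - \<psi> (\<lambda>l\<in>{..<m}. L l f)" for f
  have sV: "square_int \<mu> V"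
  proof (rule square_intI_nn)
    show "V \<in> borel_measurable \<mu>"
      unfolding V_def using sX measurable_compose[OF T \<psi>] by (auto simp: square_int_def)
    show "(\<integral>\<^sup>+f. ennreal ((V f)\<^sup>2) \<partial>\<mu>) < \<infinity>" using False by (simp add: V_def less_top)
  qed
  \<comment> \<open>In \<open>V\<close> - \<open>Z\<close> the term \<open>X f\<close> cancels, so
    the difference depends on f through the data alone.\<close>
  define \<psi>' where "\<psi>' y = (\<Sum>j<s. h j * (\<Sum>l<m. C j l * y l)) - \<psi> y" for y
  define U where "U f = V f - Z f" for f
  have U: "U f = \<psi>' (\<lambda>l\<in>{..<m}. L l f)" for f
    by (simp add: U_def V_def Z_def \<psi>'_def K_def)
  have sU: "square_int \<mu> U" unfolding U_def by (intro square_int_diff sV sZ)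
  have "(\<integral>f. \<psi>' (\<lambda>l\<in>{..<m}. L l f) * Z f \<partial>\<mu>) = 0"
  proof (rule vanishing_transform_orthogonal[OF _ Lm fourier])
    show "integrable \<mu> Z"
    proof -
      interpret prob_space \<mu> using G by (simp add: gaussian_measure_def)
      show ?thesis using square_int_mult[OF sZ, of "\<lambda>_. 1"] by (simp add: square_int_def)
    qed
    show "\<psi>' \<in> borel_measurable (PiM {..<m} (\<lambda>_. borel))"
      unfolding \<psi>'_def
      by (intro borel_measurable_diff borel_measurable_sum borel_measurable_times \<psi>
          measurable_component_singleton borel_measurable_const) auto
    show "integrable \<mu> (\<lambda>f. \<psi>' (\<lambda>l\<in>{..<m}. L l f) * Z f)"
      unfolding U[symmetric] by (rule square_int_mult[OF sU sZ])
  qed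
  then have UZ: "(\<integral>f. U f * Z f \<partial>\<mu>) = 0" by (simp only: U)
  have "(\<integral>f. (V f)\<^sup>2 \<partial>\<mu>) = (\<integral>f. (Z f)\<^sup>2 + 2 * (U f * Z f) + (U f)\<^sup>2 \<partial>\<mu>)"
    by (intro Bochner_Integration.integral_cong) (auto simp: U_def power2_eq_square algebra_simps)
  also have "\<dots> = (\<integral>f. (Z f)\<^sup>2 \<partial>\<mu>) + (\<integral>f. (U f)\<^sup>2 \<partial>\<mu>)"
    using sZ sU square_int_mult[OF sU sZ] UZ by (simp add: square_int_def)
  finally have "(\<integral>f. (Z f)\<^sup>2 \<partial>\<mu>) \<le> (\<integral>f. (V f)\<^sup>2 \<partial>\<mu>)" by simp
  then have "(\<integral>\<^sup>+f. ennreal ((Z f)\<^sup>2) \<partial>\<mu>) \<le> (\<integral>\<^sup>+f. ennreal ((V f)\<^sup>2) \<partial>\<mu>)"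
    unfolding nn_integral_square_int[OF sZ] nn_integral_square_int[OF sV] by (rule ennreal_leI)
  then show ?thesis by (simp add: Z_def V_def h_def)
qed simp

text \<open>\<open>W\<close> is fixed before y and c are known, as an algorithm requires.
  Orthonormalising the sampled functions in the weighted l2 space on the points replaces inverting
  the Gram matrix. For the coefficient error d, the frame bound and the normal equations give
  |d|^2/2 \<le> (d, w) \<le> |d|^2/4 + |w|^2, whence the factor 4.\<close>

lemma least_squares:
  fixes q :: "nat \<Rightarrow> real" and F :: "nat \<Rightarrow> nat \<Rightarrow> real"
  assumes q: "\<And>i. 0 \<le> q i"
    and frame: "\<And>a. (\<Sum>k<r. (a k)\<^sup>2) / 2 \<le> (\<Sum>i<n. q i * (\<Sum>k<r. a k * F k i)\<^sup>2)"
  shows "\<exists>W. \<forall>y c. (\<Sum>k<r. ((\<Sum>i<n. W k i * y i) - c k)\<^sup>2) \<le>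
    4 * (\<Sum>k<r. (\<Sum>i<n. q i * (y i - (\<Sum>l<r. c l * F l i)) * F k i)\<^sup>2)"
proof -
  \<comment> \<open>The sample points become atoms of a measure, to which the results on orthonormal
    systems apply.\<close>
  let ?M = "point_measure {..<n} (\<lambda>i. ennreal (q i))"
  have I: "(\<integral>i. f i \<partial>?M) = (\<Sum>i<n. q i * f i)" for f :: "nat \<Rightarrow> real"
    using q by (subst lebesgue_integral_point_measure_finite) auto
  have sq: "square_int ?M f" for f
    using integrable_point_measure_finite[of "{..<n}" q "\<lambda>i. (f i)\<^sup>2"]
    by (simp add: square_int_def)
  obtain s C where on: "orthonormal ?M s (\<lambda>l i. \<Sum>k<r. C l k * F k i)"
    and span: "\<And>b. \<exists>a. AE i in ?M. (\<Sum>k<r. b k * F k i) = (\<Sum>l<s. a l * (\<Sum>k<r. C l k * F k i))"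
    using gram_schmidt[of r F ?M] sq by (auto simp: square_int_def)
  define U where "U l i = (\<Sum>k<r. C l k * F k i)" for l i
  define W where "W k i = (\<Sum>l<s. q i * U l i * C l k)" for k i
  have "(\<Sum>k<r. ((\<Sum>i<n. W k i * y i) - c k)\<^sup>2) \<le>
    4 * (\<Sum>k<r. (\<Sum>i<n. q i * (y i - (\<Sum>l<r. c l * F l i)) * F k i)\<^sup>2)" for y c
  proof -
    define b where "b k = (\<Sum>i<n. W k i * y i)" for k
    have b: "(\<Sum>k<r. b k * F k i) = (\<Sum>l<s. (\<integral>j. y j * U l j \<partial>?M) * U l i)" for i
    proof -
      have "b k = (\<Sum>l<s. (\<integral>j. y j * U l j \<partial>?M) * C l k)" for k
        unfolding b_def W_def I sum_distrib_right by (subst sum.swap) (simp add: mult_ac)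
      then have "(\<Sum>k<r. b k * F k i) = (\<Sum>k<r. \<Sum>l<s. (\<integral>j. y j * U l j \<partial>?M) * (C l k * F k i))"
        by (simp add: sum_distrib_right mult.assoc)
      also have "\<dots> = (\<Sum>l<s. (\<integral>j. y j * U l j \<partial>?M) * U l i)"
        unfolding U_def sum_distrib_left by (rule sum.swap)
      finally show ?thesis .
    qed
    define d where "d k = b k - c k" for k
    define D where "D i = (\<Sum>k<r. d k * F k i)" for i
    define w where "w k = (\<Sum>i<n. q i * (y i - (\<Sum>l<r. c l * F l i)) * F k i)" for k
    \<comment> \<open>Normal equations: the fitted residual is orthogonal to the sampled subspace,
      in which \<open>D\<close> lies.\<close>
    have normal: "(\<Sum>i<n. q i * (D i * (y i - (\<Sum>k<r. b k * F k i)))) = 0"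
    proof -
      obtain a where a: "AE i in ?M. D i = (\<Sum>l<s. a l * U l i)"
        using span[of d] unfolding D_def U_def by blast
      let ?g = "\<lambda>i. y i - (\<Sum>k<r. b k * F k i)"
      have "(\<integral>i. ?g i * D i \<partial>?M) = (\<integral>i. ?g i * (\<Sum>l<s. a l * U l i) \<partial>?M)"
        using a by (intro integral_cong_AE) (auto simp: measurable_point_measure_eq1)
      also have "\<dots> = (\<Sum>l<s. a l * (\<integral>i. ?g i * U l i \<partial>?M))" by (rule integral_lincomb) (rule sq)+
      also have "\<dots> = 0"
        using orthonormal_residual[OF on[folded U_def] sq, of _ y] unfolding b
        by (intro sum.neutral) (simp add: mult.commute)
      finally show ?thesis unfolding I by (simp add: mult_ac)
    qed
    have "(\<Sum>k<r. (d k)\<^sup>2) / 2 \<le> (\<Sum>i<n. q i * (D i)\<^sup>2)" unfolding D_def by (rule frame)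
    also have "\<dots> = (\<Sum>i<n. q i * (D i * (y i - (\<Sum>l<r. c l * F l i))))
        - (\<Sum>i<n. q i * (D i * (y i - (\<Sum>k<r. b k * F k i))))"
      unfolding sum_subtractf[symmetric]
      by (intro sum.cong) (auto simp: D_def d_def power2_eq_square algebra_simps sum_subtractf)
    also have "\<dots> = (\<Sum>i<n. \<Sum>k<r. d k * (q i * (y i - (\<Sum>l<r. c l * F l i)) * F k i))"
      unfolding normal by (simp add: D_def sum_distrib_left sum_distrib_right mult_ac)
    also have "\<dots> = (\<Sum>k<r. d k * w k)"
      unfolding w_def sum_distrib_left by (rule sum.swap)
    also have "\<dots> \<le> (\<Sum>k<r. (d k)\<^sup>2 / 4 + (w k)\<^sup>2)"
    proof (rule sum_mono)
      fix k
      have "0 \<le> (d k / 2 - w k)\<^sup>2" by simp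
      then show "d k * w k \<le> (d k)\<^sup>2 / 4 + (w k)\<^sup>2" by (simp add: power2_diff power_divide)
    qed
    also have "\<dots> = (\<Sum>k<r. (d k)\<^sup>2) / 4 + (\<Sum>k<r. (w k)\<^sup>2)"
      by (simp add: sum.distrib sum_divide_distrib)
    finally show ?thesis unfolding d_def b_def w_def by simp
  qed
  then show ?thesis by blast
qed

text \<open>Integrating out the newest coordinate kills its cross term with the earlier partial sum,
  as \<open>Y k\<close> has mean zero; every draw therefore adds the same variance.\<close>

lemma nn_integral_sum_centered:
  fixes Y :: "nat \<Rightarrow> 'x \<Rightarrow> real"
  assumes M: "prob_space M" and Y: "\<And>k. k < r \<Longrightarrow> square_int M (Y k)"
    and mean: "\<And>k. k < r \<Longrightarrow> (\<integral>x. Y k x \<partial>M) = 0"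
  shows "(\<integral>\<^sup>+\<omega>. ennreal (\<Sum>k<r. (\<Sum>i<n. Y k (\<omega> i))\<^sup>2) \<partial>PiM {..<n} (\<lambda>_. M))
    = ennreal (real n * (\<Sum>k<r. (\<integral>x. (Y k x)\<^sup>2 \<partial>M)))"
proof -
  interpret prob_space M by (rule M)
  interpret P: product_prob_space "\<lambda>_::nat. M" UNIV ..
  let ?C = "\<Sum>k<r. (\<integral>x. (Y k x)\<^sup>2 \<partial>M)"
  have C0: "0 \<le> ?C" by (intro sum_nonneg) simp
  have Ym: "Y k \<in> borel_measurable M" if "k < r" for k using Y[OF that] by (simp add: square_int_def)
  have m: "(\<lambda>\<omega>. ennreal (\<Sum>k<r. (\<Sum>i<n. Y k (\<omega> i))\<^sup>2)) \<in> borel_measurable (PiM {..<n} (\<lambda>_. M))" for n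
    by (intro measurable_compose[OF _ measurable_ennreal] borel_measurable_sum borel_measurable_power
        measurable_PiM_component_fun[where u="\<lambda>x k. Y k x"] Ym) auto
  have step: "(\<integral>\<^sup>+y. ennreal (\<Sum>k<r. (t k + Y k y)\<^sup>2) \<partial>M) = ennreal (\<Sum>k<r. (t k)\<^sup>2) + ennreal ?C" for t
  proof -
    have i: "integrable M (Y k)" if "k < r" for k
      using square_int_mult[OF Y[OF that], of "\<lambda>_. 1"] by (simp add: square_int_def)
    have sq: "(t k + Y k y)\<^sup>2 = (t k)\<^sup>2 + 2 * t k * Y k y + (Y k y)\<^sup>2" for k y by (rule power2_sum[unfolded mult.assoc, THEN trans]) simp
    have int: "integrable M (\<lambda>y. (t k + Y k y)\<^sup>2)" if "k < r" for k
      unfolding sq using i[OF that] Y[OF that] by (auto simp: square_int_def)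
    have "(\<integral>\<^sup>+y. ennreal (\<Sum>k<r. (t k + Y k y)\<^sup>2) \<partial>M) = ennreal (\<integral>y. (\<Sum>k<r. (t k + Y k y)\<^sup>2) \<partial>M)"
      using int by (intro nn_integral_eq_integral) (auto intro!: sum_nonneg)
    also have "(\<integral>y. (\<Sum>k<r. (t k + Y k y)\<^sup>2) \<partial>M) = (\<Sum>k<r. (\<integral>y. (t k + Y k y)\<^sup>2 \<partial>M))"
      using int by (intro Bochner_Integration.integral_sum) auto
    also have "\<dots> = (\<Sum>k<r. (t k)\<^sup>2 + (\<integral>x. (Y k x)\<^sup>2 \<partial>M))"
    proof (rule sum.cong[OF refl])
      fix k assume "k \<in> {..<r}"
      then have k: "k < r" by simp
      show "(\<integral>y. (t k + Y k y)\<^sup>2 \<partial>M) = (t k)\<^sup>2 + (\<integral>x. (Y k x)\<^sup>2 \<partial>M)"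
        unfolding sq using i[OF k] Y[OF k] mean[OF k] by (simp add: square_int_def prob_space)
    qed
    also have "ennreal \<dots> = ennreal (\<Sum>k<r. (t k)\<^sup>2) + ennreal ?C"
      using C0 by (simp add: sum.distrib ennreal_plus sum_nonneg)
    finally show ?thesis .
  qed
  show ?thesis
  proof (induction n)
    case (Suc n)
    have "(\<integral>\<^sup>+\<omega>. ennreal (\<Sum>k<r. (\<Sum>i<Suc n. Y k (\<omega> i))\<^sup>2) \<partial>PiM {..<Suc n} (\<lambda>_. M))
      = (\<integral>\<^sup>+\<omega>. \<integral>\<^sup>+y. ennreal (\<Sum>k<r. (\<Sum>i<Suc n. Y k ((fun_upd \<omega> n y) i))\<^sup>2) \<partial>M \<partial>PiM {..<n} (\<lambda>_. M))"
      using m[of "Suc n"] unfolding lessThan_Suc[of n]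
      by (subst P.product_nn_integral_insert) auto
    also have "\<dots> = (\<integral>\<^sup>+\<omega>. \<integral>\<^sup>+y. ennreal (\<Sum>k<r. ((\<Sum>i<n. Y k (\<omega> i)) + Y k y)\<^sup>2) \<partial>M \<partial>PiM {..<n} (\<lambda>_. M))"
    proof -
      have "(\<Sum>i<Suc n. Y k ((fun_upd \<omega> n y) i)) = (\<Sum>i<n. Y k (\<omega> i)) + Y k y" for k \<omega> y
        by simp
      then show ?thesis by (simp only:)
    qed
    also have "\<dots> = (\<integral>\<^sup>+\<omega>. ennreal (\<Sum>k<r. (\<Sum>i<n. Y k (\<omega> i))\<^sup>2) + ennreal ?C \<partial>PiM {..<n} (\<lambda>_. M))"
      unfolding step ..
    also have "\<dots> = ennreal (real n * ?C) + ennreal ?C"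
      using m[of n] prob_space.emeasure_space_1[OF prob_space_PiM[OF M], of "{..<n}"] Suc
      by (simp add: nn_integral_add M)
    also have "\<dots> = ennreal (real (Suc n) * ?C)"
      using C0 by (simp add: ennreal_plus[symmetric] algebra_simps del: ennreal_plus)
    finally show ?case .
  qed simp
qed

section \<open>The average case setting\<close>

lemma ennsqrt_mono: "a \<le> b \<Longrightarrow> ennsqrt a \<le> ennsqrt b"
  by (cases a; cases b) (auto simp: ennsqrt_def top_unique intro!: ennreal_leI)

lemma ennsqrt_mult_self: "ennsqrt a * ennsqrt a = a"
  by (cases a) (auto simp: ennsqrt_def ennreal_top_mult simp flip: ennreal_mult)

lemma le_ennsqrt_scaled:
  assumes "ennreal a * (I * I) \<le> ennreal b * X" "0 < a" "0 < b"
  shows "I \<le> ennreal (sqrt b * (1 / sqrt a)) * ennsqrt X"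
proof (cases X)
  case top
  then show ?thesis using assms by (simp add: ennsqrt_def ennreal_mult_top)
next
  case (real x)
  show ?thesis
  proof (cases I)
    case top
    then show ?thesis using assms real by (simp add: ennreal_mult_top top_unique flip: ennreal_mult)
  next
    case (real i)
    have "a * (i * i) \<le> b * x"
      using assms \<open>X = ennreal x\<close> \<open>0 \<le> x\<close> real by (simp flip: ennreal_mult)
    then have "i\<^sup>2 \<le> (b / a) * x" using assms by (simp add: field_simps power2_eq_square)
    then have "i \<le> sqrt ((b / a) * x)" by (rule real_le_rsqrt)
    also have "\<dots> = sqrt b * (1 / sqrt a) * sqrt x" by (simp add: real_sqrt_mult real_sqrt_divide)
    finally show ?thesis using real assms \<open>X = ennreal x\<close> \<open>0 \<le> x\<close>
      by (simp add: ennsqrt_def flip: ennreal_mult)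
  qed
qed

lemma le_mult_INF_ennreal:
  fixes I :: ennreal
  assumes "0 < c" "\<And>p. p \<in> A \<Longrightarrow> I \<le> ennreal c * f p"
  shows "I \<le> ennreal c * (INF p\<in>A. f p)"
proof -
  have c: "ennreal c * ennreal (1 / c) = 1" using assms(1) by (simp flip: ennreal_mult)
  have "ennreal (1 / c) * I \<le> f p" if "p \<in> A" for p
    using mult_left_mono[OF assms(2)[OF that], of "ennreal (1 / c)"] c
    by (simp add: mult.assoc[symmetric]) (simp add: mult.commute)
  then have "ennreal (1 / c) * I \<le> (INF p\<in>A. f p)" by (rule INF_greatest)
  from mult_left_mono[OF this, of "ennreal c"] show ?thesis
    using c by (simp add: mult.assoc[symmetric])
qed

locale average_case =
  fixes D :: "'a::euclidean_space set" and \<rho> :: "'a \<Rightarrow> real"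
    and pe :: "'f::{banach,second_countable_topology} \<Rightarrow> 'a \<Rightarrow> real" and \<mu> :: "'f measure"
  assumes setting: "avg_setting D \<rho> pe \<mu>"
begin

text \<open>Domain and density are absorbed into a probability measure on the whole space, under
  which \<open>D\<close> has full measure and \<open>Gnorm2\<close> is a plain squared L2
  norm.\<close>

definition N :: "'a measure" where
  "N = density lborel (\<lambda>x. ennreal (indicator D x * \<rho> x))"

text \<open>The values of \<open>pe f\<close> outside \<open>D\<close> are arbitrary, possibly nonmeasurable, hence the cut-off.\<close>

definition ev :: "'f \<Rightarrow> 'a \<Rightarrow> real" where
  "ev f x = indicator D x * pe f x"

text \<open>For orthonormal \<open>e\<close> this is f minus its projection onto the span, as a
  function with a value at every point, since these values get sampled.\<close>

definition residual :: "nat \<Rightarrow> (nat \<Rightarrow> 'a \<Rightarrow> real) \<Rightarrow> 'f \<Rightarrow> 'a \<Rightarrow> real" where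
  "residual r e f x = ev f x - (\<Sum>k<r. (\<integral>y. ev f y * e k y \<partial>N) * e k x)"

lemma D_sets: "D \<in> sets lborel" and G: "gaussian_measure \<mu>"
  and rho_measurable: "(\<lambda>x. indicator D x * \<rho> x) \<in> borel_measurable lborel"
  and rho_nonneg: "x \<in> D \<Longrightarrow> 0 \<le> \<rho> x"
  and in_G_pe: "in_G D \<rho> (pe f)"
  using setting by (auto simp: avg_setting_def prob_density_on_def)

lemma D_nonempty: "D \<noteq> {}"
  using setting by (auto simp: avg_setting_def)

lemma sets_N[simp, measurable_cong]: "sets N = sets lborel"
  by (simp add: N_def)

lemma borel_measurable_N: "borel_measurable N = borel_measurable lborel"
  by (rule measurable_cong_sets) simp_all

lemma space_N[simp]: "space N = UNIV"
  by (simp add: N_def)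

sublocale N: prob_space N
proof
  have "emeasure N (space N) = (\<integral>\<^sup>+x. ennreal (indicator D x * \<rho> x) \<partial>lborel)"
    unfolding N_def using rho_measurable by (subst emeasure_density) auto
  also have "\<dots> = (\<integral>\<^sup>+x\<in>D. ennreal (\<rho> x) \<partial>lborel)"
    by (intro nn_integral_cong) (auto simp: indicator_def)
  also have "\<dots> = 1" using setting by (simp add: avg_setting_def prob_density_on_def)
  finally show "emeasure N (space N) = 1" .
qed

sublocale mu: prob_space \<mu>
  using G by (simp add: gaussian_measure_def)

sublocale muN: pair_sigma_finite \<mu> N ..

lemma AE_N_D: "AE x in N. x \<in> D"
  unfolding N_def using rho_measurable by (subst AE_density) (auto simp: indicator_def)

lemma bounded_linear_ev: "bounded_linear (\<lambda>f. ev f x)"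
proof (cases "x \<in> D")
  case True
  then show ?thesis using setting by (simp add: ev_def avg_setting_def)
qed (simp add: ev_def)

lemma ev_measurable[measurable]: "ev f \<in> borel_measurable N"
proof -
  have "ev f \<in> borel_measurable lborel"
    unfolding ev_def using in_G_pe[of f] by (simp add: in_G_def)
  then show ?thesis by simp
qed

lemma ev_joint_measurable[measurable]: "(\<lambda>(f, x). ev f x) \<in> borel_measurable (\<mu> \<Otimes>\<^sub>M N)"
proof (rule caratheodory_measurable)
  show "sets \<mu> = sets borel" using G by (simp add: gaussian_measure_def)
  show "continuous_on UNIV (\<lambda>f. ev f x)" for x
    by (rule linear_continuous_on[OF bounded_linear_ev])
qed (rule ev_measurable)

lemma Gnorm2_N:
  assumes "(\<lambda>x. indicator D x * h x) \<in> borel_measurable lborel"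
  shows "Gnorm2 D \<rho> h = (\<integral>\<^sup>+x. ennreal ((indicator D x * h x)\<^sup>2) \<partial>N)"
proof -
  have "(\<integral>\<^sup>+x. ennreal ((indicator D x * h x)\<^sup>2) \<partial>N)
     = (\<integral>\<^sup>+x. ennreal (indicator D x * \<rho> x) * ennreal ((indicator D x * h x)\<^sup>2) \<partial>lborel)"
    unfolding N_def using assms rho_measurable by (subst nn_integral_density) auto
  also have "\<dots> = Gnorm2 D \<rho> h"
    unfolding Gnorm2_def using rho_nonneg
    by (intro nn_integral_cong) (auto simp: indicator_def mult.commute simp flip: ennreal_mult)
  finally show ?thesis ..
qed

lemma square_int_ev: "square_int N (ev f)"
proof (rule square_intI_nn)
  have m: "(\<lambda>x. indicator D x * pe f x) \<in> borel_measurable lborel"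
    using in_G_pe[of f] by (simp add: in_G_def)
  show "(\<integral>\<^sup>+x. ennreal ((ev f x)\<^sup>2) \<partial>N) < \<infinity>"
    using in_G_pe[of f] unfolding in_G_def Gnorm2_N[OF m] ev_def by simp
qed (rule ev_measurable)

lemma in_G_square_int:
  assumes "square_int N h" shows "in_G D \<rho> h"
proof -
  have hm: "h \<in> borel_measurable lborel"
    using square_int_measurable[OF assms] by (simp only: borel_measurable_N)
  then have m: "(\<lambda>x. indicator D x * h x) \<in> borel_measurable lborel" using D_sets by measurable
  have "(\<integral>\<^sup>+x. ennreal ((indicator D x * h x)\<^sup>2) \<partial>N) \<le> (\<integral>\<^sup>+x. ennreal ((h x)\<^sup>2) \<partial>N)"
    by (intro nn_integral_mono ennreal_leI) (auto simp: indicator_def)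
  also have "\<dots> < \<infinity>" by (simp add: nn_integral_square_int[OF assms])
  finally show ?thesis using m by (simp add: in_G_def Gnorm2_N)
qed

lemma residual_joint_measurable:
  assumes "\<And>k. k < r \<Longrightarrow> e k \<in> borel_measurable N"
  shows "(\<lambda>(f, x). residual r e f x) \<in> borel_measurable (\<mu> \<Otimes>\<^sub>M N)"
proof -
  have c: "(\<lambda>f. \<integral>y. ev f y * e k y \<partial>N) \<in> borel_measurable \<mu>" if "k < r" for k
  proof (rule N.borel_measurable_lebesgue_integral)
    have [measurable]: "e k \<in> borel_measurable N" by (rule assms[OF that])
    show "(\<lambda>(f, y). ev f y * e k y) \<in> borel_measurable (\<mu> \<Otimes>\<^sub>M N)" by measurable
  qed
  have "(\<lambda>p. ev (fst p) (snd p)) \<in> borel_measurable (\<mu> \<Otimes>\<^sub>M N)"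
    using ev_joint_measurable by (simp add: case_prod_beta')
  then show ?thesis
    unfolding residual_def case_prod_beta'
    by (intro borel_measurable_diff borel_measurable_sum borel_measurable_times
        measurable_compose[OF measurable_fst c] measurable_compose[OF measurable_snd assms]) auto
qed

lemma square_int_residual:
  assumes "orthonormal N r e" shows "square_int N (residual r e f)"
  unfolding residual_def
  by (intro square_int_diff square_int_ev square_int_lincomb) (use assms in \<open>simp add: orthonormal_def\<close>)

text \<open>At fixed x the regression of f(x) on the data is a sum of \<open>K j f * h j x\<close>.
  As a function of x it lies, for every f, in the span of the same \<open>s\<close> \<le>
  \<open>m\<close> functions \<open>h j\<close>, and projecting f onto that span can only reduce the
  error. Fubini turns the pointwise comparison into one of norms.\<close>

lemma subspace_lower_bound:
  assumes adm: "admissible D \<rho> m Lambda_all Ls \<phi>"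
  shows "\<exists>r\<le>m. \<exists>e. orthonormal N r e \<and>
    (\<integral>\<^sup>+f. \<integral>\<^sup>+x. ennreal ((residual r e f x)\<^sup>2) \<partial>N \<partial>\<mu>)
     \<le> (\<integral>\<^sup>+f. Gnorm2 D \<rho> (\<lambda>x. pe f x - \<phi> (\<lambda>i\<in>{..<m}. Ls i f) x) \<partial>\<mu>)"
proof (cases "(\<integral>\<^sup>+f. Gnorm2 D \<rho> (\<lambda>x. pe f x - \<phi> (\<lambda>i\<in>{..<m}. Ls i f) x) \<partial>\<mu>) = \<infinity>")
  case True
  \<comment> \<open>Against an infinite error the empty system suffices.\<close>
  then show ?thesis by (intro exI[of _ 0]) (simp add: orthonormal_def)
next
  case False
  let ?P = "PiM {..<m} (\<lambda>_. lborel :: real measure)"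
  define T where "T f = (\<lambda>i\<in>{..<m}. Ls i f)" for f
  have L: "bounded_linear (Ls l)" if "l < m" for l
    using adm that by (auto simp: admissible_def Lambda_all_def)
  have Lm: "Ls l \<in> borel_measurable \<mu>" if "l < m" for l
    by (rule bounded_linear_measurable_gaussian[OF G L[OF that]])
  have Tm[measurable]: "T \<in> measurable \<mu> ?P"
    unfolding T_def using Lm by (intro measurable_restrict) auto
  have Tsp: "T f \<in> space ?P" for f by (simp add: T_def space_PiM)
  have \<phi>m: "(\<lambda>(y, x). \<phi> y x) \<in> borel_measurable (?P \<Otimes>\<^sub>M lborel)"
    using adm by (simp add: admissible_def)
  define a where "a f x = indicator D x * \<phi> (T f) x" for f x
  have am: "(\<lambda>x. indicator D x * \<phi> (T f) x) \<in> borel_measurable lborel" for f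
    using adm Tsp by (auto simp: admissible_def in_G_def)
  have a_joint: "(\<lambda>(f, x). a f x) \<in> borel_measurable (\<mu> \<Otimes>\<^sub>M N)"
  proof -
    have "(\<lambda>p. (T (fst p), snd p)) \<in> measurable (\<mu> \<Otimes>\<^sub>M N) (?P \<Otimes>\<^sub>M lborel)" by measurable
    from measurable_compose[OF this \<phi>m]
    have "(\<lambda>p. \<phi> (T (fst p)) (snd p)) \<in> borel_measurable (\<mu> \<Otimes>\<^sub>M N)" by simp
    then show ?thesis unfolding a_def case_prod_beta' using D_sets by measurable
  qed
  have Gn: "Gnorm2 D \<rho> (\<lambda>x. pe f x - \<phi> (T f) x) = (\<integral>\<^sup>+x. ennreal ((ev f x - a f x)\<^sup>2) \<partial>N)" for f
  proof (subst Gnorm2_N)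
    have "(\<lambda>x. indicator D x * pe f x - indicator D x * \<phi> (T f) x) \<in> borel_measurable lborel"
      using am[of f] in_G_pe[of f] by (intro borel_measurable_diff) (auto simp: in_G_def)
    then show "(\<lambda>x. indicator D x * (pe f x - \<phi> (T f) x)) \<in> borel_measurable lborel"
      by (simp add: right_diff_distrib)
  qed (simp add: ev_def a_def right_diff_distrib)
  obtain s C where on: "orthonormal \<mu> s (\<lambda>j f. \<Sum>l<m. C j l * Ls l f)"
    and span: "\<And>b. square_int \<mu> (\<lambda>f. \<Sum>l<m. b l * Ls l f) \<Longrightarrow>
      \<exists>c. AE f in \<mu>. (\<Sum>l<m. b l * Ls l f) = (\<Sum>j<s. c j * (\<Sum>l<m. C j l * Ls l f))"
    and s: "s \<le> m"
    using gram_schmidt[of m Ls \<mu>] Lm by blast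
  define K where "K j f = (\<Sum>l<m. C j l * Ls l f)" for j f
  have Km: "K j \<in> borel_measurable \<mu>" for j unfolding K_def using Lm by auto
  define h where "h j x = (\<integral>f. ev f x * K j f \<partial>\<mu>)" for j x
  have hm: "h j \<in> borel_measurable N" for j
    unfolding h_def
  proof (rule mu.borel_measurable_lebesgue_integral)
    have [measurable]: "K j \<in> borel_measurable \<mu>" by (rule Km)
    have "(\<lambda>(f, x). ev f x * K j f) \<in> borel_measurable (\<mu> \<Otimes>\<^sub>M N)" by measurable
    from measurable_pair_swap[OF this]
    show "(\<lambda>(x, f). ev f x * K j f) \<in> borel_measurable (N \<Otimes>\<^sub>M \<mu>)"
      by (simp add: case_prod_beta')
  qed
  define Q where "Q f x = (\<Sum>j<s. K j f * h j x)" for f x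
  have Q_joint: "(\<lambda>(f, x). Q f x) \<in> borel_measurable (\<mu> \<Otimes>\<^sub>M N)"
    unfolding Q_def case_prod_beta'
    by (intro borel_measurable_sum borel_measurable_times measurable_compose[OF measurable_fst Km]
        measurable_compose[OF measurable_snd hm])
  have pointwise: "(\<integral>\<^sup>+f. ennreal ((ev f x - Q f x)\<^sup>2) \<partial>\<mu>) \<le> (\<integral>\<^sup>+f. ennreal ((ev f x - a f x)\<^sup>2) \<partial>\<mu>)" for x
  proof -
    have "(\<lambda>y. \<phi> y x) \<in> borel_measurable ?P"
      using measurable_compose[OF measurable_Pair2'[of x lborel ?P] \<phi>m] by simp
    then have "(\<lambda>y. indicator D x * \<phi> y x) \<in> borel_measurable ?P" by simp
    also have "borel_measurable ?P = borel_measurable (PiM {..<m} (\<lambda>_. borel :: real measure))"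
      by (intro measurable_cong_sets sets_PiM_cong) auto
    finally have \<psi>: "(\<lambda>y. indicator D x * \<phi> y x) \<in> borel_measurable (PiM {..<m} (\<lambda>_. borel))" .
    show ?thesis
      using gaussian_regression[OF G bounded_linear_ev[of x] L on span \<psi>]
      by (simp add: Q_def K_def h_def a_def T_def mult.commute)
  qed
  have joint2: "(\<lambda>(f, x). ennreal ((ev f x - b f x)\<^sup>2)) \<in> borel_measurable (\<mu> \<Otimes>\<^sub>M N)"
    if "(\<lambda>(f, x). b f x) \<in> borel_measurable (\<mu> \<Otimes>\<^sub>M N)" for b
    using that ev_joint_measurable by measurable
  have le: "(\<integral>\<^sup>+f. \<integral>\<^sup>+x. ennreal ((ev f x - Q f x)\<^sup>2) \<partial>N \<partial>\<mu>) \<le> (\<integral>\<^sup>+f. Gnorm2 D \<rho> (\<lambda>x. pe f x - \<phi> (T f) x) \<partial>\<mu>)"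
  proof -
    have "(\<integral>\<^sup>+f. \<integral>\<^sup>+x. ennreal ((ev f x - Q f x)\<^sup>2) \<partial>N \<partial>\<mu>) = (\<integral>\<^sup>+x. \<integral>\<^sup>+f. ennreal ((ev f x - Q f x)\<^sup>2) \<partial>\<mu> \<partial>N)"
      by (rule muN.Fubini'[symmetric]) (rule joint2[OF Q_joint])
    also have "\<dots> \<le> (\<integral>\<^sup>+x. \<integral>\<^sup>+f. ennreal ((ev f x - a f x)\<^sup>2) \<partial>\<mu> \<partial>N)"
      by (intro nn_integral_mono pointwise)
    also have "\<dots> = (\<integral>\<^sup>+f. \<integral>\<^sup>+x. ennreal ((ev f x - a f x)\<^sup>2) \<partial>N \<partial>\<mu>)"
      by (rule muN.Fubini') (rule joint2[OF a_joint])
    finally show ?thesis by (simp add: Gn)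
  qed
  obtain r B where r: "r \<le> s" and onN: "orthonormal N r (\<lambda>k x. \<Sum>j<s. B k j * h j x)"
    and spanN: "\<And>b. square_int N (\<lambda>x. \<Sum>j<s. b j * h j x) \<Longrightarrow>
      \<exists>c. AE x in N. (\<Sum>j<s. b j * h j x) = (\<Sum>k<r. c k * (\<Sum>j<s. B k j * h j x))"
    using gram_schmidt[of s h N] hm by blast
  define e where "e k x = (\<Sum>j<s. B k j * h j x)" for k x
  have one: "orthonormal N r e" using onN by (simp add: e_def[abs_def])
  \<comment> \<open>Square integrability is not established for the single \<open>h j\<close>;
    finiteness of the total error yields it for the combination \<open>Q f\<close> for almost every
    f, which is what the spanning property \<open>spanN\<close> asks.\<close>
  have fin: "AE f in \<mu>. (\<integral>\<^sup>+x. ennreal ((ev f x - Q f x)\<^sup>2) \<partial>N) \<noteq> \<infinity>"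
  proof (rule nn_integral_noteq_infinite)
    show "(\<lambda>f. \<integral>\<^sup>+x. ennreal ((ev f x - Q f x)\<^sup>2) \<partial>N) \<in> borel_measurable \<mu>"
      by (rule N.borel_measurable_nn_integral) (rule joint2[OF Q_joint])
    show "(\<integral>\<^sup>+f. \<integral>\<^sup>+x. ennreal ((ev f x - Q f x)\<^sup>2) \<partial>N \<partial>\<mu>) \<noteq> \<infinity>"
      using le False by (auto simp: T_def top_unique)
  qed
  have "AE f in \<mu>. (\<integral>\<^sup>+x. ennreal ((residual r e f x)\<^sup>2) \<partial>N) \<le> (\<integral>\<^sup>+x. ennreal ((ev f x - Q f x)\<^sup>2) \<partial>N)"
    using fin
  proof eventually_elim
    case (elim f)
    have Qm: "Q f \<in> borel_measurable N" unfolding Q_def using hm by auto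
    have d: "square_int N (\<lambda>x. ev f x - Q f x)"
      by (rule square_intI_nn) (use Qm elim in \<open>auto simp: less_top\<close>)
    have "square_int N (Q f)"
      using square_int_diff[OF square_int_ev[of f] d] by simp
    then obtain c where c: "AE x in N. Q f x = (\<Sum>k<r. c k * e k x)"
      using spanN[of "\<lambda>j. K j f"] unfolding Q_def e_def by blast
    have lc: "square_int N (\<lambda>x. ev f x - (\<Sum>k<r. c k * e k x))"
      by (intro square_int_diff square_int_ev square_int_lincomb) (use one in \<open>simp add: orthonormal_def\<close>)
    have "(\<integral>x. (residual r e f x)\<^sup>2 \<partial>N) \<le> (\<integral>x. (ev f x - (\<Sum>k<r. c k * e k x))\<^sup>2 \<partial>N)"
      unfolding residual_def orthonormal_pythagoras[OF one square_int_ev, of f c]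
      by (simp add: sum_nonneg)
    then have "(\<integral>\<^sup>+x. ennreal ((residual r e f x)\<^sup>2) \<partial>N) \<le> (\<integral>\<^sup>+x. ennreal ((ev f x - (\<Sum>k<r. c k * e k x))\<^sup>2) \<partial>N)"
      unfolding nn_integral_square_int[OF lc] nn_integral_square_int[OF square_int_residual[OF one]]
      by (rule ennreal_leI)
    also have "\<dots> = (\<integral>\<^sup>+x. ennreal ((ev f x - Q f x)\<^sup>2) \<partial>N)"
    proof (rule nn_integral_cong_AE)
      show "AE x in N. ennreal ((ev f x - (\<Sum>k<r. c k * e k x))\<^sup>2) = ennreal ((ev f x - Q f x)\<^sup>2)"
        using c by eventually_elim simp
    qed
    finally show ?case .
  qed
  then have "(\<integral>\<^sup>+f. \<integral>\<^sup>+x. ennreal ((residual r e f x)\<^sup>2) \<partial>N \<partial>\<mu>) \<le> (\<integral>\<^sup>+f. \<integral>\<^sup>+x. ennreal ((ev f x - Q f x)\<^sup>2) \<partial>N \<partial>\<mu>)"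
    by (rule nn_integral_mono_AE)
  also note le
  finally show ?thesis using one r s by (intro exI[of _ r] conjI exI[of _ e]) (auto simp: T_def)
qed

text \<open>Pythagoras splits the squared error into that of the projection and that of the
  coefficients. The latter is bounded by \<open>least_squares\<close>, where the data minus the
  projection at a sample point is the residual there.\<close>

lemma least_squares_upper_bound:
  assumes on: "orthonormal N r e" and n: "n \<ge> 1" and D: "\<And>i. i < n \<Longrightarrow> xs i \<in> D"
    and q: "\<And>i. 0 \<le> q i"
    and frame: "\<And>a. (\<Sum>k<r. (a k)\<^sup>2) / 2 \<le> (\<Sum>i<n. q i * (\<Sum>k<r. a k * e k (xs i))\<^sup>2)"
  shows "e_avg D \<rho> pe \<mu> n (Lambda_std D pe) \<le> ennsqrt (\<integral>\<^sup>+f. ((\<integral>\<^sup>+x. ennreal ((residual r e f x)\<^sup>2) \<partial>N)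
      + ennreal (4 * (\<Sum>k<r. (\<Sum>i<n. q i * residual r e f (xs i) * e k (xs i))\<^sup>2))) \<partial>\<mu>)"
proof -
  have e: "square_int N (e k)" if "k < r" for k using on that by (simp add: orthonormal_def)
  obtain W where W: "\<And>y c. (\<Sum>k<r. ((\<Sum>i<n. W k i * y i) - c k)\<^sup>2) \<le>
    4 * (\<Sum>k<r. (\<Sum>i<n. q i * (y i - (\<Sum>l<r. c l * e l (xs i))) * e k (xs i))\<^sup>2)"
    using least_squares[where q=q and F="\<lambda>k i. e k (xs i)", OF q frame] by blast
  define \<phi> where "\<phi> y x = (\<Sum>k<r. (\<Sum>i<n. W k i * y i) * e k x)" for y :: "nat \<Rightarrow> real" and x
  define Ls where "Ls i f = pe f (xs i)" for i f
  let ?P = "PiM {..<n} (\<lambda>_. lborel :: real measure)"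
  have sq\<phi>: "square_int N (\<phi> y)" for y unfolding \<phi>_def by (intro square_int_lincomb e)
  have adm: "admissible D \<rho> n (Lambda_std D pe) Ls \<phi>"
    unfolding admissible_def
  proof (intro conjI allI impI ballI)
    show "Ls i \<in> Lambda_std D pe" if "i < n" for i
      using D[OF that] by (auto simp: Ls_def[abs_def] Lambda_std_def)
    have em: "e k \<in> borel_measurable lborel" if "k < r" for k
      using square_int_measurable[OF e[OF that]] by (simp only: borel_measurable_N)
    have ym: "(\<lambda>p. fst p i) \<in> borel_measurable (?P \<Otimes>\<^sub>M lborel)" if "i < n" for i
      using measurable_compose[OF measurable_fst measurable_component_singleton[of i "{..<n}" "\<lambda>_. lborel :: real measure"]] that
      by simp
    show "(\<lambda>(y, x). \<phi> y x) \<in> borel_measurable (?P \<Otimes>\<^sub>M lborel)"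
      unfolding \<phi>_def case_prod_beta'
      by (intro borel_measurable_sum borel_measurable_times borel_measurable_const ym
          measurable_compose[OF measurable_snd em]) auto
    show "in_G D \<rho> (\<phi> y)" for y by (rule in_G_square_int[OF sq\<phi>])
  qed
  have err: "Gnorm2 D \<rho> (\<lambda>x. pe f x - \<phi> (\<lambda>i\<in>{..<n}. Ls i f) x) \<le> (\<integral>\<^sup>+x. ennreal ((residual r e f x)\<^sup>2) \<partial>N)
      + ennreal (4 * (\<Sum>k<r. (\<Sum>i<n. q i * residual r e f (xs i) * e k (xs i))\<^sup>2))" for f
  proof -
    define c where "c k = (\<integral>y. ev f y * e k y \<partial>N)" for k
    define b where "b k = (\<Sum>i<n. W k i * pe f (xs i))" for k
    have \<phi>b: "\<phi> (\<lambda>i\<in>{..<n}. Ls i f) x = (\<Sum>k<r. b k * e k x)" for x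
      unfolding \<phi>_def b_def Ls_def by (intro sum.cong arg_cong2[where f="(*)"]) auto
    have m: "(\<lambda>x. indicator D x * (pe f x - \<phi> (\<lambda>i\<in>{..<n}. Ls i f) x)) \<in> borel_measurable lborel"
    proof -
      have "(\<lambda>x. ev f x - indicator D x * \<phi> (\<lambda>i\<in>{..<n}. Ls i f) x) \<in> borel_measurable N"
        using D_sets sq\<phi>[THEN square_int_measurable] by measurable
      then show ?thesis by (simp add: ev_def right_diff_distrib)
    qed
    have lc: "square_int N (\<lambda>x. ev f x - (\<Sum>k<r. b k * e k x))"
      by (intro square_int_diff square_int_ev square_int_lincomb e)
    have "Gnorm2 D \<rho> (\<lambda>x. pe f x - \<phi> (\<lambda>i\<in>{..<n}. Ls i f) x) = (\<integral>\<^sup>+x. ennreal ((ev f x - (\<Sum>k<r. b k * e k x))\<^sup>2) \<partial>N)"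
    proof (subst Gnorm2_N[OF m], rule nn_integral_cong_AE)
      show "AE x in N. ennreal ((indicator D x * (pe f x - \<phi> (\<lambda>i\<in>{..<n}. Ls i f) x))\<^sup>2)
          = ennreal ((ev f x - (\<Sum>k<r. b k * e k x))\<^sup>2)"
        using AE_N_D unfolding \<phi>b by eventually_elim (simp add: ev_def)
    qed
    also have "\<dots> = ennreal ((\<integral>x. (residual r e f x)\<^sup>2 \<partial>N) + (\<Sum>k<r. (b k - c k)\<^sup>2))"
      unfolding nn_integral_square_int[OF lc] orthonormal_pythagoras[OF on square_int_ev, of f b]
      by (simp add: residual_def c_def)
    also have "\<dots> \<le> ennreal ((\<integral>x. (residual r e f x)\<^sup>2 \<partial>N) +
        4 * (\<Sum>k<r. (\<Sum>i<n. q i * residual r e f (xs i) * e k (xs i))\<^sup>2))"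
    proof (intro ennreal_leI add_left_mono)
      have "residual r e f (xs i) = pe f (xs i) - (\<Sum>l<r. c l * e l (xs i))" if "i < n" for i
        using D[OF that] by (simp add: residual_def ev_def[of f "xs i"] c_def)
      then show "(\<Sum>k<r. (b k - c k)\<^sup>2) \<le> 4 * (\<Sum>k<r. (\<Sum>i<n. q i * residual r e f (xs i) * e k (xs i))\<^sup>2)"
        using W[of "\<lambda>i. pe f (xs i)" c] by (simp add: b_def)
    qed
    also have "\<dots> = (\<integral>\<^sup>+x. ennreal ((residual r e f x)\<^sup>2) \<partial>N) +
        ennreal (4 * (\<Sum>k<r. (\<Sum>i<n. q i * residual r e f (xs i) * e k (xs i))\<^sup>2))"
      unfolding nn_integral_square_int[OF square_int_residual[OF on]]
      by (intro ennreal_plus) (auto intro!: sum_nonneg)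
    finally show ?thesis .
  qed
  have "e_avg D \<rho> pe \<mu> n (Lambda_std D pe) \<le> alg_err D \<rho> pe \<mu> n Ls \<phi>"
    unfolding e_avg_def using n adm by (auto intro!: INF_lower2[of "(Ls, \<phi>)"])
  also have "\<dots> \<le> ennsqrt (\<integral>\<^sup>+f. ((\<integral>\<^sup>+x. ennreal ((residual r e f x)\<^sup>2) \<partial>N)
      + ennreal (4 * (\<Sum>k<r. (\<Sum>i<n. q i * residual r e f (xs i) * e k (xs i))\<^sup>2))) \<partial>\<mu>)"
    unfolding alg_err_def by (intro ennsqrt_mono nn_integral_mono err)
  finally show ?thesis .
qed

end

context average_case
begin

section \<open>Random sampling points\<close>

text \<open>For orthonormal \<open>e\<close>, the diagonal of the reproducing kernel of the span,
  that is the reciprocal of the classical Christoffel function; its integral is r.\<close>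

definition christoffel :: "nat \<Rightarrow> (nat \<Rightarrow> 'a \<Rightarrow> real) \<Rightarrow> 'a \<Rightarrow> real" where
  "christoffel r e x = (\<Sum>k<r. (e k x)\<^sup>2)"

text \<open>The sampling distribution: drawing from it and weighting by the reciprocal density makes the vectors
  \<open>(e\<^sub>k(x))\<^sub>k\<close> isotropic and of constant norm. Where \<open>christoffel\<close> vanishes, so do all \<open>e\<^sub>k\<close>, and the
  quotients by it below are \<open>0\<close>.\<close>

definition samp :: "nat \<Rightarrow> (nat \<Rightarrow> 'a \<Rightarrow> real) \<Rightarrow> 'a measure" where
  "samp r e = density N (\<lambda>x. ennreal (christoffel r e x / real r))"

lemma christoffel_nonneg: "0 \<le> christoffel r e x"
  by (simp add: christoffel_def sum_nonneg)

lemma christoffel_eq_0: "christoffel r e x = 0 \<Longrightarrow> k < r \<Longrightarrow> e k x = 0"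
  by (simp add: christoffel_def sum_nonneg_eq_0_iff)

lemma e_measurable: "orthonormal N r e \<Longrightarrow> k < r \<Longrightarrow> e k \<in> borel_measurable N"
  by (simp add: orthonormal_def square_int_def)

lemma christoffel_measurable:
  assumes "orthonormal N r e" shows "christoffel r e \<in> borel_measurable N"
  unfolding christoffel_def
  by (intro borel_measurable_sum borel_measurable_power e_measurable[OF assms]) auto

lemma sets_samp[simp, measurable_cong]: "sets (samp r e) = sets lborel"
  by (simp add: samp_def)

lemma borel_measurable_samp: "borel_measurable (samp r e) = borel_measurable N"
  by (rule measurable_cong_sets) simp_all

lemma integral_samp:
  assumes on: "orthonormal N r e" and f: "f \<in> borel_measurable N"
  shows "(\<integral>x. f x \<partial>samp r e) = (\<integral>x. christoffel r e x / real r * f x \<partial>N)"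
    and "integrable (samp r e) f \<longleftrightarrow> integrable N (\<lambda>x. christoffel r e x / real r * (f x :: real))"
  unfolding samp_def using f christoffel_measurable[OF on] christoffel_nonneg
  by (subst integral_density integrable_density; simp)+

lemma prob_space_samp:
  assumes on: "orthonormal N r e" and r: "0 < r"
  shows "prob_space (samp r e)"
proof
  have i: "integrable N (\<lambda>x. (e k x)\<^sup>2)" "(\<integral>x. (e k x)\<^sup>2 \<partial>N) = 1" if "k < r" for k
    using on that by (auto simp: orthonormal_def square_int_def power2_eq_square)
  have "emeasure (samp r e) (space (samp r e)) = (\<integral>\<^sup>+x. ennreal (christoffel r e x / real r) \<partial>N)"
    unfolding samp_def using christoffel_measurable[OF on] by (subst emeasure_density) auto
  also have "\<dots> = ennreal (\<integral>x. christoffel r e x / real r \<partial>N)"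
  proof (rule nn_integral_eq_integral)
    have "integrable N (christoffel r e)"
      unfolding christoffel_def by (rule Bochner_Integration.integrable_sum) (simp add: i)
    then show "integrable N (\<lambda>x. christoffel r e x / real r)" by simp
  qed (simp add: christoffel_nonneg)
  also have "(\<integral>x. christoffel r e x / real r \<partial>N) = 1"
  proof -
    have "(\<integral>x. christoffel r e x \<partial>N) = (\<Sum>k<r. \<integral>x. (e k x)\<^sup>2 \<partial>N)"
      unfolding christoffel_def by (rule Bochner_Integration.integral_sum) (simp add: i)
    then show ?thesis using i r by simp
  qed
  finally show "emeasure (samp r e) (space (samp r e)) = 1" by simp
qed

lemma AE_samp_D:
  assumes on: "orthonormal N r e"
  shows "AE x in samp r e. x \<in> D"
  unfolding samp_def using AE_N_D christoffel_measurable[OF on] by (subst AE_density) auto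

text \<open>The factor \<open>christoffel\<close> in the density cancels the normalisation of u u^T
  and leaves e_k e_l / r. The squared norm is 1 except where \<open>christoffel\<close> vanishes and
  u = 0.\<close>

lemma samp_isotropic:
  assumes on: "orthonormal N r e" and r: "0 < r"
  defines "u \<equiv> \<lambda>x k. if k < r then e k x / sqrt (christoffel r e x) else 0"
  shows "(\<lambda>x. u x k) \<in> borel_measurable (samp r e)" and "ip r (u x) (u x) \<le> 1"
    and "k < r \<Longrightarrow> l < r \<Longrightarrow> (\<integral>x. u x k * u x l \<partial>samp r e) = (if k = l then 1 / real r else 0)"
proof -
  show m: "(\<lambda>x. u x k) \<in> borel_measurable (samp r e)" for k
    unfolding borel_measurable_samp u_def
    using e_measurable[OF on, of k] christoffel_measurable[OF on] by (cases "k < r") auto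
  have "ip r (u x) (u x) = (\<Sum>k<r. (e k x)\<^sup>2 / christoffel r e x)"
    unfolding ip_def u_def using christoffel_nonneg[of r e x]
    by (intro sum.cong) (auto simp: power2_eq_square)
  also have "\<dots> = christoffel r e x / christoffel r e x"
    by (simp only: sum_divide_distrib[symmetric] christoffel_def)
  also have "\<dots> \<le> 1" by simp
  finally show "ip r (u x) (u x) \<le> 1" .
  assume k: "k < r" and l: "l < r"
  have "(\<integral>x. u x k * u x l \<partial>samp r e) = (\<integral>x. christoffel r e x / real r * (u x k * u x l) \<partial>N)"
    by (rule integral_samp[OF on]) (use m in \<open>auto simp: borel_measurable_samp\<close>)
  also have "\<dots> = (\<integral>x. e k x * e l x / real r \<partial>N)"
  proof (rule Bochner_Integration.integral_cong[OF refl])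
    fix x
    show "christoffel r e x / real r * (u x k * u x l) = e k x * e l x / real r"
      using christoffel_eq_0[of r e x k] christoffel_nonneg[of r e x] k l
      by (cases "christoffel r e x = 0") (auto simp: u_def)
  qed
  also have "\<dots> = (if k = l then 1 / real r else 0)"
    using on k l by (simp add: orthonormal_def)
  finally show "(\<integral>x. u x k * u x l \<partial>samp r e) = (if k = l then 1 / real r else 0)" .
qed

text \<open>The weight cancels the density up to 1/n, so the mean of \<open>Y k\<close> is 1/n times
  the inner product of e_k with the residual, which is 0. Summed over k, the second moments are at
  most r/n^2 times the squared norm of the residual, because the ratios e_k^2 / christoffel sum to
  at most 1; n draws and the factor 4 give 4r/n.\<close>

lemma expected_noise:
  assumes on: "orthonormal N r e" and r: "0 < r" and n: "0 < n"
  defines "q \<equiv> \<lambda>x. real r / (real n * christoffel r e x)"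
  shows "(\<integral>\<^sup>+\<omega>. ennreal (4 * (\<Sum>k<r. (\<Sum>i<n. q (\<omega> i) * residual r e f (\<omega> i) * e k (\<omega> i))\<^sup>2))
      \<partial>PiM {..<n} (\<lambda>_. samp r e))
    \<le> ennreal (4 * real r / real n) * (\<integral>\<^sup>+x. ennreal ((residual r e f x)\<^sup>2) \<partial>N)"
proof -
  let ?S = "christoffel r e" and ?g = "residual r e f"
  define Y where "Y k x = q x * ?g x * e k x" for k x
  have g: "square_int N ?g" by (rule square_int_residual[OF on])
  have gm: "?g \<in> borel_measurable N" by (rule square_int_measurable[OF g])
  have qm: "q \<in> borel_measurable N" unfolding q_def using christoffel_measurable[OF on] by auto
  have Ym: "Y k \<in> borel_measurable N" if "k < r" for k
    unfolding Y_def using gm qm e_measurable[OF on that] by auto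
  have g2: "integrable N (\<lambda>x. (?g x)\<^sup>2)" using g by (simp add: square_int_def)
  have Y2: "?S x / real r * (Y k x)\<^sup>2 = real r / (real n)\<^sup>2 * ((?g x)\<^sup>2 * ((e k x)\<^sup>2 / ?S x))" for k x
    using r n by (cases "?S x = 0") (auto simp: Y_def q_def power2_eq_square field_simps)
  have ratio: "(e k x)\<^sup>2 / ?S x \<le> 1" if "k < r" for k x
  proof -
    have "(e k x)\<^sup>2 \<le> ?S x" unfolding christoffel_def using that by (intro member_le_sum) auto
    then show ?thesis using christoffel_nonneg[of r e x] by (cases "?S x = 0") (auto simp: field_simps)
  qed
  have int: "integrable N (\<lambda>x. (?g x)\<^sup>2 * ((e k x)\<^sup>2 / ?S x))" if k: "k < r" for k
  proof (rule Bochner_Integration.integrable_bound[OF g2])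
    show "(\<lambda>x. (?g x)\<^sup>2 * ((e k x)\<^sup>2 / ?S x)) \<in> borel_measurable N"
      using gm e_measurable[OF on k] christoffel_measurable[OF on] by auto
    show "AE x in N. norm ((?g x)\<^sup>2 * ((e k x)\<^sup>2 / ?S x)) \<le> norm ((?g x)\<^sup>2)"
    proof (rule AE_I2)
      fix x
      have "(?g x)\<^sup>2 * ((e k x)\<^sup>2 / ?S x) \<le> (?g x)\<^sup>2 * 1" by (intro mult_left_mono ratio[OF k]) simp
      moreover have "0 \<le> (?g x)\<^sup>2 * ((e k x)\<^sup>2 / ?S x)" using christoffel_nonneg[of r e x] by simp
      ultimately show "norm ((?g x)\<^sup>2 * ((e k x)\<^sup>2 / ?S x)) \<le> norm ((?g x)\<^sup>2)" by simp
    qed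
  qed
  have sqY: "square_int (samp r e) (Y k)" if k: "k < r" for k
  proof -
    have "integrable (samp r e) (\<lambda>x. (Y k x)\<^sup>2)"
      using Ym[OF k] int[OF k] by (subst integral_samp(2)[OF on]) (auto simp only: Y2 borel_measurable_power integrable_mult_right)
    then show ?thesis using Ym[OF k] by (simp only: square_int_def borel_measurable_samp)
  qed
  have mean: "(\<integral>x. Y k x \<partial>samp r e) = 0" if k: "k < r" for k
  proof -
    have "(\<integral>x. Y k x \<partial>samp r e) = (\<integral>x. ?S x / real r * Y k x \<partial>N)" by (rule integral_samp(1)[OF on Ym[OF k]])
    also have "\<dots> = (\<integral>x. 1 / real n * (e k x * ?g x) \<partial>N)"
    proof (rule Bochner_Integration.integral_cong[OF refl])
      fix x show "?S x / real r * Y k x = 1 / real n * (e k x * ?g x)"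
        using christoffel_eq_0[of r e x k] k r n
        by (cases "?S x = 0") (auto simp: Y_def q_def field_simps)
    qed
    also have "\<dots> = 0"
      using orthonormal_residual[OF on square_int_ev k, of f] by (simp add: residual_def)
    finally show ?thesis .
  qed
  have "(\<Sum>k<r. (\<integral>x. (Y k x)\<^sup>2 \<partial>samp r e)) \<le> real r / (real n)\<^sup>2 * (\<integral>x. (?g x)\<^sup>2 \<partial>N)"
  proof -
    have "(\<Sum>k<r. (\<integral>x. (Y k x)\<^sup>2 \<partial>samp r e)) = (\<Sum>k<r. real r / (real n)\<^sup>2 * (\<integral>x. (?g x)\<^sup>2 * ((e k x)\<^sup>2 / ?S x) \<partial>N))"
    proof (rule sum.cong[OF refl])
      fix k assume "k \<in> {..<r}"
      then have "(\<integral>x. (Y k x)\<^sup>2 \<partial>samp r e) = (\<integral>x. ?S x / real r * (Y k x)\<^sup>2 \<partial>N)"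
        using Ym by (intro integral_samp(1)[OF on]) auto
      then show "(\<integral>x. (Y k x)\<^sup>2 \<partial>samp r e) = real r / (real n)\<^sup>2 * (\<integral>x. (?g x)\<^sup>2 * ((e k x)\<^sup>2 / ?S x) \<partial>N)"
        by (simp only: Y2 integral_mult_right_zero)
    qed
    also have "\<dots> = real r / (real n)\<^sup>2 * (\<integral>x. (\<Sum>k<r. (?g x)\<^sup>2 * ((e k x)\<^sup>2 / ?S x)) \<partial>N)"
    proof -
      have "(\<integral>x. (\<Sum>k<r. (?g x)\<^sup>2 * ((e k x)\<^sup>2 / ?S x)) \<partial>N) = (\<Sum>k<r. \<integral>x. (?g x)\<^sup>2 * ((e k x)\<^sup>2 / ?S x) \<partial>N)"
        by (rule Bochner_Integration.integral_sum) (rule int, simp)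
      then show ?thesis by (simp only: sum_distrib_left)
    qed
    also have "\<dots> \<le> real r / (real n)\<^sup>2 * (\<integral>x. (?g x)\<^sup>2 \<partial>N)"
    proof (rule mult_left_mono)
      show "(\<integral>x. (\<Sum>k<r. (?g x)\<^sup>2 * ((e k x)\<^sup>2 / ?S x)) \<partial>N) \<le> (\<integral>x. (?g x)\<^sup>2 \<partial>N)"
      proof (rule integral_mono[OF _ g2])
        show "integrable N (\<lambda>x. \<Sum>k<r. (?g x)\<^sup>2 * ((e k x)\<^sup>2 / ?S x))"
          by (intro Bochner_Integration.integrable_sum int) simp
        fix x
        have "(\<Sum>k<r. (?g x)\<^sup>2 * ((e k x)\<^sup>2 / ?S x)) = (?g x)\<^sup>2 * (?S x / ?S x)"
          by (simp only: christoffel_def sum_distrib_left[symmetric] sum_divide_distrib[symmetric])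
        also have "\<dots> \<le> (?g x)\<^sup>2 * 1" by (intro mult_left_mono) auto
        finally show "(\<Sum>k<r. (?g x)\<^sup>2 * ((e k x)\<^sup>2 / ?S x)) \<le> (?g x)\<^sup>2" by simp
      qed
    qed simp
    finally show ?thesis .
  qed
  then have le: "4 * (real n * (\<Sum>k<r. (\<integral>x. (Y k x)\<^sup>2 \<partial>samp r e))) \<le> 4 * real r / real n * (\<integral>x. (?g x)\<^sup>2 \<partial>N)"
    using n mult_left_mono[of _ _ "4 * real n"] by (fastforce simp: power2_eq_square)
  let ?V = "\<lambda>\<omega>. (\<Sum>k<r. (\<Sum>i<n. Y k (\<omega> i))\<^sup>2)"
  have Vm: "(\<lambda>\<omega>. ennreal (?V \<omega>)) \<in> borel_measurable (PiM {..<n} (\<lambda>_. samp r e))"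
    by (intro measurable_compose[OF _ measurable_ennreal] borel_measurable_sum borel_measurable_power
        measurable_PiM_component_fun[where u="\<lambda>x k. Y k x"]) (use Ym in \<open>auto simp only: borel_measurable_samp\<close>)
  have "(\<integral>\<^sup>+\<omega>. ennreal (4 * ?V \<omega>) \<partial>PiM {..<n} (\<lambda>_. samp r e))
     = (\<integral>\<^sup>+\<omega>. ennreal 4 * ennreal (?V \<omega>) \<partial>PiM {..<n} (\<lambda>_. samp r e))"
    by (intro nn_integral_cong ennreal_mult) (auto intro!: sum_nonneg)
  also have "\<dots> = ennreal 4 * (\<integral>\<^sup>+\<omega>. ennreal (?V \<omega>) \<partial>PiM {..<n} (\<lambda>_. samp r e))"
    by (rule nn_integral_cmult[OF Vm])
  also have "\<dots> = ennreal 4 * ennreal (real n * (\<Sum>k<r. (\<integral>x. (Y k x)\<^sup>2 \<partial>samp r e)))"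
    by (subst nn_integral_sum_centered[OF prob_space_samp[OF on r] sqY mean]) auto
  also have "\<dots> = ennreal (4 * (real n * (\<Sum>k<r. (\<integral>x. (Y k x)\<^sup>2 \<partial>samp r e))))"
    by (intro ennreal_mult[symmetric]) (auto intro!: mult_nonneg_nonneg sum_nonneg)
  also have "\<dots> \<le> ennreal (4 * real r / real n * (\<integral>x. (?g x)\<^sup>2 \<partial>N))" by (rule ennreal_leI[OF le])
  also have "\<dots> = ennreal (4 * real r / real n) * ennreal (\<integral>x. (?g x)\<^sup>2 \<partial>N)" by (rule ennreal_mult) auto
  finally show ?thesis unfolding Y_def nn_integral_square_int[OF g] .
qed

text \<open>Every good configuration bounds I^2 by its own error, so integrating over the good event
  puts (1 - \<delta>) I^2 on the left; on the right the nonnegative integrand is extended to all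
  configurations, for which the mean noise is known.\<close>

lemma e_avg_std_le_subspace:
  assumes on: "orthonormal N r e" and r: "0 < r" "r \<le> n" and \<delta>: "0 < \<delta>" "\<delta> < 1"
    and n: "48 * (sqrt 2 * ln (2 * real n) - ln \<delta>) \<le> real n / real r"
  defines "I \<equiv> e_avg D \<rho> pe \<mu> n (Lambda_std D pe)"
  shows "ennreal (1 - \<delta>) * (I * I) \<le> ennreal (1 + 4 * real r / real n) *
     (\<integral>\<^sup>+f. \<integral>\<^sup>+x. ennreal ((residual r e f x)\<^sup>2) \<partial>N \<partial>\<mu>)"
proof -
  let ?S = "christoffel r e" and ?P = "PiM {..<n} (\<lambda>_. samp r e)"
  have n1: "n \<ge> 1" using r by simp
  interpret samp: prob_space "samp r e" by (rule prob_space_samp[OF on r(1)])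
  interpret P: prob_space ?P by (intro prob_space_PiM prob_space_samp[OF on r(1)])
  interpret PM: pair_sigma_finite \<mu> ?P ..
  define u where "u x k = (if k < r then e k x / sqrt (?S x) else 0)" for x k
  define q where "q x = real r / (real n * ?S x)" for x
  define A where "A f = (\<integral>\<^sup>+x. ennreal ((residual r e f x)\<^sup>2) \<partial>N)" for f
  define V where "V f \<omega> = 4 * (\<Sum>k<r. (\<Sum>i<n. q (\<omega> i) * residual r e f (\<omega> i) * e k (\<omega> i))\<^sup>2)" for f \<omega>
  have em: "e k \<in> borel_measurable N" if "k < r" for k by (rule e_measurable[OF on that])
  have joint: "(\<lambda>(f, x). residual r e f x) \<in> borel_measurable (\<mu> \<Otimes>\<^sub>M N)"
    by (rule residual_joint_measurable[OF em])
  have Am: "A \<in> borel_measurable \<mu>"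
    unfolding A_def by (rule N.borel_measurable_nn_integral) (use joint in measurable)
  have qm: "q \<in> borel_measurable N" unfolding q_def using christoffel_measurable[OF on] by auto
  have comp: "(\<lambda>p. snd p i) \<in> measurable (\<mu> \<Otimes>\<^sub>M ?P) N" if "i < n" for i
  proof -
    have "(\<lambda>p. snd p i) \<in> measurable (\<mu> \<Otimes>\<^sub>M ?P) (samp r e)"
      using measurable_compose[OF measurable_snd measurable_component_singleton[of i "{..<n}" "\<lambda>_. samp r e"]] that
      by simp
    also have "measurable (\<mu> \<Otimes>\<^sub>M ?P) (samp r e) = measurable (\<mu> \<Otimes>\<^sub>M ?P) N"
      by (rule measurable_cong_sets) simp_all
    finally show ?thesis .
  qed
  have resm: "(\<lambda>p. residual r e (fst p) (snd p i)) \<in> borel_measurable (\<mu> \<Otimes>\<^sub>M ?P)" if "i < n" for i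
    using measurable_compose[OF measurable_Pair[OF measurable_fst comp[OF that]] joint] by simp
  have Vm: "(\<lambda>(f, \<omega>). V f \<omega>) \<in> borel_measurable (\<mu> \<Otimes>\<^sub>M ?P)"
    unfolding V_def case_prod_beta'
    by (intro borel_measurable_sum borel_measurable_times borel_measurable_power borel_measurable_const
        resm measurable_compose[OF comp qm] measurable_compose[OF comp em]) auto
  have Bm: "(\<lambda>(f, \<omega>). A f + ennreal (V f \<omega>)) \<in> borel_measurable (\<mu> \<Otimes>\<^sub>M ?P)"
    using Am Vm by measurable
  have Vf: "(\<lambda>\<omega>. ennreal (V f \<omega>)) \<in> borel_measurable ?P" if "f \<in> space \<mu>" for f
    using measurable_compose[OF measurable_Pair1'[OF that] Vm] by simp
  obtain E where E: "E \<in> sets ?P" "ennreal (1 - \<delta>) \<le> emeasure ?P E"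
    and frame: "\<And>\<omega> a. \<omega> \<in> E \<Longrightarrow> ip r a a / 2 \<le> (real r / real n) * (\<Sum>j<n. (ip r (u (\<omega> j)) a)\<^sup>2)"
    using isotropic_lower_frame_bound[where u=u and M="samp r e", OF prob_space_samp[OF on r(1)] r
        samp_isotropic(1)[OF on r(1), folded u_def] samp_isotropic(2)[OF on r(1), folded u_def]
        samp_isotropic(3)[OF on r(1), folded u_def] \<delta> n]
    by blast
  have I_le: "I * I \<le> (\<integral>\<^sup>+f. (A f + ennreal (V f \<omega>)) \<partial>\<mu>)" if \<omega>: "\<omega> \<in> E" "\<And>i. i < n \<Longrightarrow> \<omega> i \<in> D" for \<omega>
  proof -
    have "I \<le> ennsqrt (\<integral>\<^sup>+f. (A f + ennreal (V f \<omega>)) \<partial>\<mu>)"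
      unfolding I_def A_def V_def
    proof (rule least_squares_upper_bound[where q="\<lambda>i. q (\<omega> i)", OF on n1 \<omega>(2)])
      show "0 \<le> q (\<omega> i)" for i using christoffel_nonneg by (simp add: q_def)
      show "(\<Sum>k<r. (a k)\<^sup>2) / 2 \<le> (\<Sum>i<n. q (\<omega> i) * (\<Sum>k<r. a k * e k (\<omega> i))\<^sup>2)" for a
      proof -
        \<comment> \<open>The normalisation of \<open>u\<close> moves into the weight: r/n divided
          by \<open>christoffel\<close> is \<open>q\<close>.\<close>
        have "(ip r (u x) a)\<^sup>2 = (\<Sum>k<r. a k * e k x)\<^sup>2 / ?S x" for x
        proof -
          have "ip r (u x) a = (\<Sum>k<r. a k * e k x) / sqrt (?S x)"
            by (simp add: ip_def u_def sum_divide_distrib mult.commute)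
          then show ?thesis using christoffel_nonneg[of r e x] by (simp add: power_divide)
        qed
        then have "(real r / real n) * (\<Sum>j<n. (ip r (u (\<omega> j)) a)\<^sup>2) = (\<Sum>i<n. q (\<omega> i) * (\<Sum>k<r. a k * e k (\<omega> i))\<^sup>2)"
          by (simp add: q_def sum_distrib_left)
        then show ?thesis using frame[OF \<omega>(1), of a] by (simp add: ip_def power2_eq_square)
      qed
    qed
    from mult_mono[OF this this] show ?thesis by (simp add: ennsqrt_mult_self)
  qed
  \<comment> \<open>Algorithms may sample only in \<open>D\<close>; configurations leaving it form a
    null set.\<close>
  have inD: "AE \<omega> in ?P. \<forall>i\<in>{..<n}. \<omega> i \<in> D"
    by (intro AE_finite_allI AE_PiM_component[OF prob_space_samp[OF on r(1)]] AE_samp_D[OF on]) auto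
  have "ennreal (1 - \<delta>) * (I * I) \<le> emeasure ?P E * (I * I)" by (intro mult_right_mono E) simp
  also have "\<dots> = (\<integral>\<^sup>+\<omega>. I * I * indicator E \<omega> \<partial>?P)"
    using E(1) by (simp add: nn_integral_cmult_indicator mult.commute)
  also have "\<dots> \<le> (\<integral>\<^sup>+\<omega>. \<integral>\<^sup>+f. (A f + ennreal (V f \<omega>)) \<partial>\<mu> \<partial>?P)"
  proof (rule nn_integral_mono_AE)
    show "AE \<omega> in ?P. I * I * indicator E \<omega> \<le> (\<integral>\<^sup>+f. (A f + ennreal (V f \<omega>)) \<partial>\<mu>)"
      using inD
    proof eventually_elim
      case (elim \<omega>)
      then show ?case using I_le[of \<omega>] by (cases "\<omega> \<in> E") auto
    qed
  qed
  \<comment> \<open>After the exchange f is fixed while the points vary, which is the situation of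
    \<open>expected_noise\<close>.\<close>
  also have "\<dots> = (\<integral>\<^sup>+f. \<integral>\<^sup>+\<omega>. (A f + ennreal (V f \<omega>)) \<partial>?P \<partial>\<mu>)"
    by (rule PM.Fubini'[OF Bm])
  also have "\<dots> \<le> (\<integral>\<^sup>+f. ennreal (1 + 4 * real r / real n) * A f \<partial>\<mu>)"
  proof (rule nn_integral_mono)
    fix f assume f: "f \<in> space \<mu>"
    have "(\<integral>\<^sup>+\<omega>. (A f + ennreal (V f \<omega>)) \<partial>?P) = A f + (\<integral>\<^sup>+\<omega>. ennreal (V f \<omega>) \<partial>?P)"
      using Vf[OF f] P.emeasure_space_1 by (simp add: nn_integral_add)
    also have "\<dots> \<le> A f + ennreal (4 * real r / real n) * A f"
      unfolding A_def V_def q_def using n1 by (intro add_left_mono expected_noise[OF on r(1)]) simp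
    also have "\<dots> = ennreal (1 + 4 * real r / real n) * A f"
      by (simp add: ennreal_plus distrib_right)
    finally show "(\<integral>\<^sup>+\<omega>. (A f + ennreal (V f \<omega>)) \<partial>?P) \<le> ennreal (1 + 4 * real r / real n) * A f" .
  qed
  also have "\<dots> = ennreal (1 + 4 * real r / real n) * (\<integral>\<^sup>+f. A f \<partial>\<mu>)" by (rule nn_integral_cmult[OF Am])
  finally show ?thesis by (simp add: A_def)
qed

text \<open>For r = 0 there is no sampling density, as it divides by r. The zero algorithm takes
  over, written as least squares with weight 0 at an arbitrary point of \<open>D\<close>.\<close>

lemma e_avg_std_le_trivial:
  assumes "n \<ge> 1"
  defines "I \<equiv> e_avg D \<rho> pe \<mu> n (Lambda_std D pe)"
  shows "I * I \<le> (\<integral>\<^sup>+f. \<integral>\<^sup>+x. ennreal ((residual 0 e f x)\<^sup>2) \<partial>N \<partial>\<mu>)"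
proof -
  obtain x0 where "x0 \<in> D" using D_nonempty by blast
  then have "I \<le> ennsqrt (\<integral>\<^sup>+f. \<integral>\<^sup>+x. ennreal ((residual 0 e f x)\<^sup>2) \<partial>N \<partial>\<mu>)"
    using least_squares_upper_bound[of 0 e n "\<lambda>_. x0" "\<lambda>_. 0"] assms by (simp add: orthonormal_def)
  from mult_mono[OF this this] show ?thesis by (simp add: ennsqrt_mult_self)
qed

end

theorem theorem2p1:
  fixes D :: "'a::euclidean_space set" and \<rho> :: "'a \<Rightarrow> real"
    and pe :: "'f::{banach,second_countable_topology} \<Rightarrow> 'a \<Rightarrow> real"
    and \<mu> :: "'f measure"
    and \<delta> :: real and m n :: nat
  assumes setting: "avg_setting D \<rho> pe \<mu>"
    and delta: "0 < \<delta>" "\<delta> < 1"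
    and mn: "m \<ge> 1" "n \<ge> 1"
    and m_def: "int m = \<lfloor>real n / (48 * (sqrt 2 * ln (2 * real n) - ln \<delta>))\<rfloor>"
  shows "e_avg D \<rho> pe \<mu> n (Lambda_std D pe)
         \<le> ennreal (sqrt (1 + 4 * real m / real n) * (1 / sqrt (1 - \<delta>))) * e_avg D \<rho> pe \<mu> m Lambda_all"
proof -
  interpret average_case D \<rho> pe \<mu> by unfold_locales (rule setting)
  let ?I = "e_avg D \<rho> pe \<mu> n (Lambda_std D pe)"
  let ?c = "sqrt (1 + 4 * real m / real n) * (1 / sqrt (1 - \<delta>))"
  define l where "l = 48 * (sqrt 2 * ln (2 * real n) - ln \<delta>)"
  have "0 < ln (2 * real n)" "ln \<delta> < 0" using mn delta by auto
  then have "0 < sqrt 2 * ln (2 * real n)" by simp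
  then have l0: "l > 0" using \<open>ln \<delta> < 0\<close> by (simp add: l_def)
  have "real m \<le> real n / l" using m_def by (simp add: l_def) linarith
  then have lm: "l * real m \<le> real n" using l0 by (simp add: field_simps)
  \<comment> \<open>A smaller rank only increases the oversampling ratio, so the concentration bound
    is available for every positive rank up to \<open>m\<close>.\<close>
  have lr: "l \<le> real n / real r" if "0 < r" "r \<le> m" for r
  proof -
    have "l * real r \<le> l * real m" using that l0 by simp
    then show ?thesis using lm that by (simp add: field_simps)
  qed
  \<comment> \<open>This yields m \<le> n, hence r \<le> n for the rank in the sampling
    argument.\<close>
  have l1: "1 \<le> l"
  proof -
    have "(1/2::real) \<le> ln 2" using ln_diff_le[of 1 2] by simp
    also have "\<dots> \<le> ln (2 * real n)" using mn by simp
    also have "\<dots> \<le> sqrt 2 * ln (2 * real n)" using \<open>0 < ln (2 * real n)\<close> by simp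
    finally show ?thesis using \<open>ln \<delta> < 0\<close> by (simp add: l_def)
  qed
  have "real m \<le> l * real m" using mult_right_mono[OF l1, of "real m"] by simp
  then have mn': "m \<le> n" using lm by simp
  have c0: "0 < ?c" using delta
    by (intro mult_pos_pos divide_pos_pos real_sqrt_gt_zero add_pos_nonneg) auto
  have "?I \<le> ennreal ?c * alg_err D \<rho> pe \<mu> m Ls \<phi>" if adm: "admissible D \<rho> m Lambda_all Ls \<phi>" for Ls \<phi>
  proof -
    let ?X = "\<integral>\<^sup>+f. Gnorm2 D \<rho> (\<lambda>x. pe f x - \<phi> (\<lambda>i\<in>{..<m}. Ls i f) x) \<partial>\<mu>"
    from subspace_lower_bound[OF adm] obtain r e where r: "r \<le> m" and on: "orthonormal N r e"
      and le: "(\<integral>\<^sup>+f. \<integral>\<^sup>+x. ennreal ((residual r e f x)\<^sup>2) \<partial>N \<partial>\<mu>) \<le> ?X" by blast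
    have "ennreal (1 - \<delta>) * (?I * ?I) \<le> ennreal (1 + 4 * real m / real n) * ?X"
    proof (cases "r = 0")
      case True
      have "ennreal (1 - \<delta>) * (?I * ?I) \<le> 1 * (?I * ?I)"
        using delta by (intro mult_right_mono) auto
      also have "\<dots> \<le> 1 * ?X" using e_avg_std_le_trivial[OF mn(2), of e] le True by simp
      also have "\<dots> \<le> ennreal (1 + 4 * real m / real n) * ?X"
        by (intro mult_right_mono) auto
      finally show ?thesis .
    next
      case False
      have "ennreal (1 - \<delta>) * (?I * ?I) \<le> ennreal (1 + 4 * real r / real n) *
          (\<integral>\<^sup>+f. \<integral>\<^sup>+x. ennreal ((residual r e f x)\<^sup>2) \<partial>N \<partial>\<mu>)"
        by (rule e_avg_std_le_subspace[OF on _ _ delta]) (use False r mn' lr[of r] in \<open>auto simp: l_def\<close>)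
      also have "\<dots> \<le> ennreal (1 + 4 * real m / real n) * ?X"
        using r le by (intro mult_mono ennreal_leI add_left_mono divide_right_mono) auto
      finally show ?thesis .
    qed
    then show ?thesis
      unfolding alg_err_def using delta by (intro le_ennsqrt_scaled) (auto intro!: add_pos_nonneg)
  qed
  then have "?I \<le> ennreal ?c * (INF p \<in> {(Ls, \<phi>). admissible D \<rho> m Lambda_all Ls \<phi>}. alg_err D \<rho> pe \<mu> m (fst p) (snd p))"
    by (intro le_mult_INF_ennreal[OF c0]) auto
  then show ?thesis using mn by (simp add: e_avg_def[of _ _ _ _ m])
qed

end
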